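(* Let $\alpha$ be an infinite permutation (that is, an $\mathbb N$-permutation). If $\alpha$ is not ultimately periodic, then $p^*_{\alpha}(n)\geq n$ for every integer $n\ge1$. Moreover, $p^*_{\alpha}(n)=n$ for all integers $n\ge 1$ if and only if $\alpha$ is a Sturmian permutation.
   Context: $\mathbb N=\{0,1,2,\dots\}$. An infinite permutation (or $\mathbb N$-permutation) $\alpha$ is an equivalence class of sequences $(a_s)_{s\in\mathbb N}$ of pairwise distinct real numbers, where $(a_s)\sim(b_s)$ if and only if for all $s,r\in\mathbb N$ one has $a_s<a_r \iff b_s<b_r$. Equivalently, it is a linear ordering of the index set $\mathbb N$; we write $\alpha_i<\alpha_j$ or $\alpha_i>\alpha_j$ for this order. The class of a sequence $a$ is denoted $\overline a$. For $i\ne j$ let $\gamma_{ij}\in\{<,>\}$ be the relation such that $\alpha_i\,\gamma_{ij}\,\alpha_j$. $\alpha$ is ultimately periodic if there are $t\ge1$ and $n_0$ such that $\gamma_{ij}=\gamma_{i+t,j+t}$ for all $i\neq j$ with $i,j>n_0$. A window is a finite set $T=\{0,m_1,\dots,m_{k-1}\}\subset\mathbb N$ with $0<m_1<\dots<m_{k-1}$; $\#T=k$. For $n\in\mathbb N$ the $T$-factor $\alpha_{T+n}$ is the restriction of $\alpha$ to $T+n$, regarded as a permutation on $T$ (via the shift by $n$). The number of distinct $T$-factors of $\alpha$ is denoted $p_\alpha(T)$, and the maximal pattern complexity of $\alpha$ is $p^*_\alpha(n)=\max_{\#T=n}p_\alpha(T)$. A one-sided infinite word $w=w_0w_1w_2\cdots$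 on $\{0,1\}$ is Sturmian if for every $n$ it has exactly $n+1$ distinct factors (blocks of consecutive letters) of length $n$. Sturmian permutations: let $w$ be a Sturmian word on $\{0,1\}$ and let $x,y>0$ be real numbers such that $kx\neq ly$ whenever $k$ is the number of $0$'s and $l$ is the number of $1$'s in some nonempty factor of $w$. Let $a_0$ be any real number and, for $i\ge0$, let $a_{i+1}=a_i+x$ if $w_i=0$ and $a_{i+1}=a_i-y$ if $w_i=1$. The $a_i$ are pairwise distinct, and the Sturmian permutation associated with $w,x,y$ is $\alpha(w,x,y)=\overline a$. A Sturmian permutation is any permutation of the form $\alpha(w,x,y)$. *)

theory Defs
  imports Complex_Main
begin

definition same_order :: "(nat \<Rightarrow> real) \<Rightarrow> (nat \<Rightarrow> real) \<Rightarrow> bool" where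
  "same_order a b \<longleftrightarrow> inj a \<and> inj b \<and> (\<forall>s r. a s < a r \<longleftrightarrow> b s < b r)"

text \<open>Since the partial equivalence only relates injective sequences, every element of this type
  is a class of sequences of pairwise distinct reals; \<open>perm_class a\<close> is meaningful only for
  injective \<open>a\<close>.\<close>

quotient_type infperm = "nat \<Rightarrow> real" / partial: same_order
  morphisms rep_infperm perm_class
proof (rule part_equivpI)
  show "\<exists>a. same_order a a"
    by (rule exI[of _ real]) (auto simp: same_order_def inj_def)
  show "symp same_order"
    by (auto simp: symp_def same_order_def)
  show "transp same_order"
    by (auto simp: transp_def same_order_def)
qed

lift_definition perm_less :: "infperm \<Rightarrow> nat \<Rightarrow> nat \<Rightarrow> bool"
  is "\<lambda>a i j. a i < a j"
  by (auto simp: same_order_def fun_eq_iff)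

lemma perm_less_perm_class:
  "inj a \<Longrightarrow> perm_less (perm_class a) i j \<longleftrightarrow> a i < a j"
  by (simp add: perm_less.abs_eq same_order_def)

lemma infperm_cases:
  obtains a where "inj a" "\<alpha> = perm_class a"
proof -
  have "\<exists>a. inj a \<and> \<alpha> = perm_class a"
    by (induction \<alpha> rule: infperm.abs_induct) (auto simp: same_order_def)
  with that show thesis by blast
qed

lemma perm_class_eq_iff:
  "inj a \<Longrightarrow> inj b \<Longrightarrow> perm_class a = perm_class b \<longleftrightarrow> (\<forall>s r. a s < a r \<longleftrightarrow> b s < b r)"
  using Quotient3_rel[OF Quotient3_infperm, of a b] by (simp add: same_order_def)

lemma infperm_eqI:
  assumes "\<And>i j. perm_less \<alpha> i j \<longleftrightarrow> perm_less \<beta> i j"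
  shows "\<alpha> = \<beta>"
proof -
  obtain a b where "inj a" "\<alpha> = perm_class a" "inj b" "\<beta> = perm_class b"
    using infperm_cases by metis
  with assms show ?thesis
    by (simp add: perm_class_eq_iff perm_less_perm_class)
qed

lemma perm_less_irrefl: "\<not> perm_less \<alpha> i i"
  by transfer simp

lemma perm_less_trans: "perm_less \<alpha> i j \<Longrightarrow> perm_less \<alpha> j k \<Longrightarrow> perm_less \<alpha> i k"
  by transfer simp

lemma perm_less_total: "i \<noteq> j \<Longrightarrow> perm_less \<alpha> i j \<or> perm_less \<alpha> j i"
proof -
  obtain a where a: "inj a" "\<alpha> = perm_class a"
    using infperm_cases by blast
  assume "i \<noteq> j"
  with a have "a i \<noteq> a j" by (simp add: inj_eq)
  with a show ?thesis by (auto simp: perm_less_perm_class)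
qed

text \<open>For \<open>i \<noteq> j\<close> the relation \<open>\<gamma>\<^sub>i\<^sub>j \<in> {<, >}\<close> is determined by the truth value of
  \<open>\<alpha>\<^sub>i < \<alpha>\<^sub>j\<close>.\<close>

definition ultimately_periodic :: "infperm \<Rightarrow> bool" where
  "ultimately_periodic \<alpha> \<longleftrightarrow>
     (\<exists>t\<ge>1. \<exists>n\<^sub>0. \<forall>i j. i \<noteq> j \<and> i > n\<^sub>0 \<and> j > n\<^sub>0 \<longrightarrow>
        (perm_less \<alpha> i j \<longleftrightarrow> perm_less \<alpha> (i + t) (j + t)))"

definition window :: "nat set \<Rightarrow> bool" where
  "window T \<longleftrightarrow> finite T \<and> 0 \<in> T"

text \<open>The permutation on \<open>T\<close> obtained from \<open>\<alpha>\<close> on \<open>T + n\<close>, as its strict order relation.\<close>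

definition window_factor :: "infperm \<Rightarrow> nat set \<Rightarrow> nat \<Rightarrow> nat rel" where
  "window_factor \<alpha> T n = {(i, j) \<in> T \<times> T. perm_less \<alpha> (i + n) (j + n)}"

definition window_complexity :: "infperm \<Rightarrow> nat set \<Rightarrow> nat" where
  "window_complexity \<alpha> T = card (range (window_factor \<alpha> T))"

definition max_pattern_complexity :: "infperm \<Rightarrow> nat \<Rightarrow> nat" where
  "max_pattern_complexity \<alpha> n = Max {window_complexity \<alpha> T |T. window T \<and> card T = n}"

text \<open>For \<open>n \<ge> 1\<close> the maximum is taken over a finite nonempty set of cardinalities of finite
  sets.\<close>

lemma window_factor_range: "range (window_factor \<alpha> T) \<subseteq> Pow (T \<times> T)"
  by (auto simp: window_factor_def)

lemma finite_window_factors: "window T \<Longrightarrow> finite (range (window_factor \<alpha> T))"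
  by (rule finite_subset[OF window_factor_range]) (simp add: window_def)

lemma finite_window_complexities:
  "finite {window_complexity \<alpha> T |T. window T \<and> card T = n}"
proof (rule finite_subset)
  show "{window_complexity \<alpha> T |T. window T \<and> card T = n} \<subseteq> {..2 ^ (n * n)}"
  proof
    fix c assume "c \<in> {window_complexity \<alpha> T |T. window T \<and> card T = n}"
    then obtain T where "c = window_complexity \<alpha> T" "window T" "card T = n" by blast
    moreover have "card (range (window_factor \<alpha> T)) \<le> card (Pow (T \<times> T))"
      using \<open>window T\<close> by (intro card_mono window_factor_range) (simp add: window_def)
    ultimately show "c \<in> {..2 ^ (n * n)}"
      by (simp add: window_complexity_def window_def card_Pow card_cartesian_product)
  qed
qed simp

lemma window_complexities_nonempty:
  assumes "n \<ge> 1"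
  shows "{window_complexity \<alpha> T |T. window T \<and> card T = n} \<noteq> {}"
proof -
  have "window {..<n}" "card {..<n} = n"
    using assms by (auto simp: window_def)
  then show ?thesis by blast
qed

definition factors :: "(nat \<Rightarrow> 'a) \<Rightarrow> nat \<Rightarrow> 'a list set" where
  "factors w n = {map w [i..<i + n] |i. True}"

definition sturmian_word :: "(nat \<Rightarrow> nat) \<Rightarrow> bool" where
  "sturmian_word w \<longleftrightarrow> range w \<subseteq> {0, 1} \<and> (\<forall>n. card (factors w n) = n + 1)"

primrec sturmian_seq :: "(nat \<Rightarrow> nat) \<Rightarrow> real \<Rightarrow> real \<Rightarrow> real \<Rightarrow> nat \<Rightarrow> real" where
  "sturmian_seq w x y a\<^sub>0 0 = a\<^sub>0"
| "sturmian_seq w x y a\<^sub>0 (Suc i) =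
     (if w i = 0 then sturmian_seq w x y a\<^sub>0 i + x else sturmian_seq w x y a\<^sub>0 i - y)"

definition admissible_steps :: "(nat \<Rightarrow> nat) \<Rightarrow> real \<Rightarrow> real \<Rightarrow> bool" where
  "admissible_steps w x y \<longleftrightarrow>
     x > 0 \<and> y > 0 \<and>
     (\<forall>n\<ge>1. \<forall>u\<in>factors w n. real (count_list u 0) * x \<noteq> real (count_list u 1) * y)"

definition sturmian_perm :: "infperm \<Rightarrow> bool" where
  "sturmian_perm \<alpha> \<longleftrightarrow>
     (\<exists>w x y a\<^sub>0. sturmian_word w \<and> admissible_steps w x y \<and>
        \<alpha> = perm_class (sturmian_seq w x y a\<^sub>0))"

lemma sturmian_seq_add:
  assumes "range w \<subseteq> {0, 1}"
  shows "sturmian_seq w x y a\<^sub>0 (i + n) = sturmian_seq w x y a\<^sub>0 i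
    + real (count_list (map w [i..<i + n]) 0) * x - real (count_list (map w [i..<i + n]) 1) * y"
proof (induction n)
  case (Suc n)
  have "w (i + n) = 0 \<or> w (i + n) = 1"
    using assms by auto
  with Suc show ?case
    by (auto simp: algebra_simps)
qed simp

lemma inj_sturmian_seq:
  assumes "sturmian_word w" "admissible_steps w x y"
  shows "inj (sturmian_seq w x y a\<^sub>0)"
proof (rule linorder_injI)
  fix i j :: nat assume "i < j"
  define n where "n = j - i"
  with \<open>i < j\<close> have n: "n \<ge> 1" "j = i + n" by auto
  have "map w [i..<i + n] \<in> factors w n"
    by (auto simp: factors_def)
  with assms n show "sturmian_seq w x y a\<^sub>0 i \<noteq> sturmian_seq w x y a\<^sub>0 j"
    using sturmian_seq_add[of w x y a\<^sub>0 i n]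
    by (auto simp: sturmian_word_def admissible_steps_def)
qed

lemma sturmian_seq_shift: "sturmian_seq w x y a\<^sub>0 i = sturmian_seq w x y 0 i + a\<^sub>0"
  by (induction i) auto

lemma perm_class_sturmian_seq:
  assumes "sturmian_word w" "admissible_steps w x y"
  shows "perm_class (sturmian_seq w x y a\<^sub>0) = perm_class (sturmian_seq w x y 0)"
  using assms
  by (subst perm_class_eq_iff) (auto simp: inj_sturmian_seq sturmian_seq_shift[of _ _ _ a\<^sub>0])

end

theory Submission
  imports Defs "HOL-Analysis.Kronecker_Approximation_Theorem"
begin

text \<open>Write \<open>R i j\<close> for \<open>\<alpha>\<^sub>i < \<alpha>\<^sub>j\<close>. If no element added to a window \<open>T\<close> increases the number of
  types, then the type of \<open>T + n\<close> determines all comparisons with the elements of \<open>T + n\<close>; the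
  sequence of these comparisons is then generated by a finite recursion, so \<open>\<alpha>\<close> is ultimately
  periodic. Hence the maximal complexity of a permutation that is not ultimately periodic grows
  strictly.

  For a Sturmian word the letter counts over the elements of a window form a chain, which gives
  the upper bound \<open>n\<close> for Sturmian permutations.

  Conversely assume that every window shows at most as many types as it has elements, and let \<open>w\<close>
  record the comparisons of neighbours. If \<open>w\<close> were ultimately periodic, then \<open>\<alpha>\<close> would be too: one
  passes to a modulus for which all residue classes are monotone and examines how two classes
  interleave. So \<open>w\<close> is Sturmian. Removing one element from \<open>{0..L}\<close> leaves a window that confuses two
  factors of length \<open>L\<close>, and it follows that \<open>R n (n + m)\<close> depends only on \<open>m\<close> and on the number of
  ones in between. Transitivity of \<open>R\<close> then forces the ratios of ones in the ascending and in the
  descending factors to be separated by a threshold, and the threshold yields the steps \<open>x\<close> and \<open>y\<close>.\<close>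

section \<open>Low factor complexity and periodicity\<close>

text \<open>The bound \<open>card T\<close> leaves no slack, and most contradictions consist in
  producing one type too many. The hard case is an ultimately periodic neighbour word. Its minimal
  period \<open>D\<close> makes \<open>D\<close> consecutive elements reveal the position modulo
  \<open>D\<close>, which uses up \<open>D\<close> types; a further element at lag \<open>m\<close>
  can add only one, so at each lag at most one residue class keeps varying. If a class varies at lag
  \<open>D\<close> itself, its word of comparisons is again ultimately periodic, with a period
  \<open>q\<close>, and \<open>D * q\<close> separates residues as well; a second failure at lag
  \<open>D * q\<close> would give \<open>2 * q + 1\<close> types on \<open>2 * q\<close> elements,
  so one refinement suffices. In the aperiodic case the discrepancies \<xi> order all count vectors
  linearly. Two blocks with the same final count can therefore be joined by changing the count at
  one interior place at a time, which is what leaving out one window element permits. The ratios may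
  leave no open gap for the threshold; then it must be the slope, which is irrational and so not
  attained.\<close>

definition ev_periodic :: "(nat \<Rightarrow> 'a) \<Rightarrow> bool" where
  "ev_periodic u \<longleftrightarrow> (\<exists>p\<ge>1. \<exists>N. \<forall>n\<ge>N. u (n + p) = u n)"

lemma map_upt_eq_iff:
  "map u [p..<p + k] = map v [q..<q + k] \<longleftrightarrow> (\<forall>s<k. u (p + s) = v (q + s))"
  by (auto simp: list_eq_iff_nth_eq)

lemma factors_eq_range: "factors u k = range (\<lambda>i. map u [i..<i + k])"
  by (auto simp: factors_def)

lemma factors_0: "factors u 0 = {[]}"
  by (auto simp: factors_def)

lemma finite_factors:
  assumes "finite (range u)"
  shows "finite (factors u k)"
proof (rule finite_subset)
  show "factors u k \<subseteq> {xs. set xs \<subseteq> range u \<and> length xs = k}"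
    by (auto simp: factors_def)
  show "finite {xs. set xs \<subseteq> range u \<and> length xs = k}"
    by (rule finite_lists_length_eq[OF assms])
qed

lemma image_take_factors: "take k ` factors u (Suc k) = factors u k"
  unfolding factors_eq_range image_image by (auto simp: image_def)

text \<open>Truncation maps the factors of length \<open>k + 1\<close> onto those of length
  \<open>k\<close>; without growth it is injective, so a factor has only one continuation.\<close>

lemma determined_if_card_factors_le:
  assumes "finite (range u)" "card (factors u (Suc k)) \<le> card (factors u k)"
    and "\<forall>s<k. u (p + s) = u (q + s)"
  shows "u (p + k) = u (q + k)"
proof -
  have fin: "finite (factors u (Suc k))" by (rule finite_factors[OF assms(1)])
  have "card (take k ` factors u (Suc k)) = card (factors u (Suc k))"
    using assms(2) card_image_le[OF fin, of "take k"] unfolding image_take_factors by simp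
  with fin have inj: "inj_on (take k) (factors u (Suc k))"
    by (rule eq_card_imp_inj_on)
  have mem: "map u [i..<i + Suc k] \<in> factors u (Suc k)" for i
    unfolding factors_def by blast
  have "take k (map u [p..<p + Suc k]) = take k (map u [q..<q + Suc k])"
    using assms(3) map_upt_eq_iff[of u p k u q] by simp
  from inj_onD[OF inj this mem mem] have "map u [p..<p + Suc k] = map u [q..<q + Suc k]" .
  then show ?thesis unfolding map_upt_eq_iff by auto
qed

text \<open>Pigeonhole among the first \<open>card (factors u k) + 1\<close> positions;
  determination then carries the coincidence forward forever. The bound on \<open>j\<close> is kept
  because \<open>factors_determine_phase\<close> plays it against a minimal period.\<close>

lemma coincidence_if_determined:
  assumes "finite (range u)"
    and det: "\<And>p q. (\<forall>s<k. u (p + s) = u (q + s)) \<Longrightarrow> u (p + k) = u (q + k)"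
  shows "\<exists>i j. i < j \<and> j \<le> card (factors u k) \<and> (\<forall>t. u (i + t) = u (j + t))"
proof -
  let ?f = "\<lambda>i. map u [i..<i + k]"
  have "\<not> inj_on ?f {..card (factors u k)}"
  proof
    assume "inj_on ?f {..card (factors u k)}"
    then have "card {..card (factors u k)} = card (?f ` {..card (factors u k)})"
      by (simp add: card_image)
    also have "\<dots> \<le> card (factors u k)"
      by (rule card_mono[OF finite_factors[OF assms(1)]]) (auto simp: factors_eq_range)
    finally show False by simp
  qed
  then obtain i' j' where ij': "i' \<le> card (factors u k)" "j' \<le> card (factors u k)" "i' \<noteq> j'"
    "?f i' = ?f j'"
    by (auto simp: inj_on_def)
  define i j where "i = min i' j'" and "j = max i' j'"
  have ij: "i < j" "j \<le> card (factors u k)" "?f i = ?f j"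
    using ij' by (auto simp: i_def j_def min_def max_def)
  have "\<forall>s<k. u (i + t + s) = u (j + t + s)" for t
  proof (induction t)
    case 0
    show ?case using ij(3) by (simp only: map_upt_eq_iff) simp
  next
    case (Suc t)
    have "u (i + t + k) = u (j + t + k)" using det Suc by blast
    with Suc have "\<forall>s<Suc k. u (i + t + s) = u (j + t + s)" by (auto simp: less_Suc_eq)
    then have "\<forall>s<k. u (i + t + Suc s) = u (j + t + Suc s)" by (metis Suc_mono)
    then show ?case by simp
  qed
  then have "u (i + t) = u (j + t)" for t
  proof -
    assume *: "\<And>t. \<forall>s<k. u (i + t + s) = u (j + t + s)"
    have "u (i + t' + k) = u (j + t' + k)" for t' using det * by blast
    then show "u (i + t) = u (j + t)"
    proof (cases "t < k")
      case True
      then show ?thesis using *[of 0] by simp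
    next
      case False
      then have "u (i + (t - k) + k) = u (j + (t - k) + k)"
        using \<open>\<And>t'. u (i + t' + k) = u (j + t' + k)\<close> by blast
      with False show ?thesis by simp
    qed
  qed
  with ij show ?thesis by blast
qed

lemma ev_periodicI:
  fixes u :: "nat \<Rightarrow> 'a"
  assumes "i < j" "\<forall>t. u (i + t) = u (j + t)"
  shows "\<forall>n\<ge>i. u (n + (j - i)) = u n"
proof (intro allI impI)
  fix n assume "n \<ge> i"
  then have n: "n = i + (n - i)" by simp
  define t where "t = n - i"
  with n have n: "n = i + t" by simp
  have "n + (j - i) = j + t" using assms(1) n by simp
  then show "u (n + (j - i)) = u n" using spec[OF assms(2), of t] n by (simp only:)
qed

lemma ev_periodic_if_coincidence:
  assumes "i < j" "\<forall>t. u (i + t) = u (j + t)"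
  shows "ev_periodic u"
  unfolding ev_periodic_def
proof (intro exI conjI)
  show "1 \<le> j - i" using assms(1) by simp
  show "\<forall>n\<ge>i. u (n + (j - i)) = u n" by (rule ev_periodicI[OF assms])
qed

lemma morse_hedlund:
  assumes "finite (range u)" "\<not> ev_periodic u"
  shows "k + 1 \<le> card (factors u k)"
proof (induction k)
  case 0
  show ?case by (simp add: factors_0)
next
  case (Suc k)
  have "card (factors u k) < card (factors u (Suc k))"
  proof (rule ccontr)
    assume "\<not> ?thesis"
    then obtain i j where "i < j" "\<forall>t. u (i + t) = u (j + t)"
      using coincidence_if_determined[OF assms(1), of k] determined_if_card_factors_le[OF assms(1)]
      by (metis not_less)
    from ev_periodic_if_coincidence[OF this] assms(2) show False by blast
  qed
  with Suc show ?case by simp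
qed

text \<open>For the minimal period \<open>q\<close> the number of factors must grow at every length
  below \<open>q\<close>, as a stationary length would yield a shorter period. So already length
  \<open>q - 1\<close> has \<open>q\<close> factors and tells the \<open>q\<close> phases apart; one
  letter less than a full period is what fits into the windows of
  \<open>separates_mult\<close>.\<close>

lemma factors_determine_phase:
  fixes u :: "nat \<Rightarrow> 'a"
  assumes "ev_periodic u"
  shows "\<exists>q\<ge>1. \<exists>N. (\<forall>n\<ge>N. u (n + q) = u n) \<and>
    (\<forall>i\<ge>N. \<forall>j\<ge>N. (\<forall>s<q - 1. u (i + s) = u (j + s)) \<longrightarrow> i mod q = j mod q)"
proof -
  let ?P = "\<lambda>p. p \<ge> 1 \<and> (\<exists>N. \<forall>n\<ge>N. u (n + p) = u n)"
  define q where "q = (LEAST p. ?P p)"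
  have "?P q" unfolding q_def
    using assms unfolding ev_periodic_def by (rule exE) (rule LeastI[of ?P], blast)
  then obtain N where q: "q \<ge> 1" "\<forall>n\<ge>N. u (n + q) = u n" by blast
  have minq: "q \<le> p" if "?P p" for p unfolding q_def by (rule Least_le[of ?P, OF that])
  define v where "v = (\<lambda>n. u (N + n))"
  have vq: "v (n + q) = v n" for n
    using q(2) by (simp add: v_def flip: add.assoc)
  have vqk: "v (n + k * q) = v n" for n k
    by (induction k) (simp_all add: vq flip: add.assoc, metis vq add.assoc add.commute)
  have vmod: "v n = v (n mod q)" for n
    using vqk[of "n mod q" "n div q"] by simp
  have fac: "factors v k = (\<lambda>i. map v [i..<i + k]) ` {..<q}" for k
  proof -
    have "map v [i..<i + k] = map v [i mod q..<i mod q + k]" for i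
      unfolding map_upt_eq_iff
      by (metis vmod mod_add_left_eq)
    moreover have "i mod q < q" for i using q(1) by simp
    ultimately show ?thesis unfolding factors_eq_range image_def by blast
  qed
  have "range v \<subseteq> v ` {..<q}"
    using vmod q(1) by (metis One_nat_def Suc_le_eq image_eqI image_subsetI lessThan_iff mod_less_divisor)
  then have finv: "finite (range v)" by (rule finite_subset) simp
  have "k \<le> q - 1 \<Longrightarrow> k + 1 \<le> card (factors v k)" for k
  proof (induction k)
    case 0
    show ?case by (simp add: factors_0)
  next
    case (Suc k)
    then have IH: "k + 1 \<le> card (factors v k)" by simp
    show ?case
    proof (rule ccontr)
      assume "\<not> ?thesis"
      with IH have le: "card (factors v (Suc k)) \<le> card (factors v k)"
        and c: "card (factors v (Suc k)) < Suc k + 1" by auto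
      have "card (factors v k) \<le> card (factors v (Suc k))"
        using card_image_le[OF finite_factors[OF finv], of "take k" "Suc k"]
        unfolding image_take_factors .
      with c have c': "card (factors v k) \<le> Suc k" by simp
      obtain i j where ij: "i < j" "j \<le> card (factors v k)" "\<forall>t. v (i + t) = v (j + t)"
        using coincidence_if_determined[OF finv, of k] determined_if_card_factors_le[OF finv le]
        by metis
      from ev_periodicI[OF ij(1,3)] have per: "\<forall>n\<ge>i. v (n + (j - i)) = v n" .
      have "\<forall>n\<ge>N + i. u (n + (j - i)) = u n"
      proof (intro allI impI)
        fix n assume "n \<ge> N + i"
        then show "u (n + (j - i)) = u n"
          using per[rule_format, of "n - N"] by (simp add: v_def)
      qed
      with minq[of "j - i"] ij(1) have "q \<le> j - i" by fastforce
      with ij c' Suc.prems q(1) show False by linarith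
    qed
  qed
  from this[of "q - 1"] have "q \<le> card (factors v (q - 1))" using q(1) by simp
  moreover have "card (factors v (q - 1)) \<le> q"
    unfolding fac using card_image_le[of "{..<q}"] by fastforce
  ultimately have "card ((\<lambda>i. map v [i..<i + (q - 1)]) ` {..<q}) = card {..<q}"
    unfolding fac by simp
  then have inj: "inj_on (\<lambda>i. map v [i..<i + (q - 1)]) {..<q}"
    by (intro eq_card_imp_inj_on) simp_all
  have "i mod q = j mod q" if "i \<ge> N" "j \<ge> N" and eq: "\<forall>s<q - 1. u (i + s) = u (j + s)" for i j
  proof -
    define i' j' where "i' = i - N" and "j' = j - N"
    have "\<forall>s<q - 1. v (i' + s) = v (j' + s)"
      using that by (simp add: v_def i'_def j'_def)
    then have "\<forall>s<q - 1. v (i' mod q + s) = v (j' mod q + s)"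
      by (metis vmod mod_add_left_eq)
    then have "map v [i' mod q..<i' mod q + (q - 1)] = map v [j' mod q..<j' mod q + (q - 1)]"
      unfolding map_upt_eq_iff .
    from inj_onD[OF inj this] have "i' mod q = j' mod q" using q(1) by simp
    then have "(N + i') mod q = (N + j') mod q" by (metis mod_add_right_eq)
    then show ?thesis using that by (simp add: i'_def j'_def)
  qed
  with q show ?thesis by blast
qed

text \<open>Each run length of \<open>c\<close> already accounts for one factor, so the factor starting
  with a letter other than \<open>c\<close> is unique, and the word repeats from each such letter.\<close>

lemma ev_periodic_if_long_runs:
  fixes u :: "nat \<Rightarrow> 'a"
  assumes "finite (range u)"
    and low: "\<And>k. card (factors u k) \<le> k + 1"
    and runs: "\<And>k. \<exists>p. \<forall>s<k. u (p + s) = c"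
  shows "ev_periodic u"
proof (rule ccontr)
  assume nper: "\<not> ev_periodic u"
  have io: "\<exists>n\<ge>N. u n \<noteq> c" for N
  proof (rule ccontr)
    assume "\<not> ?thesis"
    then have "\<forall>n\<ge>N. u (n + 1) = u n" by simp
    with nper show False unfolding ev_periodic_def by blast
  qed
  have uniq: "u (p + t) = u (p' + t)" if "u p \<noteq> c" "u p' \<noteq> c" for p p' t
  proof -
    define k where "k = Suc t"
    have "\<exists>x. (\<forall>s<i. u (x + s) = c) \<and> (i < k \<longrightarrow> u (x + i) \<noteq> c)" for i
    proof (cases "i < k")
      case True
      obtain y where y: "\<forall>s<i. u (y + s) = c" using runs by blast
      define z where "z = (LEAST n. n \<ge> y \<and> u n \<noteq> c)"
      have z: "z \<ge> y" "u z \<noteq> c" using LeastI_ex[OF io[of y, unfolded]] unfolding z_def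
        by blast+
      have zc: "u n = c" if "n \<ge> y" "n < z" for n
        using not_less_Least[of n "\<lambda>n. n \<ge> y \<and> u n \<noteq> c"] that unfolding z_def by blast
      have "z \<ge> y + i" using z y by (metis le_add_diff_inverse nat_add_left_cancel_less not_le)
      then have "(\<forall>s<i. u (z - i + s) = c) \<and> u (z - i + i) \<noteq> c" using zc z by auto
      then show ?thesis by blast
    next
      case False
      then show ?thesis using runs by blast
    qed
    then obtain x where x: "\<And>i s. s < i \<Longrightarrow> u (x i + s) = c" "\<And>i. i < k \<Longrightarrow> u (x i + i) \<noteq> c"
      by metis
    let ?f = "\<lambda>p. map u [p..<p + k]"
    let ?A = "(\<lambda>i. ?f (x i)) ` {1..k}"
    have inj: "inj_on (\<lambda>i. ?f (x i)) {1..k}"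
    proof (rule linorder_inj_onI')
      fix i j assume "i \<in> {1..k}" "j \<in> {1..k}" "i < j"
      then have "u (x i + i) \<noteq> u (x j + i)" "i < k" using x by auto
      then show "?f (x i) \<noteq> ?f (x j)" unfolding map_upt_eq_iff by blast
    qed
    have disj: "?f r \<notin> ?A" if "u r \<noteq> c" for r
    proof
      assume "?f r \<in> ?A"
      then obtain i where "i \<ge> 1" "?f r = ?f (x i)" by auto
      then have "u r = u (x i + 0)" unfolding map_upt_eq_iff
        by (metis add.right_neutral k_def zero_less_Suc)
      with x(1)[of 0 i] \<open>i \<ge> 1\<close> that show False by auto
    qed
    have "?f p = ?f p'"
    proof (rule ccontr)
      assume ne: "?f p \<noteq> ?f p'"
      have "card (insert (?f p) (insert (?f p') ?A)) = k + 2"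
        using ne disj that card_image[OF inj] by simp
      moreover have "insert (?f p) (insert (?f p') ?A) \<subseteq> factors u k"
        by (auto simp: factors_eq_range)
      ultimately have "k + 2 \<le> card (factors u k)"
        using card_mono[OF finite_factors[OF assms(1), of k], of "insert (?f p) (insert (?f p') ?A)"]
        by simp
      with low[of k] show False by simp
    qed
    then show ?thesis unfolding map_upt_eq_iff k_def by blast
  qed
  obtain p where p: "u p \<noteq> c" using io by blast
  obtain p' where p': "p' > p" "u p' \<noteq> c" using io[of "Suc p"] Suc_le_lessD by blast
  from ev_periodic_if_coincidence[of p p' u] uniq p p' nper show False by blast
qed

lemma common_period:
  fixes \<Phi> :: "'s \<Rightarrow> nat \<Rightarrow> nat \<Rightarrow> bool"
  assumes "finite S" "\<And>s. s \<in> S \<Longrightarrow> \<exists>P\<ge>1. \<exists>N. \<Phi> s P N"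
    and mult: "\<And>s P N k N'. \<Phi> s P N \<Longrightarrow> k \<ge> 1 \<Longrightarrow> N' \<ge> N \<Longrightarrow> \<Phi> s (k * P) N'"
  shows "\<exists>P\<ge>1. \<exists>N. \<forall>s\<in>S. \<Phi> s P N"
  using assms(1,2)
proof (induction S)
  case (insert s S)
  then obtain P N where P: "P \<ge> 1" "\<forall>s\<in>S. \<Phi> s P N" by auto
  obtain Q M where Q: "Q \<ge> 1" "\<Phi> s Q M" using insert.prems by blast
  have "\<forall>x\<in>insert s S. \<Phi> x (Q * P) (max N M)"
    using P Q mult[of _ P N Q "max N M"] mult[of s Q M P "max N M"] by (auto simp: mult.commute)
  moreover have "Q * P \<ge> 1" using P(1) Q(1) by simp
  ultimately show ?case by blast
qed auto

lemma ev_periodic_uniform: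
  assumes "finite S" "\<forall>s\<in>S. ev_periodic (v s)"
  shows "\<exists>p\<ge>1. \<exists>N. \<forall>s\<in>S. \<forall>n\<ge>N. v s (n + p) = v s n"
proof (rule common_period[where \<Phi> = "\<lambda>s p N. \<forall>n\<ge>N. v s (n + p) = v s n", OF assms(1)])
  show "\<exists>p\<ge>1. \<exists>N. \<forall>n\<ge>N. v s (n + p) = v s n" if "s \<in> S" for s
    using assms(2) that by (simp add: ev_periodic_def)
  fix s p N k N' assume per: "\<forall>n\<ge>N. v s (n + p) = v s n" and "k \<ge> (1 :: nat)" "N' \<ge> N"
  have "v s (n + k * p) = v s n" if "n \<ge> N" for n
  proof (induction k)
    case (Suc k)
    have "v s ((n + k * p) + p) = v s (n + k * p)" using per that by simp
    with Suc show ?case by (simp add: algebra_simps)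
  qed simp
  with \<open>N' \<ge> N\<close> show "\<forall>n\<ge>N'. v s (n + k * p) = v s n" by simp
qed

section \<open>Sturmian words\<close>

lemma not_ev_periodic_if_sturmian:
  assumes "sturmian_word w"
  shows "\<not> ev_periodic w"
proof
  assume "ev_periodic w"
  then obtain p N where p: "p \<ge> 1" "\<forall>n\<ge>N. w (n + p) = w n" by (auto simp: ev_periodic_def)
  have per: "w (n + k * p) = w n" if "n \<ge> N" for n k
  proof (induction k)
    case (Suc k)
    have "w ((n + k * p) + p) = w (n + k * p)" using p(2) that by simp
    with Suc show ?case by (simp add: algebra_simps)
  qed simp
  define k where "k = N + p"
  have "factors w k \<subseteq> (\<lambda>i. map w [i..<i + k]) ` {..<N + p}"
  proof
    fix x assume "x \<in> factors w k"
    then obtain i where x: "x = map w [i..<i + k]" by (auto simp: factors_def)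
    show "x \<in> (\<lambda>i. map w [i..<i + k]) ` {..<N + p}"
    proof (cases "i < N")
      case True
      then show ?thesis using x by auto
    next
      case False
      define j where "j = N + (i - N) mod p"
      have i: "i = j + ((i - N) div p) * p" using False by (simp add: j_def)
      have "w (i + s) = w (j + s)" for s
        using per[of "j + s" "(i - N) div p"] i by (simp add: j_def add_ac)
      then have "x = map w [j..<j + k]" unfolding x map_upt_eq_iff by blast
      moreover have "j < N + p" using p(1) by (simp add: j_def)
      ultimately show ?thesis by blast
    qed
  qed
  then have "card (factors w k) \<le> card {..<N + p}"
    by (meson card_image_le card_mono finite_imageI finite_lessThan order_trans)
  then show False using assms by (simp add: sturmian_word_def k_def)
qed

locale sturmian =
  fixes w :: "nat \<Rightarrow> nat"
  assumes sturmian: "sturmian_word w"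
begin

lemma w_cases: "w i = 0 \<or> w i = 1"
  using sturmian by (auto simp: sturmian_word_def)

lemma finite_range_w: "finite (range w)"
  using sturmian by (auto simp: sturmian_word_def intro: finite_subset)

lemma card_factors: "card (factors w k) = k + 1"
  using sturmian by (simp add: sturmian_word_def)

definition ones :: "nat \<Rightarrow> int" where
  "ones n = (\<Sum>i<n. int (w i))"

definition cnt :: "nat \<Rightarrow> nat \<Rightarrow> int" where
  "cnt n k = ones (n + k) - ones n"

lemma cnt_0 [simp]: "cnt n 0 = 0"
  by (simp add: cnt_def)

lemma cnt_1: "cnt n (Suc 0) = int (w n)"
  by (simp add: cnt_def ones_def)

lemma cnt_add: "cnt n (i + j) = cnt n i + cnt (n + i) j"
  by (simp add: cnt_def add.assoc)

lemma cnt_Suc: "cnt n (Suc k) = cnt n k + int (w (n + k))"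
  by (simp add: cnt_def ones_def)

lemma cnt_sum: "cnt n k = (\<Sum>i<k. int (w (n + i)))"
  by (induction k) (simp_all add: cnt_Suc)

text \<open>Positions \<open>p\<close> and \<open>q\<close> witness a right special factor of length
  \<open>k\<close>: one that is continued by both letters.\<close>

definition special :: "nat \<Rightarrow> nat \<Rightarrow> nat \<Rightarrow> bool" where
  "special k p q \<longleftrightarrow> (\<forall>s<k. w (p + s) = w (q + s)) \<and> w (p + k) \<noteq> w (q + k)"

lemma ex_special: "\<exists>p q. special k p q"
proof (rule ccontr)
  assume *: "\<nexists>p q. special k p q"
  have "inj_on (take k) (factors w (Suc k))"
  proof (rule inj_onI)
    fix x y assume "x \<in> factors w (Suc k)" "y \<in> factors w (Suc k)" and eq: "take k x = take k y"
    then obtain p q where x: "x = map w [p..<p + Suc k]" and y: "y = map w [q..<q + Suc k]"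
      by (auto simp: factors_def)
    have "map w [p..<p + k] = map w [q..<q + k]" using eq by (simp add: x y)
    then have "\<forall>s<k. w (p + s) = w (q + s)" unfolding map_upt_eq_iff .
    with * have "\<forall>s<Suc k. w (p + s) = w (q + s)" by (auto simp: special_def less_Suc_eq)
    then show "x = y" unfolding x y map_upt_eq_iff .
  qed
  then have "card (take k ` factors w (Suc k)) = card (factors w (Suc k))"
    by (rule card_image)
  then show False unfolding image_take_factors by (simp add: card_factors)
qed

text \<open>Passing from length \<open>k\<close> to \<open>k + 1\<close> adds exactly one factor.
  Two right special factors could each lose one continuation without any factor of length
  \<open>k\<close> losing its last, leaving at most \<open>k\<close> of them.\<close>

lemma special_unique:
  assumes "special k p p'" "special k q q'"
  shows "\<forall>s<k. w (p + s) = w (q + s)"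
proof (rule ccontr)
  assume ne: "\<not> ?thesis"
  define f where "f = (\<lambda>p. map w [p..<p + Suc k])"
  have sp: "take k (f p) = take k (f p')" "f p \<noteq> f p'" if "special k p p'" for p p'
    using that map_upt_eq_iff[of w p k w p'] by (simp_all add: special_def f_def)
  note p = sp[OF assms(1)] and q = sp[OF assms(2)]
  have tne: "take k (f p) \<noteq> take k (f q)"
    using ne map_upt_eq_iff[of w p k w q] by (simp add: f_def)
  have dist: "f p \<noteq> f q" "f p \<noteq> f q'" "f p' \<noteq> f q'" "f p' \<noteq> f q" using tne p(1) q(1) by metis+
  have fin: "finite (factors w (Suc k))" by (rule finite_factors[OF finite_range_w])
  have mem: "f i \<in> factors w (Suc k)" for i unfolding factors_def f_def by blast
  have "factors w k = take k ` (factors w (Suc k) - {f p', f q'})"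
  proof
    show "take k ` (factors w (Suc k) - {f p', f q'}) \<subseteq> factors w k"
      using image_take_factors by blast
    show "factors w k \<subseteq> take k ` (factors w (Suc k) - {f p', f q'})"
    proof
      fix x assume "x \<in> factors w k"
      then obtain y where y: "y \<in> factors w (Suc k)" "x = take k y"
        using image_take_factors by blast
      consider "y = f p'" | "y = f q'" | "y \<notin> {f p', f q'}" by blast
      then show "x \<in> take k ` (factors w (Suc k) - {f p', f q'})"
      proof cases
        case 1
        then have "x = take k (f p)" using y p(1) by simp
        moreover have "f p \<in> factors w (Suc k) - {f p', f q'}" using dist p(2) mem by simp
        ultimately show ?thesis by (rule image_eqI)
      next
        case 2
        then have "x = take k (f q)" using y q(1) by simp
        moreover have "f q \<in> factors w (Suc k) - {f p', f q'}" using dist q(2) mem by simp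
        ultimately show ?thesis by (rule image_eqI)
      next
        case 3
        with y show ?thesis by blast
      qed
    qed
  qed
  then have "card (factors w k) \<le> card (factors w (Suc k) - {f p', f q'})"
    using card_image_le[OF finite_Diff[OF fin], of "take k" "{f p', f q'}"] by (simp only:)
  also have "\<dots> = card (factors w (Suc k)) - 2"
    using dist(3) mem by (subst card_Diff_subset) auto
  finally show False by (simp add: card_factors)
qed

text \<open>A shortest unbalanced pair of blocks has the form \<open>1v1\<close>, \<open>0v0\<close> with \<open>v\<close> a palindrome.
  The unique right special factor of length \<open>|v| + 1\<close> is \<open>ev\<close> for a letter \<open>e\<close>, and it cannot
  occur close to the block that begins with the other letter; this leaves too few factors
  there for \<open>w\<close> to be aperiodic.\<close>

lemma balanced: "cnt n k - cnt n' k \<le> 1"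
proof (rule ccontr)
  assume "\<not> ?thesis"
  then have ex: "\<exists>k n n'. cnt n k - cnt n' k \<ge> 2" by (metis not_le zle_add1_eq_le one_add_one add.commute not_less)
  define k where "k = (LEAST k. \<exists>n n'. cnt n k - cnt n' k \<ge> 2)"
  obtain n n' where n: "cnt n k - cnt n' k \<ge> 2"
    using LeastI_ex[OF ex] unfolding k_def by blast
  have mink: "cnt i j - cnt i' j \<le> 1" if "j < k" for i i' j
  proof -
    have "\<not> 2 \<le> cnt i j - cnt i' j" using not_less_Least[OF that[unfolded k_def]] by blast
    then show ?thesis by simp
  qed
  have k2: "k \<ge> 2"
  proof (rule ccontr)
    assume "\<not> ?thesis"
    then consider "k = 0" | "k = Suc 0" by linarith
    then show False using n w_cases[of n] by cases (auto simp: cnt_1)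
  qed
  define l where "l = k - 2"
  have k: "k = Suc (Suc l)" using k2 by (simp add: l_def)
  \<comment> \<open>Cut at \<open>j\<close>: by minimality of \<open>k\<close> both parts differ by
    at most 1, and together by at least 2, so each differs by exactly 1. Hence the blocks agree
    except at their ends.\<close>
  have f1: "cnt n j - cnt n' j = 1" if "1 \<le> j" "j < k" for j
  proof -
    have "cnt n k = cnt n j + cnt (n + j) (k - j)" "cnt n' k = cnt n' j + cnt (n' + j) (k - j)"
      using cnt_add[of n j "k - j"] cnt_add[of n' j "k - j"] that by simp_all
    with mink[of "k - j" "n + j" "n' + j"] mink[of j n n'] that n show ?thesis by simp
  qed
  have mid: "w (n + j) = w (n' + j)" if "1 \<le> j" "j \<le> l" for j
    using f1[of j] f1[of "Suc j"] that k by (simp add: cnt_Suc)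
  have ends: "w n = 1" "w n' = 0"
    using f1[of 1] k w_cases[of n] w_cases[of n'] by (auto simp: cnt_1)
  have ends': "w (n + Suc l) = 1" "w (n' + Suc l) = 0"
    using f1[of "Suc l"] n k w_cases[of "n + Suc l"] w_cases[of "n' + Suc l"] cnt_Suc[of n "Suc l"]
      cnt_Suc[of n' "Suc l"] by auto
  \<comment> \<open>At the first place \<open>t\<close> violating the symmetry, a prefix of one
    block and a suffix of the other, both of length \<open>t + 1\<close>, have equal counts inside,
    while one begins and ends with 1 and the other with 0: an unbalanced pair shorter than
    \<open>k\<close>.\<close>
  have pal: "1 \<le> t \<Longrightarrow> t \<le> l \<Longrightarrow> w (n + t) = w (n + (Suc l - t))" for t
  proof (induction t rule: less_induct)
    case (less t)
    show ?case
    proof (rule ccontr)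
      assume ne: "w (n + t) \<noteq> w (n + (Suc l - t))"
      obtain t' where t: "t = Suc t'" using less.prems by (cases t) auto
      let ?Z = "cnt (n + 1) t'"
      have Z1: "cnt (n + (l + 1 - t')) t' = ?Z"
      proof -
        have "cnt (n + (l + 1 - t')) t' = (\<Sum>i<t'. int (w (n + (l + 1 - t') + (t' - Suc i))))"
          unfolding cnt_sum by (rule sum.nat_diff_reindex[symmetric])
        also have "\<dots> = (\<Sum>i<t'. int (w (n + 1 + i)))"
        proof (rule sum.cong)
          fix i assume "i \<in> {..<t'}"
          then have "w (n + (1 + i)) = w (n + (Suc l - (1 + i)))"
            using less.IH[of "1 + i"] less.prems t by auto
          moreover have "n + (l + 1 - t') + (t' - Suc i) = n + (Suc l - (1 + i))"
            using \<open>i \<in> {..<t'}\<close> less.prems t by auto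
          ultimately show "int (w (n + (l + 1 - t') + (t' - Suc i))) = int (w (n + 1 + i))"
            by (simp only: add.assoc)
        qed simp
        finally show ?thesis by (simp add: cnt_sum)
      qed
      have Z2: "cnt (n' + 1) t' = ?Z" unfolding cnt_sum
      proof (rule sum.cong)
        fix i assume "i \<in> {..<t'}"
        then show "int (w (n' + 1 + i)) = int (w (n + 1 + i))"
          using mid[of "1 + i"] less.prems t by (simp add: add.assoc)
      qed simp
      have "cnt (n' + (l + 1 - t')) t' = cnt (n + (l + 1 - t')) t'" unfolding cnt_sum
      proof (rule sum.cong)
        fix i assume "i \<in> {..<t'}"
        then show "int (w (n' + (l + 1 - t') + i)) = int (w (n + (l + 1 - t') + i))"
          using mid[of "l + 1 - t' + i"] less.prems t by (simp add: add.assoc)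
      qed simp
      with Z1 have Z3: "cnt (n' + (l + 1 - t')) t' = ?Z" by simp
      have C1: "cnt x (Suc t) = int (w x) + cnt (x + 1) t' + int (w (x + t))" for x
        using cnt_add[of x 1 t'] by (simp add: t cnt_Suc)
      have e: "n + (Suc l - t) + t = n + Suc l" "n' + (Suc l - t) + t = n' + Suc l"
        "n + (Suc l - t) + 1 = n + (l + 1 - t')" "n' + (Suc l - t) + 1 = n' + (l + 1 - t')"
        using less.prems t by simp_all
      have m: "w (n' + t) = w (n + t)" "w (n' + (Suc l - t)) = w (n + (Suc l - t))"
        using mid[of t] mid[of "Suc l - t"] less.prems by auto
      have lt: "Suc t < k" using less.prems k by simp
      show False
      proof (cases "w (n + t) = 1")
        case True
        then have "w (n + (Suc l - t)) = 0" using ne w_cases[of "n + (Suc l - t)"] by auto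
        then have "cnt n (Suc t) - cnt (n' + (Suc l - t)) (Suc t) = 2"
          unfolding C1 e using True ends ends' Z3 m by simp
        with mink[OF lt, of n "n' + (Suc l - t)"] show False by simp
      next
        case False
        then have "w (n + t) = 0" "w (n + (Suc l - t)) = 1"
          using ne w_cases[of "n + (Suc l - t)"] w_cases[of "n + t"] by auto
        then have "cnt (n + (Suc l - t)) (Suc t) - cnt n' (Suc t) = 2"
          unfolding C1 e using ends ends' Z1 Z2 m by simp
        with mink[OF lt, of "n + (Suc l - t)" n'] show False by simp
      qed
    qed
  qed
  have spv: "special l (n + 1) (n' + 1)"
    unfolding special_def
  proof (intro conjI allI impI)
    show "w (n + 1 + s) = w (n' + 1 + s)" if "s < l" for s
      using mid[of "1 + s"] that by (simp add: add.assoc)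
    show "w (n + 1 + l) \<noteq> w (n' + 1 + l)" using ends' by simp
  qed
  \<comment> \<open>Dropping its first letter leaves a right special factor of length
    \<open>l\<close>, which is the middle \<open>v\<close>; so this factor is \<open>w q\<close>
    followed by \<open>v\<close>.\<close>
  obtain q q' where q: "special (Suc l) q q'" using ex_special by blast
  have "special l (q + 1) (q' + 1)" using q unfolding special_def
    by (metis Suc_less_eq add.assoc plus_1_eq_Suc)
  from special_unique[OF this spv] have qs: "\<forall>s<l. w (q + 1 + s) = w (n + 1 + s)" .
  have qv: "w (q + t) = w (n + t)" if "1 \<le> t" "t \<le> l" for t
    using qs[rule_format, of "t - 1"] that by (simp add: add.assoc)
  \<comment> \<open>The block whose two end letters both differ from \<open>w q\<close>.\<close>
  define m where "m = (if w q = 0 then n else n')"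
  have m: "w m \<noteq> w q" "w (m + Suc l) \<noteq> w q" "\<And>t. 1 \<le> t \<Longrightarrow> t \<le> l \<Longrightarrow> w (m + t) = w (n + t)"
    using ends ends' mid by (auto simp: m_def)
  \<comment> \<open>An occurrence at an inner offset \<open>t\<close> puts \<open>w q\<close> at
    place \<open>t\<close> of the palindrome, hence at the mirrored place, which the occurrence
    aligns with the last letter of the block; that letter differs from \<open>w q\<close>.\<close>
  have noq: "\<not> (\<forall>s<Suc l. w (m + t + s) = w (q + s))" if "t \<le> Suc l" for t
  proof
    assume eq: "\<forall>s<Suc l. w (m + t + s) = w (q + s)"
    then have "w (m + t) = w q" by force
    with m(1,2) have t: "1 \<le> t" "t \<le> l"
      using that by (cases "t = 0"; cases "t = Suc l"; simp)+
    have "w (m + Suc l) = w (m + t + (Suc l - t))" using t by simp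
    also have "\<dots> = w (q + (Suc l - t))" using spec[OF eq, of "Suc l - t"] t by simp
    also have "\<dots> = w (n + (Suc l - t))" using qv[of "Suc l - t"] t by simp
    also have "\<dots> = w (n + t)" using pal t by simp
    also have "\<dots> = w (m + t)" using m(3) t by simp
    finally show False using \<open>w (m + t) = w q\<close> m(2) by simp
  qed
  define f where "f = (\<lambda>p. map w [p..<p + Suc l])"
  \<comment> \<open>There are \<open>l + 2\<close> factors of length \<open>l + 1\<close>; the
    special one is missing at these \<open>l + 2\<close> positions, so two of them agree.\<close>
  have "\<not> inj_on (\<lambda>t. f (m + t)) {..Suc l}"
  proof
    assume inj: "inj_on (\<lambda>t. f (m + t)) {..Suc l}"
    have "f q \<noteq> f (m + t)" if "t \<le> Suc l" for t
      using noq[OF that] map_upt_eq_iff[of w "m + t" "Suc l" w q]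
      unfolding f_def by metis
    then have "card (insert (f q) ((\<lambda>t. f (m + t)) ` {..Suc l})) = Suc (Suc (Suc l))"
      using card_image[OF inj] by (subst card_insert_disjoint) auto
    moreover have "insert (f q) ((\<lambda>t. f (m + t)) ` {..Suc l}) \<subseteq> factors w (Suc l)"
      by (auto simp: factors_eq_range f_def simp del: upt_Suc)
    ultimately have "Suc (Suc (Suc l)) \<le> card (factors w (Suc l))"
      using card_mono[OF finite_factors[OF finite_range_w]] by metis
    then show False by (simp add: card_factors)
  qed
  then obtain i' j' where ij': "i' \<le> Suc l" "j' \<le> Suc l" "i' < j'" "f (m + i') = f (m + j')"
    unfolding inj_on_def by (metis atMost_iff linorder_neqE_nat)
  define i d where "i = m + i'" and "d = j' - i'"
  have d: "d > 0" "i' + d \<le> Suc l" "\<forall>s<Suc l. w (i + s) = w (i + d + s)"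
    using ij' map_upt_eq_iff[of w "m + i'" "Suc l" w "m + j'"] by (auto simp: i_def d_def f_def)
  \<comment> \<open>A factor that is not special fixes the next letter, so the coincidence moves on
    by one; from offset \<open>d\<close> on each position repeats an earlier one, so the special
    factor never appears.\<close>
  have "(\<forall>s<Suc l. w (i + t + s) = w (i + d + t + s)) \<and> \<not> (\<forall>s<Suc l. w (i + t + s) = w (q + s))" for t
  proof (induction t rule: less_induct)
    case (less t)
    have Q: "\<not> (\<forall>s<Suc l. w (i + t + s) = w (q + s))"
    proof (cases "t < d")
      case True
      then show ?thesis using noq[of "i' + t"] d(2) by (simp add: i_def add.assoc)
    next
      case False
      then have "t - d < t" "t = (t - d) + d" using d(1) by auto
      with less[of "t - d"] show ?thesis by (metis add.assoc add.commute)
    qed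
    have P: "\<forall>s<Suc l. w (i + t + s) = w (i + d + t + s)"
    proof (cases t)
      case 0
      then show ?thesis using d(3) by simp
    next
      case (Suc t')
      have P': "\<forall>s<Suc l. w (i + t' + s) = w (i + d + t' + s)"
        and Q': "\<not> (\<forall>s<Suc l. w (i + t' + s) = w (q + s))"
        using less[of t'] Suc by auto
      have "w (i + t' + Suc l) = w (i + d + t' + Suc l)"
        using special_unique[OF _ q, of "i + t'" "i + d + t'"] P' Q' by (auto simp: special_def)
      with P' have "\<forall>s<Suc (Suc l). w (i + t' + s) = w (i + d + t' + s)" by (auto simp: less_Suc_eq)
      then show ?thesis using Suc by (metis Suc_less_eq add_Suc_right add_Suc)
    qed
    from P Q show ?case by blast
  qed
  then have "w (i + t) = w (i + d + t)" for t by (metis add.right_neutral zero_less_Suc)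
  then have "ev_periodic w" using ev_periodic_if_coincidence[of i "i + d" w] d(1) by simp
  with not_ev_periodic_if_sturmian[OF sturmian] show False by blast
qed

section \<open>Slope and discrepancy of a Sturmian word\<close>

lemma ones_bounds:
  assumes "\<And>i. a \<le> cnt i k" "\<And>i. cnt i k \<le> b"
  shows "int l * a \<le> cnt n (l * k)" "cnt n (l * k) \<le> int l * b"
proof (induction l)
  case (Suc l)
  {
    case 1
    then show ?case using Suc(1) assms(1)[of "n + l * k"] cnt_add[of n "l * k" k]
      by (simp add: algebra_simps)
  next
    case 2
    then show ?case using Suc(2) assms(2)[of "n + l * k"] cnt_add[of n "l * k" k]
      by (simp add: algebra_simps)
  }
qed simp_all

text \<open>Cutting a block of length \<open>k * l\<close> in both ways compares, by balance, the
  estimates from lengths \<open>k\<close> and \<open>l\<close>, so every lower bound lies below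
  every upper bound.\<close>

lemma ex_slope: "\<exists>\<theta>::real. \<forall>n k. \<bar>real_of_int (cnt n k) - k * \<theta>\<bar> \<le> 1"
proof -
  let ?A = "{(real_of_int (cnt n k) - 1) / k |n k. k \<ge> 1}"
  have le: "(real_of_int (cnt n k) - 1) / k \<le> (real_of_int (cnt n' l) + 1) / l"
    if "k \<ge> 1" "l \<ge> 1" for n k n' l
  proof -
    have "int l * (cnt n k - 1) \<le> cnt 0 (l * k)"
    proof (rule ones_bounds(1)[of _ _ "cnt n k + 1"])
      show "cnt n k - 1 \<le> cnt i k" for i using balanced[of n k i] by simp
      show "cnt i k \<le> cnt n k + 1" for i using balanced[of i k n] by simp
    qed
    moreover have "cnt 0 (k * l) \<le> int k * (cnt n' l + 1)"
    proof (rule ones_bounds(2)[of "cnt n' l - 1"])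
      show "cnt n' l - 1 \<le> cnt i l" for i using balanced[of n' l i] by simp
      show "cnt i l \<le> cnt n' l + 1" for i using balanced[of i l n'] by simp
    qed
    ultimately have "int l * (cnt n k - 1) \<le> int k * (cnt n' l + 1)" by (simp add: mult.commute)
    then have "real_of_int (int l * (cnt n k - 1)) \<le> real_of_int (int k * (cnt n' l + 1))"
      by (simp only: of_int_le_iff)
    then show ?thesis using that by (simp add: field_simps)
  qed
  have ne: "?A \<noteq> {}" by auto
  have bdd: "bdd_above ?A" using le[of _ 1] unfolding bdd_above_def by blast
  define \<theta> where "\<theta> = Sup ?A"
  have lo: "(real_of_int (cnt n k) - 1) / k \<le> \<theta>" if "k \<ge> 1" for n k
    unfolding \<theta>_def by (rule cSup_upper[OF _ bdd]) (use that in blast)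
  have hi: "\<theta> \<le> (real_of_int (cnt n k) + 1) / k" if "k \<ge> 1" for n k
    unfolding \<theta>_def by (rule cSup_least[OF ne]) (use that le in blast)
  have "\<bar>real_of_int (cnt n k) - k * \<theta>\<bar> \<le> 1" for n k
  proof (cases "k = 0")
    case False
    then show ?thesis using lo[of k n] hi[of k n] by (simp add: field_simps abs_le_iff)
  qed simp
  then show ?thesis by blast
qed

text \<open>If \<open>k * \<theta>\<close> were an integer \<open>h\<close>, the deviations of
  \<open>cnt n k\<close> from \<open>h\<close> would never take both signs, by balance, while their
  sums along a progression of step \<open>k\<close> stay within 1. Each progression would carry at
  most one nonzero deviation, and \<open>w\<close> would have period \<open>k\<close> from some
  point on.\<close>

lemma slope_mult_notin_Ints:
  fixes k :: nat and \<theta> :: real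
  assumes \<theta>: "\<And>n k. \<bar>real_of_int (cnt n k) - k * \<theta>\<bar> \<le> 1" and "k \<ge> 1"
  shows "k * \<theta> \<notin> \<int>"
proof
  assume "k * \<theta> \<in> \<int>"
  then obtain h :: int where h: "k * \<theta> = h" by (auto simp: Ints_def)
  define f where "f n = cnt n k - h" for n
  have f01: "\<bar>f n\<bar> \<le> 1" for n
    using \<theta>[of n k] unfolding h f_def by linarith
  have sum: "cnt n (l * k) = (\<Sum>i<l. f (n + i * k)) + int l * h" for n l
  proof (induction l)
    case (Suc l)
    have "cnt n (Suc l * k) = cnt n (l * k) + cnt (n + l * k) k"
      using cnt_add[of n "l * k" k] by (simp add: add.commute)
    with Suc show ?case by (simp add: f_def distrib_right)
  qed simp
  have sumb: "\<bar>\<Sum>i<l. f (n + i * k)\<bar> \<le> 1" for n l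
  proof -
    have "real (l * k) * \<theta> = real l * (real k * \<theta>)" by simp
    also have "\<dots> = real_of_int (int l * h)" unfolding h by simp
    finally have "real (l * k) * \<theta> = real_of_int (int l * h)" .
    with \<theta>[of n "l * k"] have "\<bar>real_of_int (\<Sum>i<l. f (n + i * k))\<bar> \<le> 1"
      unfolding sum by (simp only: of_int_add add_diff_cancel_right')
    then show ?thesis by linarith
  qed
  have sgn: "f n - f m \<le> 1" for n m using balanced[of n k m] by (simp add: f_def)
  have one: "f (n + i * k) = 0 \<or> f (n + j * k) = 0" if "i < j" for n i j
  proof (rule ccontr)
    assume ne: "\<not> ?thesis"
    define g where "g t = f (n + i * k + t * k)" for t
    define s where "s = g 0"
    have g0: "g 0 \<noteq> 0" "g (j - i) \<noteq> 0"
      using ne that by (simp_all add: g_def flip: distrib_right add.assoc) (simp add: add.assoc flip: distrib_right)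
    have s1: "s = 1 \<or> s = -1" using g0 f01[of "n + i * k"] by (auto simp: s_def g_def)
    have sg: "s * g t \<ge> 0" for t
      using s1 sgn[of "n + i * k" "n + i * k + t * k"] sgn[of "n + i * k + t * k" "n + i * k"]
      by (auto simp: s_def g_def)
    have pos: "s * g 0 \<ge> 1" "s * g (j - i) \<ge> 1"
      using sg[of 0] sg[of "j - i"] g0 s1 by auto
    have "{0, j - i} \<subseteq> {..<Suc (j - i)}" by auto
    then have "(\<Sum>t\<in>{0, j - i}. s * g t) \<le> (\<Sum>t<Suc (j - i). s * g t)"
      using sg by (intro sum_mono2) auto
    moreover have "(\<Sum>t\<in>{0, j - i}. s * g t) \<ge> 2" using pos that by simp
    moreover have "(\<Sum>t<Suc (j - i). s * g t) = s * (\<Sum>t<Suc (j - i). g t)"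
      by (simp only: sum_distrib_left)
    ultimately have "s * (\<Sum>t<Suc (j - i). g t) \<ge> 2" by linarith
    with s1 sumb[where n = "n + i * k" and l = "Suc (j - i)"] show False
      unfolding g_def by auto
  qed
  have ex: "\<exists>N. \<forall>i\<ge>N. f (n + i * k) = 0" for n
  proof (cases "\<exists>i. f (n + i * k) \<noteq> 0")
    case True
    then obtain i where "f (n + i * k) \<noteq> 0" by blast
    then have "\<forall>j\<ge>Suc i. f (n + j * k) = 0" using one[of i _ n] Suc_le_lessD by blast
    then show ?thesis by blast
  qed auto
  then obtain N where N: "\<And>n i. i \<ge> N n \<Longrightarrow> f (n + i * k) = 0" by metis
  define M where "M = Max (N ` {..<k})"
  have f0: "f n = 0" if "n \<ge> Suc M * k" for n
  proof -
    have "N (n mod k) \<le> M" unfolding M_def using assms(2) by (intro Max_ge) auto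
    also have "M \<le> n div k" using div_le_mono[OF that, of k] assms(2) by simp
    finally show ?thesis using N[of "n mod k" "n div k"] by simp
  qed
  have "w (n + k) = w n" if "n \<ge> Suc M * k" for n
  proof -
    have "cnt n (Suc k) = int (w n) + cnt (Suc n) k" using cnt_add[of n 1 k] by (simp add: cnt_1)
    moreover have "cnt n (Suc k) = cnt n k + int (w (n + k))" by (rule cnt_Suc)
    ultimately show ?thesis using f0[of n] f0[of "Suc n"] that by (simp add: f_def)
  qed
  then have "ev_periodic w" unfolding ev_periodic_def using assms(2) by blast
  with not_ev_periodic_if_sturmian[OF sturmian] show False by blast
qed

definition slope :: real where
  "slope = (SOME \<theta> :: real. \<forall>n k. \<bar>real_of_int (cnt n k) - k * \<theta>\<bar> \<le> 1)"

lemma slope_le: "\<bar>real_of_int (cnt n k) - k * slope\<bar> \<le> 1"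
  using someI_ex[OF ex_slope] unfolding slope_def by blast

lemma slope_notin_Ints: "k \<ge> 1 \<Longrightarrow> real k * slope \<notin> \<int>"
  by (rule slope_mult_notin_Ints[OF slope_le])

text \<open>The discrepancy of the prefix. Modulo 1 it is the orbit of 0 under rotation by
  \<open>- slope\<close>, and all its values fit into a strip of width 1.\<close>

definition \<xi> :: "nat \<Rightarrow> real" where
  "\<xi> n = ones n - n * slope"

lemma cnt_eq_\<xi>: "real_of_int (cnt n k) = k * slope + \<xi> (n + k) - \<xi> n"
  by (simp add: cnt_def \<xi>_def algebra_simps)

lemma \<xi>_neq: "i \<noteq> j \<Longrightarrow> \<xi> i \<noteq> \<xi> j"
proof (induction i j rule: linorder_wlog)
  case (le i j)
  show ?case
  proof
    assume "\<xi> i = \<xi> j"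
    then have "real (j - i) * slope = real_of_int (cnt i (j - i))"
      using cnt_eq_\<xi>[of i "j - i"] le by simp
    then have "real (j - i) * slope \<in> \<int>" by (simp only: Ints_of_int)
    moreover have "j - i \<ge> 1" using le by simp
    ultimately show False using slope_notin_Ints by blast
  qed
qed auto

lemma \<xi>_diff_less: "\<bar>\<xi> i - \<xi> j\<bar> < 1"
proof (induction i j rule: linorder_wlog)
  case (le i j)
  show ?case
  proof (cases "i = j")
    case False
    define k where "k = j - i"
    have k: "k \<ge> 1" "j = i + k" using False le by (simp_all add: k_def)
    have d: "\<xi> j - \<xi> i = real_of_int (cnt i k) - k * slope"
      using cnt_eq_\<xi>[of i k] k by simp
    have "k * slope \<noteq> real_of_int (cnt i k - 1)" "k * slope \<noteq> real_of_int (cnt i k + 1)"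
      using slope_notin_Ints[OF k(1)] by (metis Ints_of_int)+
    with slope_le[of i k] d show ?thesis by (simp add: abs_if split: if_splits)
  qed simp
next
  case (sym i j)
  then show ?case by (simp add: abs_minus_commute)
qed

text \<open>The difference is an integer and the sum of a number in (-1, 1) and one in (0, 1). Thus
  \<xi> orders the count vectors of all positions linearly, uniformly in \<open>k\<close>.\<close>

lemma cnt_diff_cases:
  assumes "\<xi> n < \<xi> n'"
  shows "cnt n k - cnt n' k = 0 \<or> cnt n k - cnt n' k = 1"
proof -
  have "real_of_int (cnt n k - cnt n' k) = (\<xi> (n + k) - \<xi> (n' + k)) + (\<xi> n' - \<xi> n)"
    using cnt_eq_\<xi>[of n k] cnt_eq_\<xi>[of n' k] by simp
  moreover have "\<bar>\<xi> (n + k) - \<xi> (n' + k)\<bar> < 1" "\<bar>\<xi> n' - \<xi> n\<bar> < 1" by (rule \<xi>_diff_less)+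
  ultimately have "-1 < real_of_int (cnt n k - cnt n' k)" "real_of_int (cnt n k - cnt n' k) < 2"
    using assms by linarith+
  then show ?thesis by linarith
qed

lemma ex_letter: "\<exists>n\<ge>N. w n = 0" "\<exists>n\<ge>N. w n = 1"
proof -
  have "\<exists>n\<ge>N. w n \<noteq> e" for e
  proof (rule ccontr)
    assume "\<not> ?thesis"
    then have "\<forall>n\<ge>N. w (n + 1) = w n" by simp
    then have "ev_periodic w" unfolding ev_periodic_def by blast
    with not_ev_periodic_if_sturmian[OF sturmian] show False by blast
  qed
  from this[of 1] this[of 0] show "\<exists>n\<ge>N. w n = 0" "\<exists>n\<ge>N. w n = 1"
    using w_cases by metis+
qed

lemma slope_bounds: "0 < slope" "slope < 1"
proof -
  obtain m n where "w m = 0" "w n = 1" using ex_letter by blast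
  then have "\<bar>slope\<bar> < 1 \<or> \<bar>slope\<bar> = 1" "\<bar>1 - slope\<bar> \<le> 1"
    using slope_le[of m 1] slope_le[of n 1] by (auto simp: cnt_1)
  moreover have "slope \<noteq> 0" "slope \<noteq> 1" "slope \<noteq> -1"
    using slope_notin_Ints[of 1] by (metis Ints_0 Ints_1 Ints_minus mult_1 of_nat_1 order_refl)+
  ultimately show "0 < slope" "slope < 1" by auto
qed

end

section \<open>Order types of windows\<close>

definition order_type :: "(nat \<Rightarrow> nat \<Rightarrow> bool) \<Rightarrow> nat set \<Rightarrow> nat \<Rightarrow> nat rel" where
  "order_type R T n = {(i, j) \<in> T \<times> T. R (i + n) (j + n)}"

definition order_periodic :: "(nat \<Rightarrow> nat \<Rightarrow> bool) \<Rightarrow> bool" where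
  "order_periodic R \<longleftrightarrow>
    (\<exists>t\<ge>1. \<exists>N. \<forall>i j. i \<noteq> j \<and> i > N \<and> j > N \<longrightarrow> (R i j \<longleftrightarrow> R (i + t) (j + t)))"

lemma order_type_eq_iff:
  "order_type R T n = order_type R T n' \<longleftrightarrow> (\<forall>i\<in>T. \<forall>j\<in>T. R (i + n) (j + n) \<longleftrightarrow> R (i + n') (j + n'))"
  by (auto simp: order_type_def set_eq_iff)

lemma order_type_eqD:
  assumes "order_type R T n = order_type R T n'" "i \<in> T" "j \<in> T"
  shows "R (n + i) (n + j) \<longleftrightarrow> R (n' + i) (n' + j)"
  using assms by (auto simp: order_type_eq_iff add.commute)

lemma finite_range_order_type: "finite T \<Longrightarrow> finite (range (order_type R T))"
  by (rule finite_subset[of _ "Pow (T \<times> T)"]) (auto simp: order_type_def)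

lemma order_type_mono:
  "T \<subseteq> U \<Longrightarrow> order_type R U n = order_type R U n' \<Longrightarrow> order_type R T n = order_type R T n'"
  unfolding order_type_eq_iff by blast

lemma order_type_subset_image:
  "T \<subseteq> U \<Longrightarrow> (\<lambda>s. s \<inter> T \<times> T) ` range (order_type R U) = range (order_type R T)"
  unfolding image_image by (rule image_cong) (auto simp: order_type_def)

locale index_order =
  fixes R :: "nat \<Rightarrow> nat \<Rightarrow> bool"
  assumes irrefl: "\<not> R i i"
    and trans: "R i j \<Longrightarrow> R j k \<Longrightarrow> R i k"
    and total: "i \<noteq> j \<Longrightarrow> R i j \<or> R j i"
begin

lemma flip: "i \<noteq> j \<Longrightarrow> R j i \<longleftrightarrow> \<not> R i j"
  using irrefl trans total by blast

lemma converse_order: "index_order (\<lambda>i j. R j i)"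
  by unfold_locales (use irrefl trans total in blast)+

lemma order_periodicI:
  assumes "t \<ge> 1" "\<And>n m. n \<ge> N \<Longrightarrow> m \<ge> 1 \<Longrightarrow> R n (n + m) \<longleftrightarrow> R (n + t) (n + t + m)"
  shows "order_periodic R"
  unfolding order_periodic_def
proof (rule exI[of _ t], rule conjI[OF assms(1)], rule exI[of _ N], intro allI impI)
  fix i j assume ij: "i \<noteq> j \<and> i > N \<and> j > N"
  have less: "R i j \<longleftrightarrow> R (i + t) (j + t)" if "i < j" "i > N" for i j
    using assms(2)[of i "j - i"] that by (simp add: add.commute add.left_commute)
  show "R i j \<longleftrightarrow> R (i + t) (j + t)"
  proof (cases "i < j")
    case True
    with less ij show ?thesis by blast
  next
    case False
    with ij have "R j i \<longleftrightarrow> R (j + t) (i + t)" using less[of j i] by simp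
    with ij flip[of i j] flip[of "i + t" "j + t"] show ?thesis by simp
  qed
qed

lemma ex_splitting_element:
  assumes "\<not> order_periodic R" "finite T" "0 \<in> T"
  shows "\<exists>m. card (range (order_type R T)) < card (range (order_type R (insert m T)))"
proof (rule ccontr)
  assume "\<not> ?thesis"
  then have le: "card (range (order_type R (insert m T))) \<le> card (range (order_type R T))" for m
    by (simp add: not_less)
  have ext: "order_type R (insert m T) n = order_type R (insert m T) n'"
    if "order_type R T n = order_type R T n'" for m n n'
  proof -
    let ?r = "\<lambda>s. s \<inter> T \<times> T"
    let ?A = "range (order_type R (insert m T))"
    have fin: "finite ?A" using assms(2) by (simp add: finite_range_order_type)
    have im: "?r ` ?A = range (order_type R T)" by (rule order_type_subset_image) blast
    have "card (?r ` ?A) = card ?A"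
      using le[of m] card_image_le[OF fin, of ?r] im by simp
    with fin have inj: "inj_on ?r ?A" by (rule eq_card_imp_inj_on)
    have r: "?r (order_type R (insert m T) k) = order_type R T k" for k
      by (auto simp: order_type_def)
    have "?r (order_type R (insert m T) n) = ?r (order_type R (insert m T) n')"
      unfolding r by (rule that)
    from inj_onD[OF inj this rangeI rangeI] show ?thesis .
  qed
  \<comment> \<open>The whole future of \<open>n\<close>: although infinite, it is a function of the
    type of \<open>T + n\<close> and so takes finitely many values.\<close>
  define \<phi> where "\<phi> n = (\<lambda>m. R n (n + m))" for n
  have \<phi>: "\<phi> (n + i) = \<phi> (n' + i)" if "order_type R T n = order_type R T n'" "i \<in> T" for n n' i
  proof
    fix m
    show "\<phi> (n + i) m = \<phi> (n' + i) m"
      using order_type_eqD[OF ext[OF that(1)], of i "i + m" "i + m"] that(2)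
      by (simp add: \<phi>_def add.assoc)
  qed
  define l where "l = Max T"
  have l: "l \<in> T" "\<And>i. i \<in> T \<Longrightarrow> i \<le> l" unfolding l_def using assms(2,3) by (auto intro: Max_in Max_ge)
  have fin: "finite (range \<phi>)"
  proof -
    have "\<phi> n = (\<lambda>s. \<phi> (SOME k. order_type R T k = s)) (order_type R T n)" for n
      using \<phi>[of n "SOME k. order_type R T k = order_type R T n" 0]
        someI[of "\<lambda>k. order_type R T k = order_type R T n" n] assms(3) by simp
    then have "range \<phi> \<subseteq> (\<lambda>s. \<phi> (SOME k. order_type R T k = s)) ` range (order_type R T)" by blast
    then show ?thesis by (rule finite_subset) (simp add: finite_range_order_type assms(2))
  qed
  \<comment> \<open>Every comparison inside \<open>T + p\<close> can be read at its smaller element,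
    which lies before \<open>p + l\<close>; so \<open>l\<close> consecutive values fix the type, and
    the type fixes the value at \<open>p + l\<close> because \<open>l \<in> T\<close>.\<close>
  have "\<phi> (p + l) = \<phi> (q + l)" if eq: "\<forall>s<l. \<phi> (p + s) = \<phi> (q + s)" for p q
  proof -
    have less: "R (i + p) (j + p) \<longleftrightarrow> R (i + q) (j + q)" if "i \<in> T" "j \<in> T" "i < j" for i j
    proof -
      have "i < l" using l(2)[OF that(2)] that(3) by simp
      with eq have "\<phi> (p + i) (j - i) = \<phi> (q + i) (j - i)" by simp
      then show ?thesis using that(3) by (simp add: \<phi>_def add.commute)
    qed
    have "R (i + p) (j + p) \<longleftrightarrow> R (i + q) (j + q)" if "i \<in> T" "j \<in> T" for i j
    proof (cases i j rule: linorder_cases)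
      case less
      with \<open>\<And>i j. i \<in> T \<Longrightarrow> j \<in> T \<Longrightarrow> i < j \<Longrightarrow> _ i j\<close> that show ?thesis by blast
    next
      case equal
      then show ?thesis by (simp add: irrefl)
    next
      case greater
      then have "R (j + p) (i + p) \<longleftrightarrow> R (j + q) (i + q)"
        using \<open>\<And>i j. i \<in> T \<Longrightarrow> j \<in> T \<Longrightarrow> i < j \<Longrightarrow> _ i j\<close> that by blast
      then show ?thesis using greater flip[of "i + p" "j + p"] flip[of "i + q" "j + q"] by simp
    qed
    then have "order_type R T p = order_type R T q" unfolding order_type_eq_iff by blast
    then show ?thesis using \<phi> l(1) by blast
  qed
  from coincidence_if_determined[OF fin this]
  obtain i j where ij: "i < j" "\<forall>t. \<phi> (i + t) = \<phi> (j + t)" by blast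
  have "order_periodic R"
  proof (rule order_periodicI)
    show "j - i \<ge> 1" using ij(1) by simp
    fix n m :: nat assume "n \<ge> i"
    with ev_periodicI[OF ij] have "\<phi> (n + (j - i)) = \<phi> n" by blast
    then show "R n (n + m) \<longleftrightarrow> R (n + (j - i)) (n + (j - i) + m)"
      by (simp add: \<phi>_def fun_eq_iff)
  qed
  with assms(1) show False by blast
qed

lemma ex_complex_window:
  assumes "\<not> order_periodic R" "n \<ge> 1"
  shows "\<exists>T. finite T \<and> 0 \<in> T \<and> card T = n \<and> n \<le> card (range (order_type R T))"
  using assms(2)
proof (induction n rule: dec_induct)
  case base
  have "card (range (order_type R {0})) \<noteq> 0" by (simp add: finite_range_order_type)
  then show ?case by (intro exI[of _ "{0}"]) auto
next
  case (step n)
  then obtain T where T: "finite T" "0 \<in> T" "card T = n" "n \<le> card (range (order_type R T))" by blast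
  obtain m where m: "card (range (order_type R T)) < card (range (order_type R (insert m T)))"
    using ex_splitting_element[OF assms(1) T(1,2)] by blast
  have "m \<notin> T" using m by (auto simp: insert_absorb)
  with T m show ?case by (intro exI[of _ "insert m T"]) simp
qed

end

locale low_order = index_order +
  assumes bound: "finite T \<Longrightarrow> T \<noteq> {} \<Longrightarrow> card (range (order_type R T)) \<le> card T"
begin

lemma card_le_if_distinguished:
  assumes "finite T" "T \<noteq> {}"
    and "\<And>a b. a \<in> A \<Longrightarrow> b \<in> A \<Longrightarrow> order_type R T (g a) = order_type R T (g b) \<Longrightarrow> a = b"
  shows "finite A \<and> card A \<le> card T"
proof -
  have inj: "inj_on (\<lambda>a. order_type R T (g a)) A"
    using assms(3) by (auto intro: inj_onI)
  have sub: "(\<lambda>a. order_type R T (g a)) ` A \<subseteq> range (order_type R T)" by blast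
  from inj_on_finite[OF inj sub] card_inj_on_le[OF inj sub] bound[OF assms(1,2)]
    finite_range_order_type[OF assms(1)]
  show ?thesis by force
qed

text \<open>The counting device behind most contradictions: whatever can be read off the type of
  \<open>T + n\<close>, for \<open>n\<close> in \<open>S\<close>, takes at most
  \<open>card T\<close> values.\<close>

lemma card_le_if_observed:
  assumes "finite T" "T \<noteq> {}"
    and "\<And>a. a \<in> A \<Longrightarrow> \<exists>n\<in>S. obs n = a"
    and "\<And>n n'. n \<in> S \<Longrightarrow> n' \<in> S \<Longrightarrow> order_type R T n = order_type R T n' \<Longrightarrow> obs n = obs n'"
  shows "finite A \<and> card A \<le> card T"
proof -
  obtain g where g: "\<And>a. a \<in> A \<Longrightarrow> g a \<in> S \<and> obs (g a) = a"
    using assms(3) by metis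
  show ?thesis
    by (rule card_le_if_distinguished[OF assms(1,2), of A g]) (metis assms(4) g)
qed

lemma converse: "low_order (\<lambda>i j. R j i)"
proof
  fix T :: "nat set" assume T: "finite T" "T \<noteq> {}"
  have "order_type (\<lambda>i j. R j i) T n = (order_type R T n)\<inverse>" for n
    by (auto simp: order_type_def)
  then have "range (order_type (\<lambda>i j. R j i) T) = converse ` range (order_type R T)" by auto
  then show "card (range (order_type (\<lambda>i j. R j i) T)) \<le> card T"
    using card_image_le[OF finite_range_order_type[OF T(1)], of converse R] bound[OF T] by simp
qed (use irrefl trans total in blast)+

end

lemma window_factor_eq: "window_factor \<alpha> = order_type (perm_less \<alpha>)"
  by (intro ext) (simp add: window_factor_def order_type_def)

lemma ultimately_periodic_eq: "ultimately_periodic \<alpha> \<longleftrightarrow> order_periodic (perm_less \<alpha>)"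
  by (simp add: ultimately_periodic_def order_periodic_def)

lemma index_order_perm_less: "index_order (perm_less \<alpha>)"
  by unfold_locales (use perm_less_irrefl perm_less_trans perm_less_total in blast)+

lemma window_complexity_le_max:
  "window T \<Longrightarrow> window_complexity \<alpha> T \<le> max_pattern_complexity \<alpha> (card T)"
  unfolding max_pattern_complexity_def by (rule Max_ge[OF finite_window_complexities]) blast

lemma max_pattern_complexity_le:
  assumes "n \<ge> 1" "\<And>T. window T \<Longrightarrow> card T = n \<Longrightarrow> window_complexity \<alpha> T \<le> n"
  shows "max_pattern_complexity \<alpha> n \<le> n"
  unfolding max_pattern_complexity_def
  using assms(2) by (intro Max.boundedI finite_window_complexities window_complexities_nonempty assms(1)) auto

lemma max_pattern_complexity_ge:
  assumes "\<not> ultimately_periodic \<alpha>" "n \<ge> 1"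
  shows "n \<le> max_pattern_complexity \<alpha> n"
proof -
  interpret index_order "perm_less \<alpha>" by (rule index_order_perm_less)
  obtain T where "finite T" "0 \<in> T" "card T = n" "n \<le> card (range (order_type (perm_less \<alpha>) T))"
    using ex_complex_window assms unfolding ultimately_periodic_eq by blast
  then show ?thesis using window_complexity_le_max[of T \<alpha>]
    by (simp add: window_def window_complexity_def window_factor_eq)
qed

text \<open>Windows contain 0, so \<open>T\<close> is translated by its minimum \<open>a\<close>;
  the types of \<open>T\<close> at \<open>n\<close> are those of the translate at
  \<open>n + a\<close>.\<close>

lemma card_order_types_le_if_max_le:
  assumes le: "\<And>n. n \<ge> 1 \<Longrightarrow> max_pattern_complexity \<alpha> n \<le> n" and T: "finite T" "T \<noteq> {}"
  shows "card (range (order_type (perm_less \<alpha>) T)) \<le> card T"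
proof -
  let ?R = "perm_less \<alpha>"
  define a where "a = Min T"
  have a: "a \<in> T" "\<And>t. t \<in> T \<Longrightarrow> a \<le> t" using T by (auto simp: a_def)
  define U where "U = (\<lambda>t. t - a) ` T"
  have U: "window U" using a T(1) by (force simp: window_def U_def)
  have "inj_on (\<lambda>t. t - a) T"
    by (rule inj_onI) (use a(2) in \<open>metis le_add_diff_inverse\<close>)
  then have cU: "card U = card T" by (simp add: U_def card_image)
  define f where "f s = {(i, j) \<in> T \<times> T. (i - a, j - a) \<in> s}" for s :: "nat rel"
  have f: "order_type ?R T n = f (order_type ?R U (n + a))" for n
  proof -
    have e: "t - a + (n + a) = t + n" if "t \<in> T" for t using a(2)[OF that] by simp
    have "t - a \<in> U" if "t \<in> T" for t using that by (simp add: U_def)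
    then have "(i - a, j - a) \<in> order_type ?R U (n + a) \<longleftrightarrow> ?R (i + n) (j + n)"
      if "i \<in> T" "j \<in> T" for i j
      using that by (simp add: order_type_def e)
    then show ?thesis unfolding f_def order_type_def[of ?R T] by blast
  qed
  have "range (order_type ?R T) \<subseteq> f ` range (order_type ?R U)"
    by (rule image_subsetI) (use f in blast)
  then have "card (range (order_type ?R T)) \<le> card (range (order_type ?R U))"
    using finite_range_order_type[of U] U unfolding window_def by (intro surj_card_le) blast+
  also have "\<dots> \<le> max_pattern_complexity \<alpha> (card U)"
    using window_complexity_le_max[OF U] by (simp add: window_complexity_def window_factor_eq)
  also have "\<dots> \<le> card U"
    using T by (intro le) (simp add: cU Suc_le_eq card_gt_0_iff)
  finally show ?thesis by (simp add: cU)
qed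

text \<open>Past \<open>N\<close> the types repeat with period \<open>t\<close> for every
  \<open>T\<close> at once, so complexity \<open>n\<close> for all \<open>n\<close> excludes
  periodicity.\<close>

lemma order_periodic_bounded:
  assumes "order_periodic R" "\<And>i. \<not> R i i"
  shows "\<exists>C. \<forall>T. finite T \<longrightarrow> card (range (order_type R T)) \<le> C"
proof -
  obtain t N where t: "t \<ge> 1" "\<And>i j. i > N \<Longrightarrow> j > N \<Longrightarrow> R i j \<longleftrightarrow> R (i + t) (j + t)"
    using assms unfolding order_periodic_def by metis
  have "card (range (order_type R T)) \<le> N + 1 + t" if "finite T" for T
  proof -
    have step: "order_type R T (n + t) = order_type R T n" if "n > N" for n
      unfolding order_type_eq_iff using t(2)[of "i + n" "j + n" for i j] that by (simp add: add.assoc)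
    have "order_type R T n \<in> order_type R T ` {..<N + 1 + t}" for n
    proof (induction n rule: less_induct)
      case (less n)
      show ?case
      proof (cases "n < N + 1 + t")
        case False
        with step[of "n - t"] less[of "n - t"] t(1) show ?thesis by simp
      qed auto
    qed
    then have "range (order_type R T) \<subseteq> order_type R T ` {..<N + 1 + t}" by blast
    from card_mono[OF _ this] card_image_le[of "{..<N + 1 + t}" "order_type R T"]
    show ?thesis by simp
  qed
  then show ?thesis by blast
qed

context sturmian
begin

text \<open>The count vectors over \<open>T\<close> form a chain, so they are determined by their sum.\<close>

lemma card_range_le_if_determined_by_cnt:
  assumes T: "finite T" "0 \<in> T"
    and F: "\<And>n n'. (\<forall>t\<in>T. cnt n t = cnt n' t) \<Longrightarrow> F n = F n'"
  shows "card (range F) \<le> card T"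
proof -
  define S where "S n = (\<Sum>t\<in>T. cnt n t)" for n
  have S0: "S n = (\<Sum>t\<in>T - {0}. cnt n t)" for n
    unfolding S_def using T by (simp add: sum.remove[of T 0])
  have le: "cnt n' t \<le> cnt n t" if "\<xi> n \<le> \<xi> n'" for n n' t
    using cnt_diff_cases[of n n' t] \<xi>_neq[of n n'] that by (cases "n = n'") auto
  have eq: "F n = F n'" if "S n = S n'" for n n'
  proof -
    have *: "F n = F n'" if "\<xi> n \<le> \<xi> n'" "S n = S n'" for n n'
    proof (rule F, rule ccontr)
      assume "\<not> (\<forall>t\<in>T. cnt n t = cnt n' t)"
      then have "\<exists>t\<in>T. cnt n' t < cnt n t" using le[OF that(1)] by (metis order.not_eq_order_implies_strict)
      then have "S n' < S n" unfolding S_def by (intro sum_strict_mono_ex1[OF T(1)]) (use le[OF that(1)] in blast)+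
      with that(2) show False by simp
    qed
    from *[of n n'] *[of n' n] that show ?thesis by (cases "\<xi> n \<le> \<xi> n'") auto
  qed
  \<comment> \<open>The element 0 always contributes 0, so at most \<open>card T - 1\<close>
    summands can differ, each by at most 1; this yields \<open>card T\<close> possible sums instead
    of one more.\<close>
  have diff: "S n - S n' \<le> int (card T) - 1" for n n'
  proof -
    have "S n - S n' = (\<Sum>t\<in>T - {0}. cnt n t - cnt n' t)"
      by (simp add: S0 sum_subtractf)
    also have "\<dots> \<le> (\<Sum>t\<in>T - {0}. 1)" by (rule sum_mono) (rule balanced)
    also have "\<dots> = int (card T) - 1" using T by (simp add: card_Diff_singleton of_nat_diff Suc_le_eq card_gt_0_iff)
      (metis One_nat_def Suc_leI card_gt_0_iff empty_iff of_nat_1 of_nat_diff)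
    finally show ?thesis .
  qed
  have "range S \<subseteq> {S 0 - (int (card T) - 1)..S 0 + (int (card T) - 1)}"
    using diff[of 0] diff[of _ 0] by (force simp: algebra_simps)
  then have fin: "finite (range S)" by (rule finite_subset) simp
  define m where "m = Min (range S)"
  have "m \<in> range S" unfolding m_def by (rule Min_in[OF fin]) simp
  then obtain n0 where n0: "m = S n0" by blast
  have "range S \<subseteq> {m..<m + int (card T)}"
  proof
    fix x assume x: "x \<in> range S"
    then have "m \<le> x" unfolding m_def by (rule Min_le[OF fin])
    moreover obtain k where "x = S k" using x by blast
    ultimately show "x \<in> {m..<m + int (card T)}" using diff[of k n0] n0 by simp
  qed
  then have cS: "card (range S) \<le> card T"
    using card_mono[of "{m..<m + int (card T)}" "range S"] by simp
  have "F n = F (SOME k. S k = S n)" for n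
    by (rule eq) (metis (mono_tags) someI)
  then have "range F \<subseteq> (\<lambda>s. F (SOME k. S k = s)) ` range S" by blast
  with fin have "card (range F) \<le> card (range S)" by (rule surj_card_le)
  with cS show ?thesis by simp
qed

lemma sturmian_seq_eq:
  "sturmian_seq w x y a (n + k) =
    sturmian_seq w x y a n + real k * x - real_of_int (cnt n k) * (x + y)"
proof (induction k)
  case (Suc k)
  then show ?case using w_cases[of "n + k"] by (auto simp: cnt_Suc algebra_simps)
qed simp

end

lemma sturmian_perm_complexity:
  assumes "sturmian_perm \<alpha>" "n \<ge> 1"
  shows "max_pattern_complexity \<alpha> n = n"
proof -
  obtain w x y a where w: "sturmian_word w" "admissible_steps w x y"
    and \<alpha>: "\<alpha> = perm_class (sturmian_seq w x y a)"
    using assms(1) unfolding sturmian_perm_def by blast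
  interpret sturmian w by unfold_locales (rule w(1))
  define s where "s = sturmian_seq w x y a"
  have less: "perm_less \<alpha> i j \<longleftrightarrow> s i < s j" for i j
    unfolding \<alpha> s_def by (rule perm_less_perm_class[OF inj_sturmian_seq[OF w]])
  have "max_pattern_complexity \<alpha> n \<le> n"
  proof (rule max_pattern_complexity_le[OF assms(2)])
    fix T assume "window T" "card T = n"
    have "card (range (window_factor \<alpha> T)) \<le> card T"
    proof (rule card_range_le_if_determined_by_cnt)
      show "finite T" "0 \<in> T" using \<open>window T\<close> by (auto simp: window_def)
      fix n n' assume "\<forall>t\<in>T. cnt n t = cnt n' t"
      then have "s (n + t) - s n = s (n' + t) - s n'" if "t \<in> T" for t
        using that sturmian_seq_eq[of x y a n t] sturmian_seq_eq[of x y a n' t] by (simp add: s_def)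
      then have "s (n + i) < s (n + j) \<longleftrightarrow> s (n' + i) < s (n' + j)" if "i \<in> T" "j \<in> T" for i j
        using that by (smt (verit))
      then show "window_factor \<alpha> T n = window_factor \<alpha> T n'"
        unfolding window_factor_eq order_type_eq_iff by (simp add: less add.commute)
    qed
    with \<open>card T = n\<close> show "window_complexity \<alpha> T \<le> n" by (simp add: window_complexity_def)
  qed
  moreover have "\<not> ultimately_periodic \<alpha>"
  proof
    assume "ultimately_periodic \<alpha>"
    then obtain t N where t: "t \<ge> 1"
      "\<And>i j. i \<noteq> j \<Longrightarrow> i > N \<Longrightarrow> j > N \<Longrightarrow> perm_less \<alpha> i j \<longleftrightarrow> perm_less \<alpha> (i + t) (j + t)"
      unfolding ultimately_periodic_def by blast
    have up: "w n = 0 \<longleftrightarrow> perm_less \<alpha> n (Suc n)" for n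
      using w(2) w_cases[of n] by (auto simp: less s_def admissible_steps_def)
    have "w (n + t) = w n" if "n \<ge> Suc N" for n
    proof -
      have "perm_less \<alpha> n (Suc n) \<longleftrightarrow> perm_less \<alpha> (n + t) (Suc n + t)"
        by (rule t(2)) (use that in simp_all)
      then have "w n = 0 \<longleftrightarrow> w (n + t) = 0" using up[of n] up[of "n + t"] by simp
      then show ?thesis using w_cases[of n] w_cases[of "n + t"] by auto
    qed
    with t(1) have "ev_periodic w" unfolding ev_periodic_def by blast
    with not_ev_periodic_if_sturmian[OF w(1)] show False by blast
  qed
  ultimately show ?thesis using max_pattern_complexity_ge[of \<alpha> n] assms(2) by simp
qed

section \<open>Residue classes\<close>

lemma ev_periodic_if_progressions:
  assumes "e \<ge> 1" "\<And>s. s < e \<Longrightarrow> ev_periodic (\<lambda>i. u (s + i * e))"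
  shows "ev_periodic u"
proof -
  obtain p N where p: "p \<ge> 1" "\<forall>s\<in>{..<e}. \<forall>i\<ge>N. u (s + (i + p) * e) = u (s + i * e)"
    using ev_periodic_uniform[of "{..<e}" "\<lambda>s i. u (s + i * e)"] assms(2) by auto
  have "u (n + p * e) = u n" if "n \<ge> N * e" for n
  proof -
    have "N \<le> n div e" using div_le_mono[OF that, of e] assms(1) by simp
    moreover have "n mod e \<in> {..<e}" using assms(1) by simp
    ultimately have "u (n mod e + (n div e + p) * e) = u (n mod e + n div e * e)" using p(2) by blast
    moreover have "n mod e + (n div e + p) * e = n + p * e" by (simp add: distrib_right)
    ultimately show ?thesis by simp
  qed
  moreover have "p * e \<ge> 1" using p(1) assms(1) by simp
  ultimately show ?thesis unfolding ev_periodic_def by blast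
qed

lemma ev_periodic_shift: "ev_periodic (\<lambda>i. u (i + k)) \<Longrightarrow> ev_periodic u"
  unfolding ev_periodic_def
proof (elim exE conjE)
  fix p N assume "p \<ge> 1" and *: "\<forall>n\<ge>N. u (n + p + k) = u (n + k)"
  have "u (n + p) = u n" if "n \<ge> N + k" for n
    using *[rule_format, of "n - k"] that by simp
  with \<open>p \<ge> 1\<close> show "\<exists>p\<ge>1. \<exists>N. \<forall>n\<ge>N. u (n + p) = u n" by blast
qed

lemma mod_eqE:
  fixes n D r :: nat
  assumes "n mod D = r"
  obtains j where "n = r + D * j" "j = n div D"
  using assms by (metis mod_mult_div_eq)

text \<open>At a place not divisible by \<open>q\<close> the letter does not depend on \<open>b\<close>. If both cyclic words
  had a smaller period, the two periods would force contradictory letters at their sum.\<close>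

lemma card_rotations_ge:
  fixes f :: "bool \<Rightarrow> nat \<Rightarrow> bool"
  assumes q: "q \<ge> 2"
    and f0: "\<And>b t. q dvd t \<Longrightarrow> f b t = b"
    and f1: "\<And>t. \<not> q dvd t \<Longrightarrow> f True t = f False t"
    and per: "\<And>b t. f b (t + q) = f b t"
    and nconst: "\<not> (\<exists>c. \<forall>t. \<not> q dvd t \<longrightarrow> f True t = c)"
  shows "q + 2 \<le> card ((\<lambda>(b, t). map (\<lambda>i. f b (t + i)) [0..<q]) ` (UNIV \<times> {..<q}))"
proof -
  define g where "g b t = map (\<lambda>i. f b (t + i)) [0..<q]" for b t
  have perk: "f b (t + k * q) = f b t" for b t k
  proof (induction k)
    case (Suc k)
    have "f b (t + k * q + q) = f b (t + k * q)" by (rule per)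
    with Suc show ?case by (simp add: algebra_simps)
  qed simp
  have all: "f b (t + i) = f b (t' + i)" if "g b t = g b t'" for b t t' i
  proof -
    have "\<forall>i<q. f b (t + i) = f b (t' + i)" using that unfolding g_def by (simp add: list_eq_iff_nth_eq)
    then have "f b (t + i mod q) = f b (t' + i mod q)" using q by simp
    then show ?thesis
      using perk[of b "t + i mod q" "i div q"] perk[of b "t' + i mod q" "i div q"] by (simp add: add.assoc)
  qed
  have shift: "\<exists>\<rho>. 0 < \<rho> \<and> \<rho> < q \<and> (\<forall>x. f b (x + \<rho>) = f b x)" if ninj: "\<not> inj_on (g b) {..<q}" for b
  proof -
    obtain s' t' where st': "s' < q" "t' < q" "s' \<noteq> t'" "g b s' = g b t'"
      using ninj by (auto simp: inj_on_def)
    define s t where "s = min s' t'" and "t = max s' t'"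
    have st: "s < t" "t < q" "g b s = g b t"
      using st' by (auto simp: s_def t_def min_def max_def)
    have "f b (x + (t - s)) = f b x" for x
    proof -
      have "f b (t + (x + (q - s))) = f b (s + (x + (q - s)))" using all[OF st(3)] by simp
      moreover have "t + (x + (q - s)) = x + (t - s) + q" "s + (x + (q - s)) = x + q"
        using st by simp_all
      ultimately show ?thesis by (simp only: per)
    qed
    with st show ?thesis by (intro exI[of _ "t - s"]) auto
  qed
  have inj: "inj_on (g True) {..<q} \<or> inj_on (g False) {..<q}"
  proof (rule ccontr)
    assume "\<not> ?thesis"
    then have ninj: "\<not> inj_on (g True) {..<q}" "\<not> inj_on (g False) {..<q}" by simp_all
    obtain \<rho> where \<rho>: "0 < \<rho>" "\<rho> < q" "\<And>x. f True (x + \<rho>) = f True x"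
      using shift[OF ninj(1)] by auto
    obtain \<sigma> where \<sigma>: "0 < \<sigma>" "\<sigma> < q" "\<And>x. f False (x + \<sigma>) = f False x"
      using shift[OF ninj(2)] by auto
    have n\<rho>: "\<not> q dvd \<rho>" and n\<sigma>: "\<not> q dvd \<sigma>" using \<rho> \<sigma> by (auto dest: dvd_imp_le)
    have "f True \<rho>" using \<rho>(3)[of 0] f0[of 0 True] by simp
    then have 1: "f False (\<rho> + \<sigma>)" using f1[OF n\<rho>] \<sigma>(3)[of \<rho>] by simp
    have "\<not> f False \<sigma>" using \<sigma>(3)[of 0] f0[of 0 False] by simp
    then have 2: "\<not> f True (\<rho> + \<sigma>)" using f1[OF n\<sigma>] \<rho>(3)[of \<sigma>] by (simp add: add.commute)
    show False
    proof (cases "q dvd \<rho> + \<sigma>")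
      case True
      then show ?thesis using f0 2 by blast
    next
      case False
      then show ?thesis using f1 1 2 by blast
    qed
  qed
  have two: "\<exists>s<q. \<exists>t<q. g b s \<noteq> g b t" for b
  proof (rule ccontr)
    assume *: "\<not> ?thesis"
    have "f b t = b" for t
    proof -
      have "g b (t mod q) = g b 0" using * q by force
      from all[OF this, of 0] have "f b (t mod q) = b" using f0[of 0 b] by simp
      then show ?thesis using perk[of b "t mod q" "t div q"] by simp
    qed
    then have "\<forall>t. \<not> q dvd t \<longrightarrow> f True t = b" using f1 by (cases b) auto
    with nconst show False by blast
  qed
  \<comment> \<open>The number of true letters in \<open>q\<close> consecutive places does not
    depend on the start and differs by one between the two words. So their rotations are disjoint:
    \<open>q\<close> of one word and at least two of the other.\<close>
  have disj: "g True s \<noteq> g False t" if st: "s < q" "t < q" for s t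
  proof
    assume eq: "g True s = g False t"
    define S where "S b t = (\<Sum>i<q. if f b (t + i) then 1 else 0 :: nat)" for b t
    have S: "S b (Suc t) = S b t" for b t
    proof -
      have "(\<Sum>i<Suc q. if f b (t + i) then 1 else 0 :: nat) = (if f b t then 1 else 0) + S b (Suc t)"
        unfolding S_def by (subst sum.lessThan_Suc_shift) simp
      moreover have "(\<Sum>i<Suc q. if f b (t + i) then 1 else 0 :: nat) = S b t + (if f b t then 1 else 0)"
        unfolding S_def by (simp add: per)
      ultimately show ?thesis by simp
    qed
    then have S0: "S b t = S b 0" for b t by (induction t) auto
    have "S True s = S False t"
      unfolding S_def by (rule sum.cong) (use eq in \<open>auto simp: g_def list_eq_iff_nth_eq\<close>)
    moreover have "S b 0 = (if b then 1 else 0) + (\<Sum>i\<in>{..<q} - {0}. if f b i then 1 else 0)" for b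
      unfolding S_def using q by (simp add: sum.remove[of "{..<q}" 0] f0)
    moreover have "(\<Sum>i\<in>{..<q} - {0}. if f True i then 1 else 0 :: nat) =
        (\<Sum>i\<in>{..<q} - {0}. if f False i then 1 else 0)"
    proof (rule sum.cong)
      fix i assume "i \<in> {..<q} - {0}"
      then have "\<not> q dvd i" by (auto dest: dvd_imp_le)
      from f1[OF this] show "(if f True i then 1 else 0 :: nat) = (if f False i then 1 else 0)" by simp
    qed simp
    ultimately show False using S0[of True s] S0[of False t] by simp
  qed
  obtain b where b: "inj_on (g b) {..<q}" using inj by blast
  obtain s t where st: "s < q" "t < q" "g (\<not> b) s \<noteq> g (\<not> b) t" using two by blast
  have "g (\<not> b) y \<noteq> g b x" if "x < q" "y < q" for x y
    using disj[of x y] disj[of y x] that by (cases b) auto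
  then have "card (g b ` {..<q} \<union> {g (\<not> b) s, g (\<not> b) t}) = card (g b ` {..<q}) + card {g (\<not> b) s, g (\<not> b) t}"
    using st by (intro card_Un_disjoint) auto
  also have "\<dots> = q + 2" using st by (simp add: card_image[OF b])
  finally have "card (g b ` {..<q} \<union> {g (\<not> b) s, g (\<not> b) t}) = q + 2" .
  moreover have "g b ` {..<q} \<union> {g (\<not> b) s, g (\<not> b) t} \<subseteq> (\<lambda>(b, t). g b t) ` (UNIV \<times> {..<q})"
    using st by auto
  moreover have "finite ((\<lambda>(b, t). g b t) ` (UNIV \<times> {..<q}))" by simp
  ultimately have "q + 2 \<le> card ((\<lambda>(b, t). g b t) ` (UNIV \<times> {..<q}))" using card_mono by metis
  then show ?thesis unfolding g_def .
qed

section \<open>Residue classes and the lags at which they are undecided\<close>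

context index_order
begin

definition uniform_on :: "nat \<Rightarrow> nat \<Rightarrow> nat \<Rightarrow> nat \<Rightarrow> bool" where
  "uniform_on D N r m \<longleftrightarrow> (\<forall>n\<ge>N. \<forall>n'\<ge>N. n mod D = r \<longrightarrow> n' mod D = r \<longrightarrow>
     (R n (n + m) \<longleftrightarrow> R n' (n' + m)))"

definition one_free_class :: "nat \<Rightarrow> nat \<Rightarrow> bool" where
  "one_free_class D N \<longleftrightarrow>
     (\<forall>m r r'. r < D \<longrightarrow> r' < D \<longrightarrow> \<not> uniform_on D N r m \<longrightarrow> \<not> uniform_on D N r' m \<longrightarrow> r = r')"

definition separates :: "nat \<Rightarrow> nat \<Rightarrow> bool" where
  "separates D N \<longleftrightarrow> (\<forall>n\<ge>N. \<forall>n'\<ge>N. order_type R {..<D} n = order_type R {..<D} n' \<longrightarrow> n mod D = n' mod D)"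

definition class_word :: "nat \<Rightarrow> nat \<Rightarrow> nat \<Rightarrow> nat \<Rightarrow> bool" where
  "class_word D r m j \<longleftrightarrow> R (r + D * j) (r + D * j + m)"

lemma uniform_on_mono: "uniform_on D N r m \<Longrightarrow> N \<le> N' \<Longrightarrow> uniform_on D N' r m"
  unfolding uniform_on_def using le_trans by blast

lemma one_free_class_mono: "one_free_class D N \<Longrightarrow> N \<le> N' \<Longrightarrow> one_free_class D N'"
  unfolding one_free_class_def using uniform_on_mono by blast

lemma class_word_io:
  assumes "\<not> (\<exists>N. uniform_on D N r m)"
  shows "\<exists>j\<ge>J. class_word D r m j = b"
proof (rule ccontr)
  assume *: "\<not> ?thesis"
  have "R n (n + m) = (\<not> b)" if n: "n \<ge> r + D * J" "n mod D = r" for n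
  proof -
    obtain j where j: "n = r + D * j" by (rule mod_eqE[OF n(2)])
    show ?thesis
    proof (cases "D = 0")
      case True
      then have "n = r + D * J" using j by simp
      with * show ?thesis by (auto simp: class_word_def)
    next
      case False
      then have "j \<ge> J" using n(1) j by simp
      with * j show ?thesis by (auto simp: class_word_def)
    qed
  qed
  then have "uniform_on D (r + D * J) r m" unfolding uniform_on_def by blast
  with assms show False by blast
qed

lemma not_uniform_if_aperiodic:
  assumes "\<not> ev_periodic (class_word D r m)" "r < D"
  shows "\<not> uniform_on D N r m"
proof
  assume N: "uniform_on D N r m"
  have "class_word D r m (j + 1) = class_word D r m j" if "j \<ge> N" for j
  proof -
    have "j \<le> D * j" using assms(2) by simp
    with that have "N \<le> D * j" by linarith
    then have "r + D * j \<ge> N" "r + D * (j + 1) \<ge> N" by simp_all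
    moreover have "(r + D * j) mod D = r" "(r + D * (j + 1)) mod D = r"
      using assms(2) by (simp_all del: mult_Suc_right add: mod_mult_self2)
    ultimately show ?thesis using N unfolding uniform_on_def class_word_def by blast
  qed
  then have "ev_periodic (class_word D r m)" unfolding ev_periodic_def by blast
  with assms show False by blast
qed

end

text \<open>A common element must be \<open>(k', l', k, l)\<close>, so the two triples share at most
  one.\<close>

lemma card_two_cross_ge_5:
  "5 \<le> card ({(True, True, k, l), (False, True, k, l), (False, False, k, l)} \<union>
      {(k', l', True, True), (k', l', True, False), (k', l', False, False)})"
  by (cases k; cases l; cases k'; cases l'; simp add: card_insert_if)

lemma le_add_mult: "D \<ge> 1 \<Longrightarrow> (N :: nat) \<le> r + D * N"
  using mult_le_mono1[of 1 D N] by linarith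

context index_order
begin

lemma uniform_onD:
  "uniform_on D N r m \<Longrightarrow> n \<ge> N \<Longrightarrow> n' \<ge> N \<Longrightarrow> n mod D = r \<Longrightarrow> n' mod D = r \<Longrightarrow>
    R n (n + m) \<longleftrightarrow> R n' (n' + m)"
  unfolding uniform_on_def by blast

lemma separatesD:
  "separates D N \<Longrightarrow> order_type R {..<D} n = order_type R {..<D} n' \<Longrightarrow> n \<ge> N \<Longrightarrow> n' \<ge> N \<Longrightarrow>
    n mod D = n' mod D"
  unfolding separates_def by blast

end

context low_order
begin

text \<open>The window \<open>{..<D}\<close> already needs a type of its own for each of the
  \<open>D\<close> residues. One further element at lag \<open>m\<close> allows at most
  \<open>D + 1\<close> types, so only one class can exhibit both outcomes at that lag.\<close>

lemma one_free_class_if_separates: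
  assumes "D \<ge> 1" "separates D N"
  shows "one_free_class D N"
  unfolding one_free_class_def
proof (intro allI impI)
  fix m r r' assume r: "r < D" "r' < D" "\<not> uniform_on D N r m" "\<not> uniform_on D N r' m"
  show "r = r'"
  proof (rule ccontr)
    assume ne: "r \<noteq> r'"
    define T where "T = insert m {..<D}"
    define obs where "obs n = (n mod D, R n (n + m))" for n
    define b where "b s = R (s + D * N) (s + D * N + m)" for s
    let ?A = "insert (r, \<not> b r) (insert (r', \<not> b r') ((\<lambda>s. (s, b s)) ` {..<D}))"
    have ex: "\<exists>n\<in>{N..}. obs n = (s, \<not> b s)" if nu: "\<not> uniform_on D N s m" for s
    proof -
      obtain n n' where n: "n \<ge> N" "n' \<ge> N" "n mod D = s" "n' mod D = s" "R n (n + m) \<noteq> R n' (n' + m)"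
        using nu unfolding uniform_on_def by blast
      have "R n (n + m) = (\<not> b s) \<or> R n' (n' + m) = (\<not> b s)" using n(5) by auto
      then show ?thesis
      proof
        assume "R n (n + m) = (\<not> b s)"
        with n show ?thesis unfolding obs_def by (intro bexI[of _ n]) auto
      next
        assume "R n' (n' + m) = (\<not> b s)"
        with n show ?thesis unfolding obs_def by (intro bexI[of _ n']) auto
      qed
    qed
    have "finite ?A \<and> card ?A \<le> card T"
    proof (rule card_le_if_observed[of T ?A "{N..}" obs])
      show "finite T" "T \<noteq> {}" by (simp_all add: T_def)
      show "\<exists>n\<in>{N..}. obs n = a" if "a \<in> ?A" for a
      proof -
        from that consider "a = (r, \<not> b r)" | "a = (r', \<not> b r')" | s where "s < D" "a = (s, b s)"
          by auto
        then show ?thesis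
        proof cases
          case (3 s)
          have "s + D * N \<in> {N..}" using le_add_mult[OF assms(1), of N s] by simp
          moreover have "obs (s + D * N) = a" using 3 by (simp add: obs_def b_def)
          ultimately show ?thesis by (rule bexI[rotated])
        qed (use ex[OF r(3)] ex[OF r(4)] in simp_all)
      qed
      fix n n' assume n: "n \<in> {N..}" "n' \<in> {N..}" and eq: "order_type R T n = order_type R T n'"
      have "order_type R {..<D} n = order_type R {..<D} n'"
        by (rule order_type_mono[OF _ eq]) (simp add: T_def subset_insertI)
      then have "n mod D = n' mod D" by (rule separatesD[OF assms(2)]) (use n in simp_all)
      moreover have "R n (n + m) = R n' (n' + m)"
        using order_type_eqD[OF eq, of 0 m] assms(1) by (simp add: T_def)
      ultimately show "obs n = obs n'" by (simp add: obs_def)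
    qed
    moreover have "card ?A = D + 2"
    proof -
      have "card ((\<lambda>s. (s, b s)) ` {..<D}) = D" by (subst card_image) (auto intro: inj_onI)
      moreover have "(r, \<not> b r) \<notin> insert (r', \<not> b r') ((\<lambda>s. (s, b s)) ` {..<D})"
        "(r', \<not> b r') \<notin> (\<lambda>s. (s, b s)) ` {..<D}" using ne by auto
      ultimately show ?thesis by simp
    qed
    moreover have "card T \<le> D + 1" unfolding T_def by (simp add: card_insert_if)
    ultimately show False by simp
  qed
qed

lemma uniform_on_if_other_free:
  assumes "one_free_class D N" "\<not> uniform_on D N a m" "a < D" "r < D" "r \<noteq> a"
  shows "uniform_on D N r m"
  using assms unfolding one_free_class_def by blast

text \<open>The \<open>k\<close> comparisons of consecutive terms of a progression involve only
  \<open>k + 1\<close> points.\<close>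

lemma card_progression_words_le:
  assumes "\<And>x. x \<in> A \<Longrightarrow> \<exists>n. map (\<lambda>i. R (n + i * m) (n + i * m + m)) [0..<k] = x"
  shows "finite A \<and> card A \<le> k + 1"
proof -
  define T where "T = (\<lambda>i. i * m) ` {..k}"
  have "finite A \<and> card A \<le> card T"
  proof (rule card_le_if_observed[where S = UNIV])
    show "finite T" "T \<noteq> {}" by (auto simp: T_def)
    show "\<exists>n\<in>UNIV. map (\<lambda>i. R (n + i * m) (n + i * m + m)) [0..<k] = x" if "x \<in> A" for x
      using assms[OF that] by simp
    fix n n' assume eq: "order_type R T n = order_type R T n'"
    show "map (\<lambda>i. R (n + i * m) (n + i * m + m)) [0..<k] = map (\<lambda>i. R (n' + i * m) (n' + i * m + m)) [0..<k]"
    proof (rule map_cong[OF refl])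
      fix i assume "i \<in> set [0..<k]"
      then have "i \<in> {..k}" "Suc i \<in> {..k}" by auto
      then have "i * m \<in> T" "Suc i * m \<in> T" unfolding T_def by (metis imageI)+
      from order_type_eqD[OF eq this]
      show "R (n + i * m) (n + i * m + m) = R (n' + i * m) (n' + i * m + m)"
        by (simp add: add_ac)
    qed
  qed
  moreover have "card T \<le> k + 1" unfolding T_def using card_image_le[of "{..k}"] by simp
  ultimately show ?thesis by simp
qed

lemma ex_other_class:
  assumes "D \<ge> (2 :: nat)"
  obtains r where "r < D" "r \<noteq> a"
  using that[of 0] that[of 1] assms by (cases "a = 0") auto

text \<open>Along the arithmetic progression with difference \<open>m\<close> the comparisons are constant except
  at the visits of the class \<open>a\<close>; every phase of these visits contributes its own factors.\<close>

lemma class_word_ev_periodic: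
  assumes D: "D \<ge> 2" and Q: "one_free_class D N" and a: "a < D" and m: "m \<ge> 1"
  shows "ev_periodic (class_word D a m)"
proof (rule ccontr)
  assume aper: "\<not> ev_periodic (class_word D a m)"
  \<comment> \<open>The progression with difference \<open>m\<close> returns to a class exactly
    every \<open>q\<close> steps, and \<open>q * m = D * e\<close>: successive returns are
    \<open>e\<close> apart in the class word.\<close>
  define g where "g = gcd D m"
  define q where "q = D div g"
  define e where "e = m div g"
  have g: "g \<ge> 1" "D = q * g" "m = e * g" using D by (simp_all add: q_def e_def g_def Suc_le_eq)
  have cop: "coprime q e" unfolding q_def e_def g_def using D by (intro div_gcd_coprime) simp
  have q1: "q \<ge> 1" and e1: "e \<ge> 1" using D m g by (auto simp: Suc_le_eq intro: gr0I)
  have qm: "q * m = D * e" by (simp add: g(2,3))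
  have dvd: "D dvd t * m \<longleftrightarrow> q dvd t" for t
  proof -
    have "D dvd t * m \<longleftrightarrow> q dvd t * e" using g(1) by (simp add: g(2,3) mult.assoc[symmetric])
    also have "\<dots> \<longleftrightarrow> q dvd t" using cop by (simp add: coprime_dvd_mult_left_iff)
    finally show ?thesis .
  qed
  have nunif: "\<not> uniform_on D M a m" for M by (rule not_uniform_if_aperiodic[OF aper a])
  have unif: "uniform_on D N r m" if "r < D" "r \<noteq> a" for r
    by (rule uniform_on_if_other_free[OF Q nunif a that])
  define val where "val r = R (r + D * N) (r + D * N + m)" for r
  have val: "R n (n + m) = val (n mod D)" if "n \<ge> N" "n mod D \<noteq> a" for n
  proof -
    have "n mod D < D" using D by simp
    from uniform_onD[OF unif[OF this that(2)] that(1), of "n mod D + D * N"] show ?thesis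
      using le_add_mult[of D N "n mod D"] D by (simp add: val_def)
  qed
  \<comment> \<open>Some subsequence with step \<open>e\<close> of the class word is still
    aperiodic; a tail of it is the word \<open>v\<close> seen at the returns to class
    \<open>a\<close>.\<close>
  obtain s where s: "s < e" "\<not> ev_periodic (\<lambda>i. class_word D a m (s + i * e))"
    using ev_periodic_if_progressions[OF e1] aper by blast
  \<comment> \<open>Far enough out that walking back fewer than \<open>q\<close> steps of size
    \<open>m\<close> stays above \<open>N\<close>.\<close>
  define K where "K = N + q * m"
  define n0 where "n0 = a + D * (s + K * e)"
  define v where "v i = R (n0 + i * (q * m)) (n0 + i * (q * m) + m)" for i
  have v: "v i = class_word D a m (s + (i + K) * e)" for i
  proof -
    have "a + D * (s + (i + K) * e) = n0 + i * (q * m)"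
      unfolding n0_def qm by (simp add: algebra_simps)
    then show ?thesis by (simp add: v_def class_word_def)
  qed
  have vap: "\<not> ev_periodic v"
  proof
    assume "ev_periodic v"
    moreover have "v = (\<lambda>i. class_word D a m (s + (i + K) * e))" by (rule ext) (rule v)
    ultimately have "ev_periodic (\<lambda>i. class_word D a m (s + (i + K) * e))" by simp
    then have "ev_periodic (\<lambda>i. class_word D a m (s + i * e))"
      by (rule ev_periodic_shift[of "\<lambda>i. class_word D a m (s + i * e)" K])
    with s(2) show False by (rule notE)
  qed
  have n0: "n0 \<ge> K" "n0 mod D = a"
  proof -
    have "K * 1 \<le> K * (D * e)" using D e1 by (intro mult_le_mono2) simp
    moreover have "n0 = a + D * s + K * (D * e)" by (simp add: n0_def algebra_simps)
    ultimately show "n0 \<ge> K" by linarith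
    show "n0 mod D = a" using a by (simp add: n0_def)
  qed
  have finv: "finite (range v)" by (rule finite_subset[of _ UNIV]) auto
  have mh: "k + 1 \<le> card (factors v k)" for k by (rule morse_hedlund[OF finv vap])
  have \<open>\<exists>c. \<forall>k. card (factors v k) \<le> k + 1 \<and> replicate k c \<in> factors v k\<close>
  \<comment> \<open>If \<open>q = 1\<close> the progression never leaves its class, and a start in
    another class supplies a constant word instead. Aperiodicity already forces \<open>k + 1\<close>
    factors of \<open>v\<close>, so the bound \<open>k + 1\<close> admits that word only as one of
    them.\<close>
  proof (cases "q = 1")
    case True
    obtain r where r: "r < D" "r \<noteq> a" using ex_other_class[OF D] by blast
    have cr: "R n (n + m) = val r" if "n \<ge> N" "n mod D = r" for n using val[OF that(1)] that(2) r by simp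
    have Dm: "D dvd m" using dvd[of 1] True by simp
    have "card (factors v k) \<le> k + 1 \<and> replicate k (val r) \<in> factors v k" for k
    proof -
      define obs where "obs n = map (\<lambda>i. R (n + i * m) (n + i * m + m)) [0..<k]" for n
      let ?A = "insert (replicate k (val r)) (factors v k)"
      have A: "finite ?A \<and> card ?A \<le> k + 1"
      proof (rule card_progression_words_le[where m = m and k = k, folded obs_def])
        show "\<exists>n. obs n = x" if "x \<in> ?A" for x
        proof (cases "x = replicate k (val r)")
          case True
          have "obs (r + D * N) = replicate k (val r)"
          proof (rule replicate_eqI)
            fix y assume "y \<in> set (obs (r + D * N))"
            then obtain i where y: "y = R (r + D * N + i * m) (r + D * N + i * m + m)"
              by (auto simp: obs_def)
            have "D dvd i * m" using Dm by simp
            then have "(r + D * N + i * m) mod D = r" using r(1)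
              by (metis mod_add_self2 mod_mult_self2 dvd_def mod_less mult.commute)
            moreover have "r + D * N + i * m \<ge> N" using le_add_mult[of D N r] D by simp
            ultimately show "y = val r" using cr y by blast
          qed (simp add: obs_def)
          with True show ?thesis by blast
        next
          case False
          with that obtain p where x: "x = map v [p..<p + k]" by (auto simp: factors_def)
          have "obs (n0 + p * m) = x"
            by (simp add: obs_def x list_eq_iff_nth_eq v_def \<open>q = 1\<close> algebra_simps)
          then show ?thesis by blast
        qed
      qed
      then have "card ?A \<le> k + 1" "finite ?A" by auto
      moreover have "card (factors v k) \<le> card ?A" using A by (intro card_mono) auto
      moreover have "?A = factors v k"
        using A \<open>card ?A \<le> k + 1\<close> mh[of k] by (metis card_seteq order_trans subset_insertI)
      ultimately show ?thesis by (metis insertI1)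
    qed
    then show ?thesis by blast
  next
    case False
    with q1 have q2: "q \<ge> 2" by simp
    \<comment> \<open>The outcomes along the progression away from class \<open>a\<close>;
      \<open>f b\<close> is the cyclic pattern with value \<open>b\<close> put in at the
      returns.\<close>
    define C where "C t = val ((a + t * m) mod D)" for t
    define f where "f b t = (if q dvd t then b else C t)" for b t
    have cls: "(a + t * m) mod D = a \<longleftrightarrow> q dvd t" for t
    proof -
      have "(a + t * m) mod D = a \<longleftrightarrow> (a + t * m) mod D = (a + 0) mod D" using a by simp
      also have "\<dots> \<longleftrightarrow> D dvd t * m" by (metis add_diff_cancel_left' le_add1 mod_eq_dvd_iff_nat add_0_right)
      finally show ?thesis by (simp add: dvd)
    qed
    have Cval: "R n (n + m) = C t" if "n \<ge> N" "n mod D = (a + t * m) mod D" "\<not> q dvd t" for n t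
      using val[OF that(1)] that(2,3) cls[of t] by (simp add: C_def)
    have Cper: "C (t + q) = C t" for t
    proof -
      have "a + (t + q) * m = (a + t * m) + D * e" unfolding qm[symmetric] by (simp add: algebra_simps)
      then show ?thesis unfolding C_def by (simp only: mod_mult_self2)
    qed
    have eqmod: "(n0 + x * (q * m) + i * m) mod D = (a + i * m) mod D" for x i
    proof -
      have "n0 + x * (q * m) + i * m = a + i * m + D * (s + K * e + x * e)"
        unfolding n0_def qm by (simp add: algebra_simps)
      then show ?thesis by (simp only: mod_mult_self2)
    qed
    have bit: "\<exists>i. v i = b" for b
    proof (rule ccontr)
      assume "\<not> ?thesis"
      then have "\<forall>n\<ge>0. v (n + 1) = v n" by auto
      with vap show False unfolding ev_periodic_def by blast
    qed
    \<comment> \<open>The start lies \<open>t\<close> steps before return number \<open>x\<close>.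
      Natural numbers force \<open>i + (q - t)\<close> in place of \<open>i - t\<close>; the final
      \<open>- 1\<close> undoes the added period.\<close>
    have seen: "R (n0 + x * (q * m) - t * m + i * m) (n0 + x * (q * m) - t * m + i * m + m) =
      (if q dvd i + (q - t) then v (x + (i + (q - t)) div q - 1) else C (i + (q - t)))"
      if t: "t < q" for x t i
    proof -
      let ?n = "n0 + x * (q * m) - t * m + i * m"
      have tm: "t * m \<le> q * m" using t by simp
      have n0q: "N + q * m \<le> n0" using n0(1) unfolding K_def .
      from tm n0q have "t * m \<le> n0" by linarith
      then have n0t: "t * m \<le> n0 + x * (q * m)" by (rule trans_le_add1)
      have ge: "?n \<ge> N" using tm n0q by linarith
      have shift: "?n + q * m = n0 + x * (q * m) + (i + (q - t)) * m"
      proof -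
        have "(i + (q - t)) * m = i * m + (q * m - t * m)"
          by (simp add: distrib_right diff_mult_distrib)
        with n0t tm show ?thesis by linarith
      qed
      show ?thesis
      proof (cases "q dvd i + (q - t)")
        case True
        then obtain y where y: "i + (q - t) = q * y" by (elim dvdE)
        have "y \<ge> 1" using y t by (cases y) auto
        then obtain y' where y': "y = Suc y'" by (cases y) auto
        have "?n + q * m = n0 + (x + y') * (q * m) + q * m"
          unfolding shift y y' by (simp add: algebra_simps)
        then have "?n = n0 + (x + y') * (q * m)" by simp
        moreover have "x + (i + (q - t)) div q - 1 = x + y'" unfolding y y' using q2 by simp
        ultimately show ?thesis using True by (simp only: v_def if_True)
      next
        case False
        have "?n mod D = (?n + q * m) mod D" by (simp add: qm)
        also have "\<dots> = (a + (i + (q - t)) * m) mod D" unfolding shift by (rule eqmod)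
        finally show ?thesis using Cval[OF ge _ False] False by simp
      qed
    qed
    have "\<exists>c. \<forall>t. \<not> q dvd t \<longrightarrow> f True t = c"
    proof (rule ccontr)
      assume nc: "\<not> ?thesis"
      let ?A = "(\<lambda>(b, t). map (\<lambda>i. f b (t + i)) [0..<q]) ` (UNIV \<times> {..<q})"
      have ge: "q + 2 \<le> card ?A"
        by (rule card_rotations_ge[of q f]) (use q2 nc in \<open>auto simp: f_def Cper\<close>)
      define obs where "obs n = map (\<lambda>i. R (n + i * m) (n + i * m + m)) [0..<q]" for n
      have "finite ?A \<and> card ?A \<le> q + 1"
      proof (rule card_progression_words_le[where m = m and k = q, folded obs_def])
        show "\<exists>n. obs n = x" if "x \<in> ?A" for x
        proof -
          from that obtain b t where t: "t < q" and x: "x = map (\<lambda>i. f b (t + i)) [0..<q]" by auto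
          \<comment> \<open>Starting at place \<open>t\<close> of the pattern means starting
            \<open>q - t\<close> steps before the next return; any \<open>q\<close> consecutive
            places contain exactly one return, whose value can be chosen as
            \<open>b\<close>.\<close>
          define t' where "t' = (if t = 0 then 0 else q - t)"
          have t': "t' < q" using t by (auto simp: t'_def)
          have tt': "f b (i + (q - t')) = f b (t + i)" for i
            using t by (auto simp: t'_def f_def Cper add.commute)
          obtain y where y: "v y = b" using bit by blast
          have once: "y + (i + (q - t')) div q - 1 = y" if iq: "i < q" "q dvd i + (q - t')" for i
          proof -
            obtain z where z: "i + (q - t') = q * z" using iq(2) by (elim dvdE)
            have "z > 0" using z t' by (cases z) auto
            moreover have "q * z < q * 2" using iq(1) z by linarith
            ultimately have "z = 1" by simp
            with z q2 show ?thesis by simp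
          qed
          have "obs (n0 + y * (q * m) - t' * m) = x"
            unfolding obs_def x
          proof (rule map_cong[OF refl])
            fix i assume "i \<in> set [0..<q]"
            then show "R (n0 + y * (q * m) - t' * m + i * m) (n0 + y * (q * m) - t' * m + i * m + m) = f b (t + i)"
              unfolding seen[OF t'] tt'[symmetric] using once[of i] y by (auto simp: f_def)
          qed
          then show ?thesis by blast
        qed
      qed
      with ge show False by linarith
    qed
    then obtain c where "\<forall>t. \<not> q dvd t \<longrightarrow> f True t = c" by blast
    then have c: "C t = c" if "\<not> q dvd t" for t using that by (auto simp: f_def)
    have "card (factors v k) \<le> k + 1 \<and> replicate k c \<in> factors v k" for k
    proof -
      \<comment> \<open>Words of length \<open>q * k\<close> along the progression: a factor
        \<open>x\<close> of \<open>v\<close> at the places congruent to \<open>t\<close>, and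
        \<open>c\<close> elsewhere. Unless \<open>x\<close> is constantly \<open>c\<close>, the word
        determines both \<open>t\<close> and \<open>x\<close>.\<close>
      define Z where "Z = (\<lambda>(t, x). map (\<lambda>i. if i mod q = t then x ! (i div q) else c) [0..<q * k])"
      define obs where "obs n = map (\<lambda>i. R (n + i * m) (n + i * m + m)) [0..<q * k]" for n
      define F where "F = factors v k"
      have finF: "finite F" unfolding F_def by (rule finite_factors[OF finv])
      have lenF: "length x = k" if "x \<in> F" for x using that by (auto simp: F_def factors_def)
      let ?A = "Z ` ({..<q} \<times> F)"
      have A: "finite ?A \<and> card ?A \<le> q * k + 1"
      proof (rule card_progression_words_le[where m = m and k = "q * k", folded obs_def])
        show "\<exists>n. obs n = z" if "z \<in> ?A" for z
        proof -
          from that obtain t p where t: "t < q" and z: "z = Z (t, map v [p..<p + k])"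
            by (auto simp: F_def factors_def)
          have "obs (n0 + p * (q * m) - t * m) = z" unfolding obs_def z Z_def prod.case
          proof (rule map_cong[OF refl])
            fix i assume i: "i \<in> set [0..<q * k]"
            then have ik: "i div q < k" by (simp add: less_mult_imp_div_less mult.commute)
            show "R (n0 + p * (q * m) - t * m + i * m) (n0 + p * (q * m) - t * m + i * m + m) =
              (if i mod q = t then map v [p..<p + k] ! (i div q) else c)"
            proof (cases "i mod q = t")
              case True
              have "i + (q - t) = q * (i div q + 1)"
                using t True mult_div_mod_eq[of q i] by (simp add: algebra_simps)
              then have "q dvd i + (q - t)" "(i + (q - t)) div q = i div q + 1" using q2 by simp_all
              then show ?thesis unfolding seen[OF t] using True ik by simp
            next
              case False
              have "\<not> q dvd i + (q - t)"
              proof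
                assume "q dvd i + (q - t)"
                then have "(i + (q - t) + t) mod q = t mod q" by (metis dvd_def mod_mult_self2 add.commute)
                moreover have "i + (q - t) + t = i + q" using t by simp
                ultimately show False using False t by simp
              qed
              then show ?thesis unfolding seen[OF t] using False c by simp
            qed
          qed
          then show ?thesis by blast
        qed
      qed
      then have cA: "card ?A \<le> q * k + 1" "finite ?A" by auto
      let ?ck = "replicate k c"
      have nthZ: "Z (t, x) ! (t + q * j) = x ! j" if "t < q" "j < k" for t x j
      proof -
        have "t + q * j < q * k"
        proof -
          have "t + q * j < q * Suc j" using that(1) by simp
          also have "\<dots> \<le> q * k" using that(2) by (intro mult_le_mono2) simp
          finally show ?thesis .
        qed
        then show ?thesis using that(1) by (simp add: Z_def)
      qed
      have nthZc: "Z (t, x) ! (t' + q * j) = c" if "t' < q" "t' \<noteq> t" "j < k" for t t' x j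
      proof -
        have "t' + q * j < q * k"
        proof -
          have "t' + q * j < q * Suc j" using that(1) by simp
          also have "\<dots> \<le> q * k" using that(3) by (intro mult_le_mono2) simp
          finally show ?thesis .
        qed
        then show ?thesis using that(1,2) by (simp add: Z_def)
      qed
      have nck: "\<exists>j<k. x ! j \<noteq> c" if "x \<in> F" "x \<noteq> ?ck" for x
      proof (rule ccontr)
        assume "\<not> ?thesis"
        then have "x = ?ck" using lenF[OF that(1)] by (intro nth_equalityI) auto
        with that(2) show False by simp
      qed
      have key: "t = t'" if h: "t < q" "t' < q" "x \<in> F" "x \<noteq> ?ck" "Z (t, x) = Z (t', x')" for t t' x x'
      proof (rule ccontr)
        assume "t \<noteq> t'"
        obtain j where j: "j < k" "x ! j \<noteq> c" using nck[OF h(3,4)] by blast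
        have "x ! j = Z (t', x') ! (t + q * j)" using nthZ[OF h(1) j(1)] h(5) by metis
        also have "\<dots> = c" using nthZc[OF h(1) \<open>t \<noteq> t'\<close> j(1)] .
        finally show False using j(2) by simp
      qed
      have key2: "x = x'" if "t < q" "x \<in> F" "x' \<in> F" "Z (t, x) = Z (t, x')" for t x x'
      proof (rule nth_equalityI)
        show "length x = length x'" using lenF that by simp
        fix j assume "j < length x"
        then have "j < k" using lenF that by simp
        from nthZ[OF that(1) this, of x] nthZ[OF that(1) this, of x'] that(4)
        show "x ! j = x' ! j" by simp
      qed
      have inj: "inj_on Z ({..<q} \<times> (F - {?ck}))"
      proof (rule inj_onI)
        fix y y' assume "y \<in> {..<q} \<times> (F - {?ck})" "y' \<in> {..<q} \<times> (F - {?ck})" and eq: "Z y = Z y'"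
        then obtain t x t' x' where y: "y = (t, x)" "y' = (t', x')"
          and tx: "t < q" "t' < q" "x \<in> F" "x \<noteq> ?ck" "x' \<in> F" by auto
        have "t = t'" using key[OF tx(1-4)] eq y by simp
        with key2[OF tx(1,3,5)] eq y show "y = y'" by simp
      qed
      have cinj: "card (Z ` ({..<q} \<times> (F - {?ck}))) = q * card (F - {?ck})"
        by (simp add: card_image[OF inj] card_cartesian_product)
      have sub: "Z ` ({..<q} \<times> (F - {?ck})) \<subseteq> ?A" by blast
      \<comment> \<open>Otherwise all \<open>q * card F\<close> words differ, and
        \<open>card F \<ge> k + 1\<close> breaks the bound \<open>q * k + 1\<close>. With the
        constant word in \<open>F\<close>, its \<open>q\<close> phases coincide and the count
        becomes \<open>q * (card F - 1) + 1\<close>.\<close>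
      have ck: "?ck \<in> F"
      proof (rule ccontr)
        assume "?ck \<notin> F"
        then have "q * card F \<le> q * k + 1"
          using card_mono[OF cA(2) sub] cA(1) cinj by simp
        moreover have "q * (k + 1) \<le> q * card F" using mh[of k] unfolding F_def by (rule mult_le_mono2)
        ultimately show False using q2 by simp
      qed
      have "Z (0, ?ck) \<notin> Z ` ({..<q} \<times> (F - {?ck}))"
      proof
        assume "Z (0, ?ck) \<in> Z ` ({..<q} \<times> (F - {?ck}))"
        then obtain t x where tx: "t < q" "x \<in> F" "x \<noteq> ?ck" and e: "Z (0, ?ck) = Z (t, x)" by auto
        have "t = 0" using key[OF tx(1) _ tx(2,3) e[symmetric]] q2 by simp
        then have "x = ?ck" using e q2 by (intro key2[OF _ tx(2) ck, of 0]) simp_all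
        with tx(3) show False by simp
      qed
      moreover have "Z (0, ?ck) \<in> ?A" using ck q2 by auto
      ultimately have "Suc (q * card (F - {?ck})) \<le> card ?A"
        using card_mono[OF cA(2), of "insert (Z (0, ?ck)) (Z ` ({..<q} \<times> (F - {?ck})))"] sub finF cinj
        by simp
      with cA(1) have "q * card (F - {?ck}) \<le> q * k" by linarith
      then have "card (F - {?ck}) \<le> k" using q2 by simp
      then have "card F \<le> k + 1" using ck finF by (simp add: card_Diff_singleton)
      with ck show ?thesis unfolding F_def by simp
    qed
    then show ?thesis by blast
  qed
  then obtain c where c: "\<And>k. card (factors v k) \<le> k + 1" "\<And>k. replicate k c \<in> factors v k" by blast
  have "\<exists>p. \<forall>s<k. v (p + s) = c" for k
  proof -
    obtain p where "replicate k c = map v [p..<p + k]" using c(2)[of k] by (auto simp: factors_def)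
    then have "\<forall>s<k. v (p + s) = c" by (auto simp: list_eq_iff_nth_eq)
    then show ?thesis by blast
  qed
  from ev_periodic_if_long_runs[OF finv c(1) this] vap show False by blast
qed

end

section \<open>Two interleaved classes\<close>

context index_order
begin

text \<open>\<open>D dvd P\<close> keeps the shifted pair in its classes, so that multiples of
  \<open>P\<close> are periods too. The earlier element is in class \<open>a\<close>; hence
  \<open>(a, b)\<close> and \<open>(b, a)\<close> are treated separately.\<close>

definition pair_periodic :: "nat \<Rightarrow> nat \<Rightarrow> nat \<Rightarrow> nat \<Rightarrow> nat \<Rightarrow> bool" where
  "pair_periodic D a b P N \<longleftrightarrow> D dvd P \<and>
     (\<forall>n\<ge>N. \<forall>m\<ge>1. n mod D = a \<longrightarrow> (n + m) mod D = b \<longrightarrow>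
        (R n (n + m) \<longleftrightarrow> R (n + P) (n + P + m)))"

lemma pair_periodic_mult:
  assumes "pair_periodic D a b P N" "k \<ge> 1" "N' \<ge> N"
  shows "pair_periodic D a b (k * P) N'"
  unfolding pair_periodic_def
proof (intro conjI allI impI)
  have P: "D dvd P" using assms(1) by (simp add: pair_periodic_def)
  then show "D dvd k * P" by simp
  fix n m assume n: "n \<ge> N'" "m \<ge> 1" "n mod D = a" "(n + m) mod D = b"
  show "R n (n + m) \<longleftrightarrow> R (n + k * P) (n + k * P + m)"
  proof (induction k)
    case (Suc k)
    obtain P' where "P = D * P'" using P by (elim dvdE)
    then have "n + k * P = n + D * (k * P')" "n + k * P + m = n + m + D * (k * P')" by simp_all
    then have "(n + k * P) mod D = n mod D" "(n + k * P + m) mod D = (n + m) mod D"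
      by (simp_all only: mod_mult_self2)
    then have "R (n + k * P) (n + k * P + m) \<longleftrightarrow> R (n + k * P + P) (n + k * P + P + m)"
      using assms(1,3) n unfolding pair_periodic_def by (simp add: trans_le_add1)
    with Suc show ?case by (simp add: add_ac)
  qed simp
qed

lemma pair_periodic_if_constant:
  assumes "D \<ge> 1"
    and "\<And>n m. n \<ge> N \<Longrightarrow> m \<ge> 1 \<Longrightarrow> n mod D = a \<Longrightarrow> (n + m) mod D = b \<Longrightarrow> R n (n + m) = c"
  shows "\<exists>P\<ge>1. \<exists>N. pair_periodic D a b P N"
proof -
  have "pair_periodic D a b D N" unfolding pair_periodic_def
  proof (intro conjI allI impI)
    fix n m assume n: "n \<ge> N" "m \<ge> 1" "n mod D = a" "(n + m) mod D = b"
    have "n + D + m = n + m + D" by simp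
    then have "(n + D + m) mod D = b" using n(4) by (simp only: mod_add_self2)
    then show "R n (n + m) \<longleftrightarrow> R (n + D) (n + D + m)"
      using assms(2)[of n m] assms(2)[of "n + D" m] n by simp
  qed simp
  with assms(1) show ?thesis by blast
qed

lemma order_periodic_if_pairs:
  assumes "D \<ge> 1" "\<And>a b. a < D \<Longrightarrow> b < D \<Longrightarrow> \<exists>P\<ge>1. \<exists>N. pair_periodic D a b P N"
  shows "order_periodic R"
proof -
  have "\<exists>P\<ge>1. \<exists>N. \<forall>s\<in>{..<D} \<times> {..<D}. pair_periodic D (fst s) (snd s) P N"
    by (rule common_period) (use assms(2) pair_periodic_mult in auto)
  then obtain P N where P: "P \<ge> 1" "\<And>a b. a < D \<Longrightarrow> b < D \<Longrightarrow> pair_periodic D a b P N" by auto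
  show ?thesis
  proof (rule order_periodicI[OF P(1)])
    fix n m :: nat assume "n \<ge> N" "m \<ge> 1"
    moreover have "n mod D < D" "(n + m) mod D < D" using assms(1) by simp_all
    ultimately show "R n (n + m) \<longleftrightarrow> R (n + P) (n + P + m)"
      using P(2)[of "n mod D" "(n + m) mod D"] unfolding pair_periodic_def by blast
  qed
qed

lemma increasing_class:
  assumes "\<And>n. n \<ge> N \<Longrightarrow> n mod D = a \<Longrightarrow> R n (n + D)" "n \<ge> N" "n mod D = a" "k \<ge> 1"
  shows "R n (n + D * k)"
  using assms(4)
proof (induction k rule: dec_induct)
  case base
  show ?case using assms(1-3) by simp
next
  case (step k)
  have "R (n + D * k) (n + D * k + D)" using assms(1)[of "n + D * k"] assms(2,3) by simp
  with step trans show ?case by (metis mult_Suc_right add.commute add.left_commute)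
qed

lemma increasing_classD:
  assumes "\<And>n. n \<ge> N \<Longrightarrow> n mod D = a \<Longrightarrow> R n (n + D)" "n \<ge> N" "n mod D = a" "n' mod D = a" "n < n'"
  shows "R n n'"
proof -
  have "D dvd n' - n" using assms(3-5) by (metis less_imp_le mod_eq_dvd_iff_nat)
  then obtain k where k: "n' - n = D * k" by (elim dvdE)
  with assms(5) have "k \<ge> 1" "n' = n + D * k" by (cases k; simp)+
  with increasing_class[OF assms(1-3)] show ?thesis by simp
qed

end

context low_order
begin

text \<open>The window \<open>{0, m, m', m + m'}\<close> sees three patterns at class \<open>a\<close> and three at class
  \<open>a - m\<close>, at most one of them in common.\<close>

lemma no_two_free_lags:
  assumes Q: "one_free_class D N" and a: "a < D"
    and m: "1 \<le> m" "m < m'" "m mod D = m' mod D" "\<not> D dvd m"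
    and free: "\<not> uniform_on D N a m" "\<not> uniform_on D N a m'"
    and n1: "n1 \<ge> N" "n1 mod D = a" "R n1 (n1 + m)" "R n1 (n1 + m')"
    and n2: "n2 \<ge> N" "n2 mod D = a" "\<not> R n2 (n2 + m)" "R n2 (n2 + m')"
    and n3: "n3 \<ge> N" "n3 mod D = a" "\<not> R n3 (n3 + m)" "\<not> R n3 (n3 + m')"
    and k1: "k1 \<ge> N + m + m'" "(k1 - m) mod D = a" "R (k1 - m') k1" "R (k1 - m) k1"
    and k2: "k2 \<ge> N + m + m'" "(k2 - m) mod D = a" "R (k2 - m') k2" "\<not> R (k2 - m) k2"
    and k3: "k3 \<ge> N + m + m'" "(k3 - m) mod D = a" "\<not> R (k3 - m') k3" "\<not> R (k3 - m) k3"
  shows False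
proof -
  have D: "D \<ge> 1" using a by simp
  define T where "T = {0, m, m', m + m'}"
  \<comment> \<open>Two comparisons start at \<open>n\<close>, two in the class of
    \<open>n + m\<close>, which is that of \<open>n + m'\<close>. If \<open>n\<close> is in class
    \<open>a\<close> the last two are fixed; if \<open>n + m\<close> is in class \<open>a\<close>
    the first two are.\<close>
  define obs where "obs n = (R n (n + m), R n (n + m'), R (n + m) (n + m + m'), R (n + m') (n + m' + m))" for n
  define val where "val l r = R (r + D * N) (r + D * N + l)" for l r
  have val: "R n (n + l) = val l (n mod D)" if "n \<ge> N" "n mod D \<noteq> a" "l = m \<or> l = m'" for n l
  proof -
    have "n mod D < D" using a by simp
    then have "uniform_on D N (n mod D) l"
      using that free uniform_on_if_other_free[OF Q _ a] by blast
    from uniform_onD[OF this that(1), of "n mod D + D * N"] show ?thesis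
      using le_add_mult[OF D] by (simp add: val_def)
  qed
  define b where "b = (a + m) mod D"
  \<comment> \<open>The class \<open>a - m\<close>.\<close>
  define c where "c = (a + (D - m mod D)) mod D"
  have ba: "b \<noteq> a"
  proof
    assume "b = a"
    then have "(a + m) mod D = (a + 0) mod D" using a by (simp add: b_def)
    then have "D dvd (a + m) - (a + 0)" by (subst (asm) mod_eq_dvd_iff_nat) simp_all
    with m(4) show False by simp
  qed
  have clsb: "(n + l) mod D = b" if "n mod D = a" "l = m \<or> l = m'" for n l
  proof -
    have "(n + l) mod D = (n mod D + l mod D) mod D" by (rule mod_add_eq[symmetric])
    also have "\<dots> = (a mod D + m mod D) mod D" using that m(3) a by auto
    also have "\<dots> = b" unfolding b_def by (rule mod_add_eq)
    finally show ?thesis .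
  qed
  have obs1: "obs n = (R n (n + m), R n (n + m'), val m' b, val m b)" if "n \<ge> N" "n mod D = a" for n
  proof -
    have "R (n + m) (n + m + m') = val m' b" "R (n + m') (n + m' + m) = val m b"
      using val[of "n + m" m'] val[of "n + m'" m] clsb[OF that(2), of m] clsb[OF that(2), of m'] that(1) ba
      by auto
    then show ?thesis by (simp add: obs_def)
  qed
  have obs2: "obs (k - m - m') = (val m c, val m' c, R (k - m') k, R (k - m) k)"
    if k: "k \<ge> N + m + m'" "(k - m) mod D = a" for k
  proof -
    let ?n = "k - m - m'"
    have "(?n + m) mod D = (?n + m') mod D" using m(3) by (rule mod_add_cong[OF refl])
    also have "?n + m' = k - m" using k(1) by simp
    finally have nm: "(?n + m) mod D = a" using k(2) by simp
    have c: "?n mod D = c"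
    proof -
      have "(a + (D - m mod D)) mod D = (?n + m + (D - m mod D)) mod D"
        unfolding nm[symmetric] by (rule mod_add_left_eq)
      also have "?n + m + (D - m mod D) = ?n + D * (m div D + 1)"
        using mult_div_mod_eq[of D m] mod_less_divisor[of D m] D
        unfolding distrib_left mult_1_right by linarith
      also have "\<dots> mod D = ?n mod D" by (rule mod_mult_self2)
      finally show ?thesis by (simp add: c_def)
    qed
    have ca: "c \<noteq> a"
    proof
      assume "c = a"
      with nm c have "(?n + m) mod D = (?n + 0) mod D" by simp
      then have "D dvd (?n + m) - (?n + 0)" by (subst (asm) mod_eq_dvd_iff_nat) simp_all
      with m(4) show False by simp
    qed
    have "R ?n (?n + m) = val m c" "R ?n (?n + m') = val m' c"
      using val[of ?n m] val[of ?n m'] c ca k(1) by auto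
    moreover have "?n + m = k - m'" "?n + m + m' = k" "?n + m' = k - m" "?n + m' + m = k"
      using k(1) by auto
    ultimately show ?thesis by (simp add: obs_def)
  qed
  let ?A = "{(True, True, val m' b, val m b), (False, True, val m' b, val m b), (False, False, val m' b, val m b)} \<union>
      {(val m c, val m' c, True, True), (val m c, val m' c, True, False), (val m c, val m' c, False, False)}"
  have "finite ?A \<and> card ?A \<le> card T"
  proof (rule card_le_if_observed[of T ?A UNIV obs])
    show "finite T" "T \<noteq> {}" by (auto simp: T_def)
    have "obs n1 = (True, True, val m' b, val m b)" "obs n2 = (False, True, val m' b, val m b)"
      "obs n3 = (False, False, val m' b, val m b)"
      using obs1 n1 n2 n3 by simp_all
    moreover have "obs (k1 - m - m') = (val m c, val m' c, True, True)"
      "obs (k2 - m - m') = (val m c, val m' c, True, False)"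
      "obs (k3 - m - m') = (val m c, val m' c, False, False)"
      using obs2 k1 k2 k3 by simp_all
    ultimately show "\<exists>n\<in>UNIV. obs n = x" if "x \<in> ?A" for x
      using that by (elim UnE insertE emptyE) (metis UNIV_I)+
    fix n n' assume eq: "order_type R T n = order_type R T n'"
    show "obs n = obs n'" unfolding obs_def
      using order_type_eqD[OF eq, of 0 m] order_type_eqD[OF eq, of 0 m']
        order_type_eqD[OF eq, of m "m + m'"] order_type_eqD[OF eq, of m' "m + m'"]
      by (simp add: T_def add_ac)
  qed
  moreover have "card T \<le> 4" unfolding T_def by (simp add: card_insert_if)
  ultimately show False using card_two_cross_ge_5[of "val m' b" "val m b" "val m c" "val m' c"] by linarith
qed

lemma ex_last:
  fixes S :: "nat set"
  assumes "x \<in> S" "\<forall>n\<in>S. n < K"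
  shows "\<exists>n\<in>S. x \<le> n \<and> (\<forall>n'\<in>S. n' \<le> n)"
proof -
  have "finite S" using assms(2) by (rule bounded_nat_set_is_finite)
  with assms(1) show ?thesis by (intro bexI[of _ "Max S"] conjI ballI Max_ge Max_in) auto
qed

text \<open>Two increasing classes whose lag grows beyond all bounds: the window \<open>{0, D, m, m'}\<close> loses its
  four comparisons at four different times.\<close>

lemma no_drifting_lag:
  assumes D: "D \<ge> 1" and a: "a < D"
    and inca: "\<And>n. n \<ge> N \<Longrightarrow> n mod D = a \<Longrightarrow> R n (n + D)"
    and incb: "\<And>n. n \<ge> N \<Longrightarrow> n mod D = b \<Longrightarrow> R n (n + D)"
    and ex: "\<And>n. n \<ge> N \<Longrightarrow> n mod D = a \<Longrightarrow> \<exists>m\<ge>1. (a + m) mod D = b \<and> R n (n + m)"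
    and fin: "\<And>m. m \<ge> 1 \<Longrightarrow> (a + m) mod D = b \<Longrightarrow> \<exists>K. \<forall>n\<ge>K. n mod D = a \<longrightarrow> \<not> R n (n + m)"
  shows False
proof -
  \<comment> \<open>The times at which lag \<open>m\<close> ascends: bounded for each lag into class
    \<open>b\<close> by \<open>fin\<close>, and growing with the lag because class \<open>b\<close>
    increases.\<close>
  define S where "S m = {n. n \<ge> N \<and> n mod D = a \<and> R n (n + m)}" for m
  have last: "\<exists>n\<in>S m. x \<le> n \<and> (\<forall>n'\<in>S m. n' \<le> n)" if m: "m \<ge> 1" "(a + m) mod D = b" and x: "x \<in> S m" for m x
  proof -
    obtain K where "\<forall>n\<ge>K. n mod D = a \<longrightarrow> \<not> R n (n + m)" using fin[OF m] by blast
    then have "\<forall>n\<in>S m. n < K" by (auto simp: S_def not_le[symmetric])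
    with x show ?thesis by (rule ex_last)
  qed
  have clsb: "(n + m) mod D = b" if "n mod D = a" "(a + m) mod D = b" for n m
    using that mod_add_left_eq[of n D m] by simp
  have mono: "n \<in> S m'" if "n \<in> S m" "m \<le> m'" "(a + m) mod D = b" "(a + m') mod D = b" for n m m'
  proof (cases "m = m'")
    case False
    with that have n: "n \<ge> N" "n mod D = a" "R n (n + m)" "m < m'" by (auto simp: S_def)
    have "R (n + m) (n + m')"
      using increasing_classD[where N = N and D = D and a = b, OF incb, of "n + m" "n + m'"] clsb[OF n(2) that(3)] clsb[OF n(2) that(4)] n(1,4)
      by simp
    with n(3) have "R n (n + m')" by (rule trans)
    with n show ?thesis by (simp add: S_def)
  qed (use that in simp)
  define n0 where "n0 = a + D * (N + 1)"
  have n0: "n0 \<ge> N + D" "n0 mod D = a"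
  proof -
    have "n0 = a + D * N + D" by (simp add: n0_def)
    with le_add_mult[OF D, of N a] show "n0 \<ge> N + D" by linarith
    show "n0 mod D = a" unfolding n0_def using a by (simp only: mod_mult_self2 mod_less)
  qed
  obtain m1 where m1: "m1 \<ge> 1" "(a + m1) mod D = b" "R n0 (n0 + m1)" using ex[of n0] n0 by auto
  obtain t1 where t1: "t1 \<in> S m1" "n0 \<le> t1" "\<forall>n'\<in>S m1. n' \<le> t1"
    using last[OF m1(1,2), of n0] m1(3) n0 by (auto simp: S_def)
  \<comment> \<open>Larger by \<open>D\<close> than \<open>m1\<close>, so that the elements
    \<open>D\<close> and \<open>m\<close> of the window compare at lag \<open>m1\<close>; the same
    relation links \<open>m'\<close> and \<open>m2\<close>.\<close>
  define m where "m = m1 + D"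
  have m: "m \<ge> 1" "(a + m) mod D = b" "m1 \<le> m" using m1 by (auto simp: m_def add.assoc[symmetric])
  obtain t2 where t2: "t2 \<in> S m" "t1 \<le> t2" "\<forall>n'\<in>S m. n' \<le> t2"
    using last[OF m(1,2) mono[OF t1(1) m(3) m1(2) m(2)]] by blast
  \<comment> \<open>Beyond the last time of lag \<open>m\<close>, so the lag needed there is larger;
    the second \<open>D\<close> keeps \<open>t3 - D\<close> beyond \<open>t2\<close>.\<close>
  define x where "x = t2 + D + D"
  have x: "x \<ge> N" "x mod D = a" using t2(1) by (auto simp: x_def S_def)
  obtain m2 where m2: "m2 \<ge> 1" "(a + m2) mod D = b" "R x (x + m2)" using ex[OF x] by blast
  have xS: "x \<in> S m2" using x m2 by (simp add: S_def)
  have mm2: "m < m2"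
  proof (rule ccontr)
    assume "\<not> ?thesis"
    then have "x \<in> S m" using mono[OF xS _ m2(2) m(2)] by simp
    with t2(3) D show False by (auto simp: x_def)
  qed
  obtain t3 where t3: "t3 \<in> S m2" "x \<le> t3" "\<forall>n'\<in>S m2. n' \<le> t3" using last[OF m2(1,2) xS] by blast
  define m' where "m' = m2 + D"
  have m': "m' \<ge> 1" "(a + m') mod D = b" "m2 \<le> m'" using m2 by (auto simp: m'_def add.assoc[symmetric])
  obtain t4 where t4: "t4 \<in> S m'" "t3 \<le> t4" "\<forall>n'\<in>S m'. n' \<le> t4"
    using last[OF m'(1,2) mono[OF t3(1) m'(3) m2(2) m'(2)]] by blast
  define T where "T = {0, D, m, m'}"
  define obs where "obs n = (R n (n + m), R (n + D) (n + D + m1), R n (n + m'), R (n + D) (n + D + m2))" for n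
  have Sn: "R n (n + l) \<longleftrightarrow> n \<in> S l" if "n \<ge> N" "n mod D = a" for n l
    using that by (simp add: S_def)
  have obs: "obs n = (n \<in> S m, n + D \<in> S m1, n \<in> S m', n + D \<in> S m2)" if "n \<ge> N" "n mod D = a" for n
    using that by (simp add: obs_def Sn)
  have step: "n \<in> S (l + D)" if "n + D \<in> S l" "n \<ge> N" "n mod D = a" for n l
  proof -
    have "R (n + D) (n + D + l)" using that(1) by (simp add: S_def)
    with inca[OF that(2,3)] have "R n (n + D + l)" by (rule trans)
    with that(2,3) show ?thesis by (simp add: S_def add_ac)
  qed
  have cls: "t1 mod D = a" "t2 mod D = a" "t3 mod D = a" "t4 mod D = a" "t1 \<ge> N + D"
    using t1 t2 t3 t4 n0 by (auto simp: S_def)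
  have cls': "(t1 - D) mod D = a" "(t3 - D) mod D = a"
    using cls t3(2) by (simp_all add: le_mod_geq x_def)
  have ge: "t1 - D \<ge> N" "t2 \<ge> N" "t3 - D \<ge> N" "t4 \<ge> N" "t4 + D \<ge> N"
    using cls t2(2) t3(2) t4(2) by (simp_all add: x_def)
  have o1: "obs (t1 - D) = (True, True, True, True)"
  proof -
    have e: "t1 - D + D = t1" using cls by simp
    have "t1 \<in> S m2" by (rule mono[OF t1(1) _ m1(2) m2(2)]) (use mm2 m(3) in simp)
    moreover have "t1 - D \<in> S m" using step[of "t1 - D" m1] e t1(1) ge cls' by (simp add: m_def)
    moreover have "t1 - D \<in> S m'" using step[of "t1 - D" m2] e \<open>t1 \<in> S m2\<close> ge cls' by (simp add: m'_def)
    ultimately show ?thesis using obs[OF ge(1) cls'(1)] e t1(1) by simp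
  qed
  have o2: "\<exists>y. obs t2 = (True, False, True, y)"
  proof -
    have "t2 + D \<notin> S m1" using t1(3) t2(2) D by fastforce
    moreover have "t2 \<in> S m'" by (rule mono[OF t2(1) _ m(2) m'(2)]) (use mm2 m'(3) in simp)
    ultimately show ?thesis using obs[OF ge(2) cls(2)] t2(1) by simp
  qed
  have gt: "t2 < t3 - D" using t3(2) D by (simp add: x_def)
  have o3: "obs (t3 - D) = (False, False, True, True)"
  proof -
    have e: "t3 - D + D = t3" using t3(2) by (simp add: x_def)
    have "t3 - D \<in> S m'" using step[of "t3 - D" m2] e t3(1) ge cls' by (simp add: m'_def)
    moreover have "t3 - D \<notin> S m" using t2(3) gt by fastforce
    moreover have "t3 \<notin> S m1" using t1(3) gt t2(2) by fastforce
    ultimately show ?thesis using obs[OF ge(3) cls'(2)] e t3(1) by simp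
  qed
  have o4: "obs t4 = (False, False, True, False)"
  proof -
    have "t4 \<notin> S m" "t4 + D \<notin> S m1" "t4 + D \<notin> S m2"
      using t2(3) t1(3) t3(3) gt t4(2) t2(2) D by fastforce+
    then show ?thesis using obs[OF ge(4) cls(4)] t4(1) by simp
  qed
  have o5: "\<exists>y y' y''. obs (t4 + D) = (y, y', False, y'')"
  proof -
    have "t4 + D \<notin> S m'" using t4(3) D by fastforce
    then show ?thesis using obs[OF ge(5)] cls(4) by simp
  qed
  obtain y where y: "obs t2 = (True, False, True, y)" using o2 by blast
  obtain z z' z'' where z: "obs (t4 + D) = (z, z', False, z'')" using o5 by blast
  let ?A = "{(True, True, True, True), (True, False, True, y), (False, False, True, True),
    (False, False, True, False), (z, z', False, z'')}"
  have "finite ?A \<and> card ?A \<le> card T"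
  proof (rule card_le_if_observed[of T ?A UNIV obs])
    show "finite T" "T \<noteq> {}" by (auto simp: T_def)
    show "\<exists>n\<in>UNIV. obs n = x" if "x \<in> ?A" for x
      using that o1 y o3 o4 z by (elim insertE emptyE) (metis UNIV_I)+
    fix n n' assume eq: "order_type R T n = order_type R T n'"
    show "obs n = obs n'" unfolding obs_def
      using order_type_eqD[OF eq, of 0 m] order_type_eqD[OF eq, of 0 m']
        order_type_eqD[OF eq, of D m] order_type_eqD[OF eq, of D m']
      by (simp add: T_def m_def m'_def add_ac)
  qed
  moreover have "card T \<le> 4" unfolding T_def by (simp add: card_insert_if)
  moreover have "card ?A = 5" by (cases y) (auto simp: card_insert_if)
  ultimately show False by linarith
qed

end

context index_order
begin

text \<open>As one class rises and the other falls, a single element of \<open>b\<close> below one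
  of \<open>a\<close> persists as such for all later pairs; so the comparison is eventually
  constant.\<close>

lemma opposite_classes:
  assumes D: "D \<ge> 1" and a: "\<And>n. n \<ge> N \<Longrightarrow> n mod D = a \<Longrightarrow> R n (n + D)"
    and b: "\<And>n. n \<ge> N \<Longrightarrow> n mod D = b \<Longrightarrow> R (n + D) n" and "a \<noteq> b"
  shows "\<exists>P\<ge>1. \<exists>N'. pair_periodic D a b P N'"
proof -
  interpret c: index_order "\<lambda>i j. R j i" by (rule converse_order)
  have "\<exists>N' x. \<forall>n\<ge>N'. \<forall>n'\<ge>N'. n mod D = a \<longrightarrow> n' mod D = b \<longrightarrow> R n n' = x"
  proof (cases "\<exists>n0\<ge>N. \<exists>n0'\<ge>N. n0 mod D = a \<and> n0' mod D = b \<and> R n0' n0")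
    case True
    then obtain n0 n0' where n0: "n0 \<ge> N" "n0' \<ge> N" "n0 mod D = a" "n0' mod D = b" "R n0' n0" by blast
    have "\<not> R n n'" if n: "n \<ge> n0 + n0'" "n' \<ge> n0 + n0'" "n mod D = a" "n' mod D = b" for n n'
    proof -
      have "n = n0 \<or> R n0 n"
        using increasing_classD[where N = N and D = D and a = a, OF a n0(1,3) n(3)] n(1) by (cases "n = n0") auto
      moreover have "n' = n0' \<or> R n' n0'"
        using c.increasing_classD[where N = N and D = D and a = b, OF b n0(2,4) n(4)] n(2) by (cases "n' = n0'") auto
      ultimately have "R n' n" using n0(5) by (elim disjE) (metis trans)+
      then show ?thesis using trans[of n n' n] irrefl[of n] by blast
    qed
    then show ?thesis by (intro exI[of _ "n0 + n0'"] exI[of _ False]) simp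
  next
    case False
    have "R n n'" if "n \<ge> N" "n' \<ge> N" "n mod D = a" "n' mod D = b" for n n'
    proof -
      have "n \<noteq> n'" using that assms(4) by auto
      moreover have "\<not> R n' n" using False that by blast
      ultimately show ?thesis using total by blast
    qed
    then show ?thesis by (intro exI[of _ N] exI[of _ True]) simp
  qed
  then obtain N' x where "\<forall>n\<ge>N'. \<forall>n'\<ge>N'. n mod D = a \<longrightarrow> n' mod D = b \<longrightarrow> R n n' = x"
    by (elim exE)
  note x = this[rule_format]
  show ?thesis by (rule pair_periodic_if_constant[OF D, of N']) (rule x, simp_all)
qed

lemma uniform_on_converse: "index_order.uniform_on (\<lambda>i j. R j i) D N r m \<longleftrightarrow> uniform_on D N r m"
proof -
  interpret c: index_order "\<lambda>i j. R j i" by (rule converse_order)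
  show ?thesis
  proof (cases "m = 0")
    case True
    then show ?thesis by (simp add: c.uniform_on_def uniform_on_def irrefl)
  next
    case False
    then have "R (n + m) n \<longleftrightarrow> \<not> R n (n + m)" for n
      using flip[of n "n + m"] by simp
    then show ?thesis by (simp add: c.uniform_on_def uniform_on_def)
  qed
qed

lemma one_free_class_converse: "index_order.one_free_class (\<lambda>i j. R j i) D N \<longleftrightarrow> one_free_class D N"
proof -
  interpret c: index_order "\<lambda>i j. R j i" by (rule converse_order)
  show ?thesis unfolding c.one_free_class_def one_free_class_def uniform_on_converse ..
qed

lemma pair_periodic_converse:
  "index_order.pair_periodic (\<lambda>i j. R j i) D a b P N \<longleftrightarrow> pair_periodic D a b P N"
proof -
  interpret c: index_order "\<lambda>i j. R j i" by (rule converse_order)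
  have "R (n + m) n \<longleftrightarrow> \<not> R n (n + m)" if "m \<ge> 1" for n m
    using flip[of n "n + m"] that by auto
  then show ?thesis unfolding c.pair_periodic_def pair_periodic_def by auto
qed

end

context low_order
begin

text \<open>For a fixed \<open>n\<close> a larger lag into class \<open>b\<close> can only help
  ascending. Either some \<open>n0\<close> lies above all later elements of \<open>b\<close>, and
  then no later pair ascends; or, since lags cannot drift, one lag \<open>m\<close> ascends
  infinitely often. If \<open>m + D\<close> then ascends from some point on, only finitely many lags
  are undecided, and their class words are periodic; otherwise \<open>m\<close> and
  \<open>m + D\<close> are both free, which is impossible.\<close>

lemma increasing_pair_periodic:
  assumes D: "D \<ge> 2" and Q: "one_free_class D N" and ab: "a < D" "b < D" "a \<noteq> b"
    and inca: "\<And>n. n \<ge> N \<Longrightarrow> n mod D = a \<Longrightarrow> R n (n + D)"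
    and incb: "\<And>n. n \<ge> N \<Longrightarrow> n mod D = b \<Longrightarrow> R n (n + D)"
  shows "\<exists>P\<ge>1. \<exists>N'. pair_periodic D a b P N'"
proof (cases "\<exists>n0\<ge>N. n0 mod D = a \<and> (\<forall>m\<ge>1. (a + m) mod D = b \<longrightarrow> \<not> R n0 (n0 + m))")
  case True
  then obtain n0 where n0: "n0 \<ge> N" "n0 mod D = a" "\<And>m. m \<ge> 1 \<Longrightarrow> (a + m) mod D = b \<Longrightarrow> \<not> R n0 (n0 + m)"
    by blast
  have no: "\<not> R n (n + m)" if n: "n \<ge> n0" "n mod D = a" "m \<ge> 1" "(n + m) mod D = b" for n m
  proof
    assume *: "R n (n + m)"
    have "R n0 (n + m)"
    proof (cases "n = n0")
      case False
      then have "R n0 n"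
        using increasing_classD[where N = N and D = D and a = a, OF inca n0(1,2) n(2)] n(1) by simp
      then show ?thesis using * by (rule trans)
    qed (use * in simp)
    moreover have e: "n0 + (n - n0 + m) = n + m" using n(1) by simp
    moreover have "(a + (n - n0 + m)) mod D = b"
      using mod_add_left_eq[of n0 D "n - n0 + m"] n(4) unfolding n0(2) e by (simp only:)
    moreover have "n - n0 + m \<ge> 1" using n(3) by simp
    ultimately show False using n0(3)[of "n - n0 + m", unfolded e] by blast
  qed
  show ?thesis by (rule pair_periodic_if_constant[of D n0 _ _ False]) (use D no in auto)
next
  case False
  then have ex: "\<exists>m\<ge>1. (a + m) mod D = b \<and> R n (n + m)" if "n \<ge> N" "n mod D = a" for n
    using that by blast
  have "\<exists>m\<ge>1. (a + m) mod D = b \<and> (\<forall>K. \<exists>n\<ge>K. n mod D = a \<and> R n (n + m))"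
  proof (rule ccontr)
    assume neg: "\<not> ?thesis"
    have fin: "\<exists>K. \<forall>n\<ge>K. n mod D = a \<longrightarrow> \<not> R n (n + m)" if m: "m \<ge> 1" "(a + m) mod D = b" for m
    proof (rule ccontr)
      assume "\<not> ?thesis"
      then have "\<forall>K. \<exists>n\<ge>K. n mod D = a \<and> R n (n + m)" by blast
      with m neg show False by blast
    qed
    have "D \<ge> 1" using D by simp
    then show False by (rule no_drifting_lag[OF _ ab(1) inca incb ex fin])
  qed
  then obtain m where m: "m \<ge> 1" "(a + m) mod D = b" "\<And>K. \<exists>n\<ge>K. n mod D = a \<and> R n (n + m)"
    by blast
  define m' where "m' = m + D"
  have clsb: "(n + l) mod D = b" if "n mod D = a" "(a + l) mod D = b" for n l
    using that mod_add_left_eq[of n D l] by simp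
  have m': "m' \<ge> 1" "(a + m') mod D = b" using m(1,2) by (simp_all add: m'_def flip: add.assoc)
  have mono: "R n (n + l')" if "R n (n + l)" "l < l'" "n \<ge> N" "n mod D = a" "(a + l) mod D = b" "(a + l') mod D = b"
    for n l l'
  proof -
    have "R (n + l) (n + l')"
      using increasing_classD[where N = N and D = D and a = b, OF incb, of "n + l" "n + l'"]
        clsb[OF that(4,5)] clsb[OF that(4,6)] that(2,3) by simp
    with that(1) show ?thesis by (rule trans)
  qed
  have step: "R x (x + m')" if "R (x + D) (x + D + m)" "x \<ge> N" "x mod D = a" for x
    using trans[OF inca[OF that(2,3)] that(1)] by (simp add: m'_def add_ac)
  have ndvd: "\<not> D dvd m"
  proof
    assume "D dvd m"
    then obtain k where "m = D * k" by (elim dvdE)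
    then show False using m(2) ab by simp
  qed
  show ?thesis
  proof (cases "\<exists>K. \<forall>n\<ge>K. n mod D = a \<longrightarrow> R n (n + m')")
    case True
    then obtain K where K: "\<And>n. n \<ge> K \<Longrightarrow> n mod D = a \<Longrightarrow> R n (n + m')" by blast
    define S where "S = {l. 1 \<le> l \<and> l < m'}"
    have "finite S" "\<forall>l\<in>S. ev_periodic (class_word D a l)"
      using class_word_ev_periodic[OF D Q ab(1)] by (auto simp: S_def)
    from ev_periodic_uniform[OF this] obtain p J where p: "p \<ge> 1"
      "\<forall>l\<in>S. \<forall>j\<ge>J. class_word D a l (j + p) = class_word D a l j" by (elim exE conjE)
    define M where "M = N + K + (a + D * J)"
    have "pair_periodic D a b (D * p) M" unfolding pair_periodic_def
    proof (intro conjI allI impI)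
      fix n l assume n: "n \<ge> M" "l \<ge> 1" "n mod D = a" "(n + l) mod D = b"
      have al: "(a + l) mod D = b" using n(3,4) mod_add_left_eq[of n D l] by simp
      have n': "(n + D * p) mod D = a" using n(3) by (simp only: mod_mult_self2)
      show "R n (n + l) \<longleftrightarrow> R (n + D * p) (n + D * p + l)"
      proof (cases "l < m'")
        case True
        obtain j where j: "n = a + D * j" by (rule mod_eqE[OF n(3)])
        have "D * J \<le> D * j" using n(1) j unfolding M_def by linarith
        then have "j \<ge> J" using D by simp
        moreover have "l \<in> S" using True n(2) by (simp add: S_def)
        ultimately have "class_word D a l (j + p) = class_word D a l j" using p(2) by simp
        then show ?thesis by (simp add: class_word_def j algebra_simps)
      next
        case False
        have *: "R x (x + l)" if "x \<ge> M" "x mod D = a" for x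
        proof (cases "l = m'")
          case True
          then show ?thesis using K[of x] that by (simp add: M_def)
        next
          case l: False
          show ?thesis
            by (rule mono[OF K[OF _ that(2)]]) (use that al m' False l in \<open>simp_all add: M_def\<close>)
        qed
        from *[OF n(1,3)] *[OF _ n'] n(1) show ?thesis by simp
      qed
    qed simp
    with p(1) D show ?thesis by (intro exI[of _ "D * p"]) auto
  next
    case False
    then have io': "\<exists>n\<ge>K. n mod D = a \<and> \<not> R n (n + m')" for K by blast
    have D0: "D \<ge> 1" using D by simp
    have mm': "m < m'" using D by (simp add: m'_def)
    have notm: "\<not> R n (n + m)" if "\<not> R n (n + m')" "n \<ge> N" "n mod D = a" for n
      using mono[OF _ mm' that(2,3) m(2) m'(2)] that(1) by blast
    define M where "M = N + m + m' + D"
    obtain n1 where n1: "n1 \<ge> M" "n1 mod D = a" "R n1 (n1 + m)" using m(3) by blast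
    have n1': "R n1 (n1 + m')" by (rule mono[OF n1(3) mm' _ n1(2) m(2) m'(2)]) (use n1(1) in \<open>simp add: M_def\<close>)
    obtain n3 where n3: "n3 \<ge> n1" "n3 mod D = a" "\<not> R n3 (n3 + m')" using io' by blast
    have n3': "\<not> R n3 (n3 + m)" using notm[OF n3(3) _ n3(2)] n3(1) n1(1) by (simp add: M_def)
    have reach: "\<exists>k. y = x + D * k" if "x \<le> y" "x mod D = a" "y mod D = a" for x y
    proof -
      have "D dvd y - x" using that by (metis mod_eq_dvd_iff_nat)
      then obtain k where "y - x = D * k" by (elim dvdE)
      then have "y = x + D * k" using that(1) by simp
      then show ?thesis by blast
    qed
    have cls: "(x + D * k) mod D = a" if "x mod D = a" for x k using that by simp
    \<comment> \<open>Take the first time along the class at which lag \<open>m'\<close> changes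
      from failing to ascending. There lag \<open>m\<close> still fails, since by
      \<open>step\<close> its success would give lag \<open>m'\<close> already at the preceding
      element.\<close>
    have "\<exists>n\<ge>N. n mod D = a \<and> \<not> R n (n + m) \<and> R n (n + m')"
    proof -
      obtain y where y: "y \<ge> n3" "y mod D = a" "R y (y + m)" using m(3) by blast
      obtain k where k: "y = n3 + D * k" using reach[OF y(1) n3(2) y(2)] by blast
      have "R (n3 + D * k) (n3 + D * k + m')"
        using mono[OF y(3) mm' _ y(2) m(2) m'(2)] y(1) n3(1) n1(1) k by (simp add: M_def)
      then obtain j where j: "\<not> R (n3 + D * j) (n3 + D * j + m')" "R (n3 + D * Suc j) (n3 + D * Suc j + m')"
        using ex_least_nat_less[of "\<lambda>k. R (n3 + D * k) (n3 + D * k + m')" k] n3(3) by auto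
      define x where "x = n3 + D * j"
      have x: "x \<ge> N" "x mod D = a" "\<not> R x (x + m')"
        using n3 n1(1) j(1) cls[OF n3(2)] by (simp_all add: x_def M_def)
      have "\<not> R (x + D) (x + D + m)" using step[OF _ x(1,2)] x(3) by blast
      moreover have "R (x + D) (x + D + m')" using j(2) by (simp add: x_def add_ac)
      ultimately show ?thesis using x(1,2) by (intro exI[of _ "x + D"]) simp
    qed
    then obtain n2 where n2: "n2 \<ge> N" "n2 mod D = a" "\<not> R n2 (n2 + m)" "R n2 (n2 + m')" by blast
    have "\<exists>y\<ge>M. y mod D = a \<and> R y (y + m) \<and> \<not> R (y + D) (y + D + m)"
    proof -
      obtain k where k: "n3 = n1 + D * k" using reach[OF n3(1) n1(2) n3(2)] by blast
      obtain j where j: "R (n1 + D * j) (n1 + D * j + m)" "\<not> R (n1 + D * Suc j) (n1 + D * Suc j + m)"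
        using ex_least_nat_less[of "\<lambda>k. \<not> R (n1 + D * k) (n1 + D * k + m)" k] n1(3) n3' k by auto
      then have "\<not> R (n1 + D * j + D) (n1 + D * j + D + m)" by (simp add: add_ac)
      with j(1) show ?thesis using n1(1) cls[OF n1(2)] by (intro exI[of _ "n1 + D * j"]) simp
    qed
    then obtain y where y: "y \<ge> M" "y mod D = a" "R y (y + m)" "\<not> R (y + D) (y + D + m)" by blast
    have y': "R y (y + m')" by (rule mono[OF y(3) mm' _ y(2) m(2) m'(2)]) (use y(1) in \<open>simp add: M_def\<close>)
    have n1D: "(n1 - D) mod D = a" "n1 - D \<ge> N" "n1 - D + D = n1"
      using n1 by (simp_all add: M_def le_mod_geq)
    have n3D: "\<not> R (n3 + D) (n3 + D + m)" using step[OF _ _ n3(2)] n3(1,3) n1(1) by (auto simp: M_def)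
    have free: "\<not> uniform_on D N a m"
      using n1 n3 n3' unfolding uniform_on_def by (metis M_def add_leD1 order_trans)
    have free': "\<not> uniform_on D N a m'"
      using n1 n1' n3 unfolding uniform_on_def by (metis M_def add_leD1 order_trans)
    have False
    \<comment> \<open>The right ends are \<open>n1 + m\<close>, \<open>y + m'\<close> and
      \<open>n3 + m'\<close>. As \<open>m' = m + D\<close>, the left ends \<open>k - m'\<close> and
      \<open>k - m\<close> are consecutive in class \<open>a\<close>, so \<open>y\<close>, after
      which lag \<open>m\<close> is lost, gives the mixed pattern.\<close>
    proof (rule no_two_free_lags[OF Q ab(1) m(1) mm' _ ndvd free free' _ n1(2,3) n1' n2 _ n3(2) n3' n3(3)])
      show "m mod D = m' mod D" by (simp add: m'_def)
      show "n1 \<ge> N" "n3 \<ge> N" using n1(1) n3(1) by (simp_all add: M_def)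
      show "n1 + m \<ge> N + m + m'" using n1(1) by (simp add: M_def)
      show "(n1 + m - m) mod D = a" using n1(2) by simp
      show "R (n1 + m - m') (n1 + m)"
        using step[of "n1 - D"] n1D n1(1,3) by (simp add: m'_def M_def algebra_simps)
      show "R (n1 + m - m) (n1 + m)" using n1(3) by simp
      show "y + m' \<ge> N + m + m'" using y(1) by (simp add: M_def)
      show "(y + m' - m) mod D = a" using y(2) by (simp add: m'_def)
      show "R (y + m' - m') (y + m')" using y' by simp
      show "\<not> R (y + m' - m) (y + m')" using y(4) by (simp add: m'_def add_ac)
      show "n3 + m' \<ge> N + m + m'" using n1(1) n3(1) by (simp add: M_def)
      show "(n3 + m' - m) mod D = a" using n3(2) by (simp add: m'_def)
      show "\<not> R (n3 + m' - m') (n3 + m')" using n3(3) by simp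
      show "\<not> R (n3 + m' - m) (n3 + m')" using n3D by (simp add: m'_def add_ac)
    qed
    then show ?thesis ..
  qed
qed

text \<open>Uniformity at lag \<open>D\<close> makes each class eventually increasing or decreasing.
  Pairs of classes are then settled by direction, two decreasing ones by passing to the converse
  order.\<close>

lemma order_periodic_if_monotone_classes:
  assumes D: "D \<ge> 2" and Q: "one_free_class D N" and mon: "\<And>r. r < D \<Longrightarrow> \<exists>N. uniform_on D N r D"
  shows "order_periodic R"
proof -
  interpret c: low_order "\<lambda>i j. R j i" by (rule converse)
  obtain f where f: "\<And>r. r < D \<Longrightarrow> uniform_on D (f r) r D" using mon by metis
  define M where "M = N + (\<Sum>r<D. f r)"
  have unif: "uniform_on D M r D" if "r < D" for r
  proof (rule uniform_on_mono[OF f[OF that]])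
    have "f r \<le> (\<Sum>r<D. f r)" using that by (intro member_le_sum) auto
    then show "f r \<le> M" by (simp add: M_def)
  qed
  have Q': "one_free_class D M" by (rule one_free_class_mono[OF Q]) (simp add: M_def)
  have Qc: "c.one_free_class D M" using Q' one_free_class_converse by simp
  define up where "up r = R (r + D * M) (r + D * M + D)" for r
  have up: "R n (n + D) = up (n mod D)" if "n \<ge> M" for n
  proof -
    have "n mod D < D" using D by simp
    from uniform_onD[OF unif[OF this] that, of "n mod D + D * M"] show ?thesis
      using le_add_mult[of D M "n mod D"] D by (simp add: up_def)
  qed
  have down: "R (n + D) n = (\<not> up (n mod D))" if "n \<ge> M" for n
    using up[OF that] flip[of n "n + D"] D by simp
  have "\<exists>P\<ge>1. \<exists>N'. pair_periodic D a b P N'" if ab: "a < D" "b < D" for a b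
  proof (cases "a = b")
    case True
    have same: "R n n' = up a" if n: "n \<ge> M" "n mod D = a" "n' mod D = a" "n < n'" for n n'
    proof (cases "up a")
      case True
      then show ?thesis
        using increasing_classD[where N = M and D = D and a = a, OF _ n] up by simp
    next
      case False
      then have "R n' n"
        using c.increasing_classD[where N = M and D = D and a = a, OF _ n] down by simp
      with False show ?thesis using flip[of n n'] n(4) by simp
    qed
    show ?thesis
      by (rule pair_periodic_if_constant[of D M _ _ "up a"]) (use D same True in auto)
  next
    case False
    consider "up a" "up b" | "\<not> up a" "\<not> up b" | "up a" "\<not> up b" | "\<not> up a" "up b" by blast
    then show ?thesis
    proof cases
      case 1
      then show ?thesis using up by (intro increasing_pair_periodic[OF D Q' ab False]) auto
    next
      case 2
      then have "\<exists>P\<ge>1. \<exists>N'. c.pair_periodic D a b P N'"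
        using down by (intro c.increasing_pair_periodic[OF D Qc ab False]) auto
      then show ?thesis by (simp only: pair_periodic_converse)
    next
      case 3
      then show ?thesis using up down by (intro opposite_classes[of D M a b]) (use D in \<open>auto simp: False\<close>)
    next
      case 4
      then have "\<exists>P\<ge>1. \<exists>N'. c.pair_periodic D a b P N'"
        using up down by (intro c.opposite_classes[of D M a b]) (use D in \<open>auto simp: False\<close>)
      then show ?thesis by (simp only: pair_periodic_converse)
    qed
  qed
  then show ?thesis by (intro order_periodic_if_pairs[of D]) (use D in auto)
qed

end

section \<open>Periodic neighbour comparisons\<close>

lemma mod_add_right_cancel_nat:
  fixes n n' i m :: nat
  assumes "(n + i) mod m = (n' + i) mod m"
  shows "n mod m = n' mod m"
proof (cases "m = 0")
  case True
  with assms show ?thesis by simp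
next
  case False
  then have "i + (m * i - i) = m * i" by simp
  then have e: "n + i + (m * i - i) = n + m * i" for n by simp
  have "(n + i + (m * i - i)) mod m = (n' + i + (m * i - i)) mod m"
    using assms by (rule mod_add_cong) (rule refl)
  then show ?thesis unfolding e by (simp only: mod_mult_self2)
qed

context index_order
begin

text \<open>\<open>D\<close> elements reveal the residue modulo \<open>D\<close> and hence the
  distance to the next member of class \<open>r\<close>; the window then shows \<open>q - 1\<close>
  letters of its class word, which reveal the phase modulo \<open>q\<close>.\<close>

lemma separates_mult:
  assumes D: "D \<ge> 1" and sep: "separates D N" and r: "r < D" and q: "q \<ge> 1"
    and phase: "\<And>i j. i \<ge> J \<Longrightarrow> j \<ge> J \<Longrightarrow>
      (\<forall>s<q - 1. class_word D r D (i + s) = class_word D r D (j + s)) \<Longrightarrow> i mod q = j mod q"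
  shows "separates (D * q) (N + r + D * J)"
  unfolding separates_def
proof (intro allI impI)
  fix n n' assume n: "n \<ge> N + r + D * J" "n' \<ge> N + r + D * J"
    and eq: "order_type R {..<D * q} n = order_type R {..<D * q} n'"
  have "D * 1 \<le> D * q" using q by (intro mult_le_mono2)
  then have "order_type R {..<D} n = order_type R {..<D} n'"
    by (intro order_type_mono[OF _ eq]) auto
  then have nD: "n mod D = n' mod D" by (rule separatesD[OF sep]) (use n in simp_all)
  define i where "i = (r + (D - n mod D)) mod D"
  have i: "i < D" using D by (simp add: i_def)
  have ni: "(x + i) mod D = r" if "x mod D = n mod D" for x
  proof -
    have "(x + i) mod D = (x mod D + (r + (D - n mod D)) mod D) mod D"
      unfolding i_def by (simp only: mod_add_eq mod_add_right_eq mod_add_left_eq)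
    also have "\<dots> = (n mod D + (r + (D - n mod D))) mod D"
      using that by (simp only: mod_add_right_eq)
    also have "n mod D + (r + (D - n mod D)) = r + D"
      using mod_less_divisor[of D n] D by linarith
    also have "(r + D) mod D = r" using r by simp
    finally show ?thesis .
  qed
  obtain j where j: "n + i = r + D * j" using mod_eqE[OF ni[OF refl]] by blast
  obtain j' where j': "n' + i = r + D * j'" using mod_eqE[OF ni[OF nD[symmetric]]] by blast
  have "D * J \<le> D * j" "D * J \<le> D * j'" using n j j' by linarith+
  then have J: "j \<ge> J" "j' \<ge> J" using D by simp_all
  have "class_word D r D (j + s) = class_word D r D (j' + s)" if "s < q - 1" for s
  proof -
    have lt: "i + D * s + D < D * q"
    proof -
      have "s + 2 \<le> q" using that by simp
      then have "D * (s + 2) \<le> D * q" by (rule mult_le_mono2)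
      with i show ?thesis by (simp add: distrib_left)
    qed
    have "R (n + (i + D * s)) (n + (i + D * s + D)) \<longleftrightarrow> R (n' + (i + D * s)) (n' + (i + D * s + D))"
      by (rule order_type_eqD[OF eq]) (use lt in simp_all)
    moreover have "r + D * (j + s) = n + (i + D * s)" "r + D * (j' + s) = n' + (i + D * s)"
      using j j' by (simp_all add: distrib_left)
    ultimately show ?thesis unfolding class_word_def by (simp add: add.assoc)
  qed
  then have "j mod q = j' mod q" using phase[OF J] by blast
  then have "(D * j) mod (D * q) = (D * j') mod (D * q)" by (simp only: mod_mult_mult1)
  then have "(r + D * j) mod (D * q) = (r + D * j') mod (D * q)" by (rule mod_add_cong[OF refl])
  then have "(n + i) mod (D * q) = (n' + i) mod (D * q)" unfolding j j' .
  then show "n mod (D * q) = n' mod (D * q)" by (rule mod_add_right_cancel_nat)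
qed

lemma uniform_on_multiple:
  assumes "uniform_on D N r D" "D \<ge> 1" "k \<ge> 1" "n \<ge> N" "n' \<ge> N" "n mod D = r" "n' mod D = r"
  shows "R n (n + D * k) \<longleftrightarrow> R n' (n' + D * k)"
proof -
  interpret c: index_order "\<lambda>i j. R j i" by (rule converse_order)
  show ?thesis
  proof (cases "R n (n + D)")
    case True
    then have up: "\<And>x. x \<ge> N \<Longrightarrow> x mod D = r \<Longrightarrow> R x (x + D)"
      using uniform_onD[OF assms(1,4)] assms(6) by blast
    show ?thesis
      using increasing_class[where N = N and D = D and a = r, OF up assms(4,6,3)]
        increasing_class[where N = N and D = D and a = r, OF up assms(5,7,3)] by simp
  next
    case False
    then have "\<And>x. x \<ge> N \<Longrightarrow> x mod D = r \<Longrightarrow> \<not> R x (x + D)"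
      using uniform_onD[OF assms(1,4)] assms(6) by blast
    then have down: "\<And>x. x \<ge> N \<Longrightarrow> x mod D = r \<Longrightarrow> R (x + D) x"
      using flip[of x "x + D" for x] assms(2) by simp
    have "R (n + D * k) n" "R (n' + D * k) n'"
      using c.increasing_class[where N = N and D = D and a = r, OF down assms(4,6,3)]
        c.increasing_class[where N = N and D = D and a = r, OF down assms(5,7,3)] by simp_all
    then show ?thesis using flip[of n "n + D * k"] flip[of n' "n' + D * k"] assms(2,3) by simp
  qed
qed

lemma period_ge_2:
  assumes "\<not> (\<exists>N. uniform_on D N r m)" "q \<ge> 1" "\<forall>j\<ge>J. class_word D r m (j + q) = class_word D r m j"
  shows "q \<ge> 2"
proof (rule ccontr)
  assume "\<not> ?thesis"
  with assms(2) have "q = 1" by simp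
  with assms(3) have step: "class_word D r m (Suc j) = class_word D r m j" if "j \<ge> J" for j using that by simp
  have "class_word D r m j = class_word D r m J" if "j \<ge> J" for j
    using that by (induction j rule: dec_induct) (simp_all add: step)
  moreover obtain j where "j \<ge> J" "class_word D r m j = (\<not> class_word D r m J)"
    using class_word_io[OF assms(1)] by blast
  ultimately show False by blast
qed

end

context low_order
begin

text \<open>A class violating this lies inside \<open>r\<close>, as the other classes are monotone.
  On \<open>2 * q\<close> points of a progression of step \<open>D\<close>, the starts
  \<open>i < q\<close> steps before such a place are told apart by the phase, and both outcomes at
  lag \<open>D * q\<close> are visible: \<open>2 * q\<close> types. A start in a monotone class adds
  one more.\<close>

lemma no_nested_free_class:
  assumes D: "D \<ge> 2" and Q: "one_free_class D N"
    and r: "r < D" "\<not> (\<exists>N. uniform_on D N r D)" and q: "q \<ge> 2"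
    and phase: "\<And>i j. i \<ge> J \<Longrightarrow> j \<ge> J \<Longrightarrow>
      (\<forall>s<q - 1. class_word D r D (i + s) = class_word D r D (j + s)) \<Longrightarrow> i mod q = j mod q"
    and r2: "r2 < D * q"
  shows "\<exists>N. uniform_on (D * q) N r2 (D * q)"
proof (rule ccontr)
  assume free: "\<not> ?thesis"
  have D1: "D \<ge> 1" using D by simp
  have rfree: "\<not> uniform_on D N r D" using r(2) by blast
  have unif: "uniform_on D N x D" if "x < D" "x \<noteq> r" for x
    by (rule uniform_on_if_other_free[OF Q rfree r(1) that])
  have r2r: "r2 mod D = r"
  proof (rule ccontr)
    assume ne: "r2 mod D \<noteq> r"
    have u: "uniform_on D N (r2 mod D) D" by (rule unif[OF _ ne]) (use D in simp)
    have "uniform_on (D * q) N r2 (D * q)" unfolding uniform_on_def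
    proof (intro allI impI)
      fix n n' assume n: "n \<ge> N" "n' \<ge> N" "n mod (D * q) = r2" "n' mod (D * q) = r2"
      have "n mod D = r2 mod D" "n' mod D = r2 mod D"
        using n(3,4) by (metis mod_mod_cancel dvd_triv_left)+
      with u n(1,2) D1 q show "R n (n + D * q) \<longleftrightarrow> R n' (n' + D * q)"
        by (intro uniform_on_multiple) auto
    qed
    with free show False by blast
  qed
  obtain r' where r': "r' < D" "r' \<noteq> r" using ex_other_class[OF D] by blast
  define c where "c = R (r' + D * N) (r' + D * N + D)"
  have c: "R n (n + D) = c" if "n \<ge> N" "n mod D = r'" for n
    using uniform_onD[OF unif[OF r'] that(1), of "r' + D * N"] le_add_mult[OF D1] that(2) r'(1)
    by (simp add: c_def)
  define B where "B = N + r + D * J + D * q"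
  have "\<exists>n\<ge>B. n mod (D * q) = r2 \<and> R n (n + D * q) = b" for b
  proof -
    obtain j where j: "j \<ge> B" "class_word (D * q) r2 (D * q) j = b"
      using class_word_io[OF free] by blast
    have "j \<le> D * q * j" using D q by simp
    with j(1) have "r2 + D * q * j \<ge> B" by linarith
    moreover have "(r2 + D * q * j) mod (D * q) = r2" using r2 by (simp only: mod_mult_self2 mod_less)
    ultimately show ?thesis using j(2) unfolding class_word_def by blast
  qed
  then obtain p where p: "\<And>b. p b \<ge> B" "\<And>b. p b mod (D * q) = r2" "\<And>b. R (p b) (p b + D * q) = b"
    by metis
  \<comment> \<open>\<open>Some (i, b)\<close> starts \<open>i\<close> steps of size
    \<open>D\<close> before a place of class \<open>r2\<close> with outcome \<open>b\<close>;
    \<open>None\<close> starts in the monotone class \<open>r'\<close>.\<close>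
  define g where "g x = (case x of None \<Rightarrow> r' + D * N | Some (i, b) \<Rightarrow> p b - D * i)" for x
  define T where "T = (\<lambda>i. D * i) ` {..<2 * q}"
  let ?K = "insert None (Some ` ({..<q} \<times> (UNIV :: bool set)))"
  have inT: "D * i \<in> T" if "i < 2 * q" for i using that unfolding T_def by blast
  have Dq: "D * i \<le> D * q" if "i < q" for i using that by simp
  have some: "\<exists>j\<ge>J. p b - D * i = r + D * j" if i: "i < q" for i b
  proof -
    have ge: "p b - D * i \<ge> r + D * J" and le: "D * i \<le> p b"
      using p(1)[of b] Dq[OF i] unfolding B_def by linarith+
    have "p b mod D = r" using p(2)[of b] r2r by (metis mod_mod_cancel dvd_triv_left)
    moreover have "p b = p b - D * i + D * i" using le by simp
    ultimately have "(p b - D * i) mod D = r" by (metis mod_mult_self2)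
    then obtain j where j: "p b - D * i = r + D * j" by (rule mod_eqE)
    with ge D have "j \<ge> J" by simp
    with j show ?thesis by blast
  qed
  have bits: "class_word D r D (j + s) = R (n' + D * s) (n' + D * s + D)"
    if "order_type R T n = order_type R T n'" "n = r + D * j" "s < 2 * q - 1" for n n' j s
  proof -
    have "s < 2 * q" "Suc s < 2 * q" using that(3) by simp_all
    from order_type_eqD[OF that(1) inT[OF this(1)] inT[OF this(2)]] that(2)
    show ?thesis unfolding class_word_def by (simp add: algebra_simps)
  qed
  \<comment> \<open>At \<open>None\<close> the visible word at lag \<open>D\<close> is constant; a
    constant word in class \<open>r\<close> would give \<open>j\<close> and \<open>j + 1\<close> the
    same phase.\<close>
  have None_Some: False if i: "i < q" and eq: "order_type R T (p b - D * i) = order_type R T (r' + D * N)" for i b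
  proof -
    obtain j where j: "j \<ge> J" "p b - D * i = r + D * j" using some[OF i] by blast
    have cw: "class_word D r D (j + s) = c" if "s < 2 * q - 1" for s
      using bits[OF eq j(2) that] c[of "r' + D * N + D * s"] le_add_mult[OF D1, of N r'] r'(1) by simp
    have "j mod q = Suc j mod q"
    proof (rule phase)
      show "\<forall>s<q - 1. class_word D r D (j + s) = class_word D r D (Suc j + s)"
      proof (intro allI impI)
        fix s assume "s < q - 1"
        then have "s < 2 * q - 1" "Suc s < 2 * q - 1" by simp_all
        from cw[OF this(1)] cw[OF this(2)]
        show "class_word D r D (j + s) = class_word D r D (Suc j + s)" by simp
      qed
    qed (use j(1) in simp_all)
    then have "q dvd Suc j - j" by (metis le_add2 mod_eq_dvd_iff_nat plus_1_eq_Suc)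
    with q show False by simp
  qed
  have "finite ?K \<and> card ?K \<le> card T"
  proof (rule card_le_if_distinguished[of T ?K g])
    show "finite T" "T \<noteq> {}" using inT[of 0] q by (auto simp: T_def)
    fix x y assume xy: "x \<in> ?K" "y \<in> ?K" "order_type R T (g x) = order_type R T (g y)"
    show "x = y"
    proof (cases x)
      case None
      then show ?thesis
      proof (cases y)
        case (Some z)
        then obtain i b where "y = Some (i, b)" "i < q" using xy(2) by auto
        then show ?thesis using None_Some[of i b] xy(3) None by (simp add: g_def)
      qed simp
    next
      case (Some z)
      then obtain i b where x: "x = Some (i, b)" and i: "i < q" using xy(1) by auto
      show ?thesis
      proof (cases y)
        case None
        then show ?thesis using None_Some[of i b] xy(3) x i by (simp add: g_def)
      next
        case (Some z)
        then obtain i' b' where y: "y = Some (i', b')" and i': "i' < q" using xy(2) by auto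
        have eq: "order_type R T (p b - D * i) = order_type R T (p b' - D * i')"
          using xy(3) x y by (simp add: g_def)
        obtain j where j: "j \<ge> J" "p b - D * i = r + D * j" using some[OF i] by blast
        obtain j' where j': "j' \<ge> J" "p b' - D * i' = r + D * j'" using some[OF i'] by blast
        have "j mod q = j' mod q"
        proof (rule phase[OF j(1) j'(1)], intro allI impI)
          fix s assume "s < q - 1"
          then have s: "s < 2 * q - 1" by simp
          show "class_word D r D (j + s) = class_word D r D (j' + s)"
            using bits[OF eq j(2) s] bits[OF refl j'(2) s] by simp
        qed
        then have "(D * j) mod (D * q) = (D * j') mod (D * q)" by (simp only: mod_mult_mult1)
        then have e: "(p b - D * i) mod (D * q) = (p b' - D * i') mod (D * q)"
          unfolding j(2) j'(2) by (rule mod_add_cong[OF refl])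
        have le: "D * i \<le> p b" "D * i' \<le> p b'"
          using p(1)[of b] p(1)[of b'] Dq[OF i] Dq[OF i'] unfolding B_def by linarith+
        have "p b + D * i' = (p b - D * i) + (D * i + D * i')" using le by simp
        moreover have "p b' + D * i = (p b' - D * i') + (D * i + D * i')" using le by simp
        ultimately have "(p b + D * i') mod (D * q) = (p b' + D * i) mod (D * q)"
          using mod_add_cong[OF e refl, of "D * i + D * i'"] by (simp only:)
        moreover have "(p b + D * i) mod (D * q) = (p b' + D * i) mod (D * q)"
          using mod_add_cong[OF _ refl, of "p b" "D * q" "p b'" "D * i"] p(2)[of b] p(2)[of b'] by simp
        ultimately have "(D * i' + p b) mod (D * q) = (D * i + p b) mod (D * q)" by (simp add: add.commute)
        then have "(D * i') mod (D * q) = (D * i) mod (D * q)" by (rule mod_add_right_cancel_nat)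
        then have "i = i'" using i i' D by (simp add: mod_mult_mult1)
        have "R (p b - D * i + D * i) (p b - D * i + D * (i + q)) \<longleftrightarrow>
          R (p b' - D * i' + D * i) (p b' - D * i' + D * (i + q))"
          by (rule order_type_eqD[OF eq inT inT]) (use i in simp_all)
        then have "R (p b) (p b + D * q) \<longleftrightarrow> R (p b') (p b' + D * q)"
          using le \<open>i = i'\<close> by (simp add: distrib_left add.assoc[symmetric])
        then have "b = b'" using p(3) by simp
        with \<open>i = i'\<close> x y show ?thesis by simp
      qed
    qed
  qed
  moreover have "card T \<le> 2 * q" unfolding T_def using card_image_le[of "{..<2 * q}"] by simp
  moreover have "card ?K = 2 * q + 1"
    by (subst card_insert_disjoint) (auto simp: card_image card_cartesian_product mult.commute)
  ultimately show False by linarith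
qed

text \<open>The neighbour word is \<open>class_word 1 0 1\<close>, so refining the trivial modulus 1
  by its period \<open>D\<close> gives a separating modulus. If some class is not monotone at lag
  \<open>D\<close>, its class word is periodic with a period \<open>q\<close> whose phases are
  visible, and modulus \<open>D * q\<close> has only monotone classes.\<close>

theorem order_periodic_if_ev_periodic:
  assumes "ev_periodic (\<lambda>n. R n (n + 1))"
  shows "order_periodic R"
proof -
  have w: "class_word 1 0 1 = (\<lambda>n. R n (n + 1))" by (simp add: class_word_def fun_eq_iff)
  obtain D J where D: "D \<ge> 1" and per: "\<forall>n\<ge>J. class_word 1 0 1 (n + D) = class_word 1 0 1 n"
    and phase: "\<forall>i\<ge>J. \<forall>j\<ge>J. (\<forall>s<D - 1. class_word 1 0 1 (i + s) = class_word 1 0 1 (j + s)) \<longrightarrow> i mod D = j mod D"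
    using factors_determine_phase[OF assms] unfolding w by (elim exE conjE)
  have sep: "separates D J"
  proof -
    have ph: "\<And>i j. i \<ge> J \<Longrightarrow> j \<ge> J \<Longrightarrow>
        (\<forall>s<D - 1. class_word 1 0 1 (i + s) = class_word 1 0 1 (j + s)) \<Longrightarrow> i mod D = j mod D"
      using phase by blast
    have "separates 1 0" by (simp add: separates_def)
    then have "separates (1 * D) (0 + 0 + 1 * J)"
      by (rule separates_mult[OF order_refl _ zero_less_one D ph])
    then show ?thesis by simp
  qed
  show ?thesis
  proof (cases "\<exists>N. uniform_on 1 N 0 1")
    case True
    then obtain N where N: "uniform_on 1 N 0 1" by blast
    show ?thesis
    proof (rule order_periodicI)
      show "(1 :: nat) \<ge> 1" by simp
      fix n m :: nat assume "n \<ge> N" "m \<ge> 1"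
      then show "R n (n + m) \<longleftrightarrow> R (n + 1) (n + 1 + m)"
        using uniform_on_multiple[OF N _ \<open>m \<ge> 1\<close>, of n "n + 1"] by simp
    qed
  next
    case False
    have D2: "D \<ge> 2" by (rule period_ge_2[OF False D per])
    have Q: "one_free_class D J" by (rule one_free_class_if_separates[OF D sep])
    show ?thesis
    proof (cases "\<forall>r<D. \<exists>N. uniform_on D N r D")
      case True
      then show ?thesis using order_periodic_if_monotone_classes[OF D2 Q] by blast
    next
      case False
      then obtain r where r: "r < D" "\<not> (\<exists>N. uniform_on D N r D)" by blast
      obtain q K where q: "q \<ge> 1" and per2: "\<forall>n\<ge>K. class_word D r D (n + q) = class_word D r D n"
        and phase2: "\<forall>i\<ge>K. \<forall>j\<ge>K. (\<forall>s<q - 1. class_word D r D (i + s) = class_word D r D (j + s)) \<longrightarrow> i mod q = j mod q"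
        using factors_determine_phase[OF class_word_ev_periodic[OF D2 Q r(1) D]] by (elim exE conjE)
      have q2: "q \<ge> 2" by (rule period_ge_2[OF r(2) q per2])
      have ph: "\<And>i j. i \<ge> K \<Longrightarrow> j \<ge> K \<Longrightarrow>
          (\<forall>s<q - 1. class_word D r D (i + s) = class_word D r D (j + s)) \<Longrightarrow> i mod q = j mod q"
        using phase2 by blast
      have "separates (D * q) (J + r + D * K)" by (rule separates_mult[OF D sep r(1) q ph])
      then have Q2: "one_free_class (D * q) (J + r + D * K)"
        by (intro one_free_class_if_separates) (use D q in simp_all)
      have "2 * 1 \<le> D * q" using D2 q by (rule mult_le_mono)
      then have "2 \<le> D * q" by simp
      then show ?thesis
        by (rule order_periodic_if_monotone_classes[OF _ Q2]) (rule no_nested_free_class[OF D2 Q r q2 ph])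
    qed
  qed
qed

end

section \<open>Comparisons depend on letter counts only\<close>

text \<open>\<open>g\<close> factors through \<open>f\<close> by a map onto the values of
  \<open>g\<close>; if \<open>f\<close> has no more values than \<open>g\<close>, that map is
  injective.\<close>

lemma determined_converse:
  assumes "\<And>n n'. f n = f n' \<Longrightarrow> g n = g n'" "finite (range f)" "card (range f) \<le> card (range g)"
    and "g n = g n'"
  shows "f n = f n'"
proof -
  define h where "h x = g (SOME n. f n = x)" for x
  have h: "h (f n) = g n" for n
    unfolding h_def by (rule assms(1)) (rule someI[of "\<lambda>k. f k = f n" n], rule refl)
  then have im: "h ` range f = range g" by (auto simp: image_def)
  then have "card (h ` range f) = card (range f)"
    using assms(3) card_image_le[OF assms(2), of h] by simp
  with assms(2) have "inj_on h (range f)" by (rule eq_card_imp_inj_on)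
  moreover have "h (f n) = h (f n')" using assms(4) by (simp add: h)
  ultimately show ?thesis by (meson inj_onD rangeI)
qed

locale sturmian_order = low_order + sturmian +
  assumes w_iff: "w n = 0 \<longleftrightarrow> R n (n + 1)"
begin

lemma \<xi>_Suc: "\<xi> (Suc n) = \<xi> n + w n - slope"
  using cnt_eq_\<xi>[of n 1] by (simp add: cnt_1)

lemma letter_eq_if_order_type_eq:
  assumes "order_type R T p = order_type R T q" "s \<in> T" "Suc s \<in> T"
  shows "w (p + s) = w (q + s)"
  using order_type_eqD[OF assms] w_iff[of "p + s"] w_iff[of "q + s"] w_cases[of "p + s"] w_cases[of "q + s"]
  by auto

text \<open>A type of \<open>{..k}\<close> shows the \<open>k\<close> letters inside it. There are
  at most \<open>k + 1\<close> types and exactly \<open>k + 1\<close> factors, so the factor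
  conversely fixes the type.\<close>

lemma order_type_determined:
  assumes "\<forall>s<k. w (p + s) = w (q + s)"
  shows "order_type R {..k} p = order_type R {..k} q"
proof (rule determined_converse[where g = "\<lambda>i. map w [i..<i + k]"])
  fix n n' assume eq: "order_type R {..k} n = order_type R {..k} n'"
  show "map w [n..<n + k] = map w [n'..<n' + k]"
    unfolding map_upt_eq_iff using letter_eq_if_order_type_eq[OF eq] by simp
next
  show "finite (range (order_type R {..k}))" by (simp add: finite_range_order_type)
  have "card (range (order_type R {..k})) \<le> k + 1" using bound[of "{..k}"] by simp
  also have "k + 1 = card (range (\<lambda>i. map w [i..<i + k]))"
    using card_factors[of k] by (simp add: factors_eq_range)
  finally show "card (range (order_type R {..k})) \<le> card (range (\<lambda>i. map w [i..<i + k]))" .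
  show "map w [p..<p + k] = map w [q..<q + k]" unfolding map_upt_eq_iff by (rule assms)
qed

lemma ex_window_with_both_letters:
  "\<exists>G. \<forall>n. (\<exists>s<G. w (n + s) = 0) \<and> (\<exists>s<G. w (n + s) = 1)"
proof -
  obtain G1 :: nat where G1: "1 < real G1 * slope"
    using slope_bounds(1) by (metis ex_less_of_nat_mult)
  obtain G2 :: nat where G2: "1 < real G2 * (1 - slope)"
    using slope_bounds(2) ex_less_of_nat_mult[of "1 - slope" 1] by auto
  have "\<exists>s<G1 + G2. w (n + s) = 0" for n
  proof (rule ccontr)
    assume "\<not> ?thesis"
    then have "w (n + s) = 1" if "s < G1 + G2" for s using w_cases that by blast
    then have "cnt n (G1 + G2) = int (G1 + G2)" by (simp add: cnt_sum)
    with slope_le[of n "G1 + G2"] have "(real G1 + real G2) * (1 - slope) \<le> 1"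
      by (simp add: algebra_simps abs_le_iff)
    moreover have "real G1 * (1 - slope) \<ge> 0" using slope_bounds by simp
    ultimately show False using G2 by (simp add: distrib_right)
  qed
  moreover have "\<exists>s<G1 + G2. w (n + s) = 1" for n
  proof (rule ccontr)
    assume "\<not> ?thesis"
    then have "w (n + s) = 0" if "s < G1 + G2" for s using w_cases that by blast
    then have "cnt n (G1 + G2) = 0" by (simp add: cnt_sum)
    with slope_le[of n "G1 + G2"] have "(real G1 + real G2) * slope \<le> 1"
      by (simp add: abs_le_iff)
    moreover have "real G2 * slope \<ge> 0" using slope_bounds by simp
    ultimately show False using G1 by (simp add: distrib_right)
  qed
  ultimately show ?thesis by blast
qed

text \<open>A window of \<open>L\<close> elements cannot tell all \<open>L + 1\<close> factors of length \<open>L\<close> apart. Leaving out the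
  element \<open>i + 1\<close> from \<open>{0..L}\<close>, the two factors that it confuses differ by \<open>01\<close> against \<open>10\<close>
  around the gap.\<close>

lemma ex_neighbours:
  assumes i: "1 \<le> i" "i < m"
  shows "\<exists>a b. (\<forall>j\<le>m. cnt a j - cnt b j = (if j = i then 1 else 0)) \<and> (R a (a + m) \<longleftrightarrow> R b (b + m))"
proof -
  obtain G where G: "\<And>n. \<exists>s<G. w (n + s) = 0" "\<And>n. \<exists>s<G. w (n + s) = 1"
    using ex_window_with_both_letters by blast
  define L where "L = m + 2 + G"
  define T where "T = {..L} - {i + 1}"
  have "card T = L" unfolding T_def using i by (subst card_Diff_singleton) (auto simp: L_def)
  have "\<exists>p q. order_type R T p = order_type R T q \<and> map w [p..<p + L] \<noteq> map w [q..<q + L]"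
  proof (rule ccontr)
    assume *: "\<not> ?thesis"
    have "finite (factors w L) \<and> card (factors w L) \<le> card T"
    proof (rule card_le_if_observed[of T "factors w L" UNIV "\<lambda>i. map w [i..<i + L]"])
      show "finite T" "T \<noteq> {}" using i by (auto simp: T_def)
      show "\<exists>n\<in>UNIV. map w [n..<n + L] = x" if "x \<in> factors w L" for x
        using that by (auto simp: factors_def)
    qed (use * in blast)
    with \<open>card T = L\<close> show False by (simp add: card_factors)
  qed
  then obtain p' q' where pq': "order_type R T p' = order_type R T q'"
    "map w [p'..<p' + L] \<noteq> map w [q'..<q' + L]" by blast
  then have "p' \<noteq> q'" by auto
  then have "\<xi> p' \<noteq> \<xi> q'" by (rule \<xi>_neq)
  then have "\<exists>p q. \<xi> p < \<xi> q \<and> order_type R T p = order_type R T q \<and> map w [p..<p + L] \<noteq> map w [q..<q + L]"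
    using pq' by (metis linorder_neqE)
  then obtain p q where pq: "\<xi> p < \<xi> q" "order_type R T p = order_type R T q"
    "map w [p..<p + L] \<noteq> map w [q..<q + L]" by blast
  define d where "d j = cnt p j - cnt q j" for j
  have d01: "d j = 0 \<or> d j = 1" for j unfolding d_def by (rule cnt_diff_cases[OF pq(1)])
  have d_Suc: "d (Suc j) = d j + int (w (p + j)) - int (w (q + j))" for j
    by (simp add: d_def cnt_Suc)
  have d\<xi>: "\<xi> (p + j) - \<xi> (q + j) = d j - (\<xi> q - \<xi> p)" for j
    using cnt_eq_\<xi>[of p j] cnt_eq_\<xi>[of q j] by (simp add: d_def)
  have letters: "w (p + s) = w (q + s)" if "s < L" "s \<noteq> i" "s \<noteq> i + 1" for s
    by (rule letter_eq_if_order_type_eq[OF pq(2)]) (use that in \<open>simp_all add: T_def\<close>)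
  have low: "d j = 0" if "j \<le> i" for j
    using that
  proof (induction j)
    case 0
    show ?case by (simp add: d_def)
  next
    case (Suc j)
    then show ?case using letters[of j] i by (simp add: d_Suc L_def)
  qed
  have high: "d j = d (i + 2)" if "i + 2 \<le> j" "j \<le> L" for j
    using that
  proof (induction j rule: dec_induct)
    case (step j)
    then show ?case using letters[of j] by (simp add: d_Suc)
  qed simp
  \<comment> \<open>A difference lasting beyond the gap would put the two discrepancies
    \<open>1 - (\<xi> q - \<xi> p)\<close> apart. The common first letter bounds
    \<open>\<xi> q - \<xi> p\<close>, and one suitable letter among the next \<open>G\<close> pushes
    two discrepancies more than 1 apart.\<close>
  have d2: "d (i + 2) = 0"
  proof (rule ccontr)
    assume "d (i + 2) \<noteq> 0"
    then have hi: "d j = 1" if "i + 2 \<le> j" "j \<le> L" for j using high[OF that] d01[of "i + 2"] by simp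
    have w0: "w p = w q" using letters[of 0] i by (simp add: L_def)
    have cl: "\<bar>\<xi> x - \<xi> y\<bar> < 1" for x y by (rule \<xi>_diff_less)
    show False
    proof (cases "w p = 0")
      case True
      have "\<xi> q - \<xi> p < 1 - slope" using cl[of "Suc p" q] True by (simp add: \<xi>_Suc)
      obtain s where s: "s < G" "w (q + (i + 2) + s) = 1" using G(2) by blast
      define j where "j = i + 2 + s"
      have j: "i + 2 \<le> Suc j" "Suc j \<le> L" using s(1) i by (simp_all add: j_def L_def)
      have "\<xi> (q + Suc j) = \<xi> (q + j) + 1 - slope"
        using \<xi>_Suc[of "q + j"] s(2) by (simp add: j_def add.assoc)
      moreover have "\<xi> (p + Suc j) - \<xi> (q + Suc j) = 1 - (\<xi> q - \<xi> p)" using d\<xi>[of "Suc j"] hi[OF j] by simp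
      ultimately have "\<xi> (p + Suc j) - \<xi> (q + j) > 1" using \<open>\<xi> q - \<xi> p < 1 - slope\<close> by linarith
      with cl[of "p + Suc j" "q + j"] show False by simp
    next
      case False
      then have "w q = 1" using w0 w_cases[of p] by auto
      then have "\<xi> q - \<xi> p < slope" using cl[of "Suc q" p] by (simp add: \<xi>_Suc)
      obtain s where s: "s < G" "w (q + (i + 2) + s) = 0" using G(1) by blast
      define j where "j = i + 2 + s"
      have j: "i + 2 \<le> j" "j \<le> L" using s(1) i by (simp_all add: j_def L_def)
      have "\<xi> (q + Suc j) = \<xi> (q + j) - slope"
        using \<xi>_Suc[of "q + j"] s(2) by (simp add: j_def add.assoc)
      moreover have "\<xi> (p + j) - \<xi> (q + j) = 1 - (\<xi> q - \<xi> p)" using d\<xi>[of j] hi[OF j] by simp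
      ultimately have "\<xi> (p + j) - \<xi> (q + Suc j) > 1" using \<open>\<xi> q - \<xi> p < slope\<close> by linarith
      with cl[of "p + j" "q + Suc j"] show False by simp
    qed
  qed
  have zero: "d j = 0" if "j \<le> L" "j \<noteq> i + 1" for j
  proof (cases "j \<le> i")
    case False
    then show ?thesis using that high[of j] d2 by simp
  qed (rule low)
  have "d (i + 1) = 1"
  proof (rule ccontr)
    assume "\<not> ?thesis"
    then have "d (i + 1) = 0" using d01[of "i + 1"] by simp
    then have all: "d j = 0" if "j \<le> L" for j using zero[OF that] by (cases "j = i + 1") simp_all
    have "w (p + s) = w (q + s)" if "s < L" for s
      using d_Suc[of s] all[of s] all[of "Suc s"] that by simp
    then show False using pq(3) unfolding map_upt_eq_iff by blast
  qed
  \<comment> \<open>Dropping the common first letter turns the place \<open>i + 1\<close> of the gap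
    into \<open>i\<close>; that letter served for the bound in \<open>d2\<close>.\<close>
  have "cnt (p + 1) j - cnt (q + 1) j = (if j = i then 1 else 0)" if "j \<le> m" for j
  proof -
    have "cnt (p + 1) j - cnt (q + 1) j = d (1 + j) - d 1"
      using cnt_add[of p 1 j] cnt_add[of q 1 j] by (simp add: d_def)
    also have "\<dots> = d (j + 1)" using low[of 1] i by (simp add: add.commute)
    also have "\<dots> = (if j = i then 1 else 0)"
      using zero[of "j + 1"] \<open>d (i + 1) = 1\<close> that by (auto simp: L_def)
    finally show ?thesis .
  qed
  moreover have "R (p + 1) (p + (1 + m)) \<longleftrightarrow> R (q + 1) (q + (1 + m))"
    by (rule order_type_eqD[OF pq(2)]) (use i in \<open>auto simp: T_def L_def\<close>)
  ultimately show ?thesis by (intro exI[of _ "p + 1"] exI[of _ "q + 1"]) (simp add: add.assoc)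
qed

text \<open>Induction on the number of places where the counts of \<open>p\<close> and
  \<open>q\<close> differ. At such a place \<open>i\<close>, the pair \<open>a\<close>,
  \<open>b\<close> of \<open>ex_neighbours\<close> has the counts of \<open>p\<close> and
  \<open>q\<close>, and the linear order of count vectors squeezes both between them:
  \<open>p\<close>, \<open>a\<close> and \<open>b\<close>, \<open>q\<close> differ at fewer places,
  and \<open>a\<close>, \<open>b\<close> have the same outcome.\<close>

lemma sign_determined_by_cnt:
  assumes "cnt p m = cnt q m"
  shows "R p (p + m) \<longleftrightarrow> R q (q + m)"
  using assms
proof (induction "card {j. j \<le> m \<and> cnt p j \<noteq> cnt q j}" arbitrary: p q rule: less_induct)
  case less
  define I where "I p q = {j. j \<le> m \<and> cnt p j \<noteq> cnt q j}" for p q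
  have finI: "finite (I x y)" for x y by (simp add: I_def)
  have IH: "R x (x + m) \<longleftrightarrow> R y (y + m)" if "card (I x y) < card (I p q)" "cnt x m = cnt y m" for x y
    using less.hyps[of x y] that by (simp add: I_def)
  show ?case
  proof (cases "I p q = {}")
    case True
    then have eq: "cnt p j = cnt q j" if "j \<le> m" for j using that by (auto simp: I_def)
    have "w (p + s) = w (q + s)" if "s < m" for s
      using eq[of s] eq[of "Suc s"] that by (simp add: cnt_Suc)
    then have "order_type R {..m} p = order_type R {..m} q" by (intro order_type_determined) blast
    from order_type_eqD[OF this, of 0 m] show ?thesis by simp
  next
    case False
    have main: "R p (p + m) \<longleftrightarrow> R q (q + m)"
      if h: "\<xi> p < \<xi> q" "I p q \<noteq> {}" "cnt p m = cnt q m"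
        and IH: "\<And>x y. card (I x y) < card (I p q) \<Longrightarrow> cnt x m = cnt y m \<Longrightarrow> R x (x + m) \<longleftrightarrow> R y (y + m)"
      for p q
    proof -
      obtain i where i: "i \<le> m" "cnt p i \<noteq> cnt q i" using h(2) by (auto simp: I_def)
      have i1: "1 \<le> i" using i(2) by (cases i) auto
      have i2: "i < m" using i h(3) by (cases "i = m") auto
      obtain a b where ab: "\<And>j. j \<le> m \<Longrightarrow> cnt a j - cnt b j = (if j = i then 1 else 0)"
        "R a (a + m) \<longleftrightarrow> R b (b + m)"
        using ex_neighbours[OF i1 i2] by blast
      have pqi: "cnt p i - cnt q i = 1" using cnt_diff_cases[OF h(1), of i] i(2) by simp
      have abi: "cnt a i - cnt b i = 1" using ab(1)[OF i(1)] by simp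
      have eqi: "cnt a i = cnt p i" "cnt b i = cnt q i"
        using balanced[of p i b] balanced[of a i q] pqi abi by simp_all
      have less: "\<xi> x < \<xi> y" if "cnt x i - cnt y i = 1" for x y
      proof (rule ccontr)
        assume "\<not> ?thesis"
        moreover have "x \<noteq> y" using that by auto
        ultimately have "\<xi> y < \<xi> x" using \<xi>_neq[of x y] by simp
        from cnt_diff_cases[OF this, of i] that show False by simp
      qed
      have "\<xi> p < \<xi> b" "\<xi> a < \<xi> q" using less pqi abi eqi by simp_all
      then have ge: "cnt p j \<ge> cnt b j" "cnt a j \<ge> cnt q j" for j
        using cnt_diff_cases[of p b j] cnt_diff_cases[of a q j] by auto
      have sand: "cnt p j \<ge> cnt a j" "cnt b j \<ge> cnt q j" if "j \<le> m" for j
        using ge[of j] ab(1)[OF that] eqi by (cases "j = i"; simp)+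
      have sub: "I p a \<subseteq> I p q - {i}" "I b q \<subseteq> I p q - {i}"
      proof -
        have "j \<in> I p q - {i}" if "j \<in> I p a" for j
          using that ge(2)[of j] sand(1)[of j] eqi(1) by (cases "j = i") (auto simp: I_def)
        then show "I p a \<subseteq> I p q - {i}" by (rule subsetI)
        have "j \<in> I p q - {i}" if "j \<in> I b q" for j
          using that ge(1)[of j] sand(2)[of j] eqi(2) by (cases "j = i") (auto simp: I_def)
        then show "I b q \<subseteq> I p q - {i}" by (rule subsetI)
      qed
      have "i \<in> I p q" using i by (simp add: I_def)
      then have lt: "card (I p q - {i}) < card (I p q)" using finI by (intro psubset_card_mono) auto
      have c1: "card (I p a) < card (I p q)" "card (I b q) < card (I p q)"
        using card_mono[OF _ sub(1)] card_mono[OF _ sub(2)] lt finI by simp_all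
      have "cnt p m = cnt a m" "cnt b m = cnt q m"
        using ge[of m] sand[of m] h(3) ab(1)[of m] i2 by simp_all
      with IH[OF c1(1)] IH[OF c1(2)] ab(2) show ?thesis by simp
    qed
    have sym: "I q p = I p q" by (auto simp: I_def)
    have "p \<noteq> q" using False by (auto simp: I_def)
    then have "\<xi> p < \<xi> q \<or> \<xi> q < \<xi> p" using \<xi>_neq[of p q] by linarith
    then show ?thesis
    proof
      assume "\<xi> p < \<xi> q"
      then show ?thesis by (rule main[OF _ False less.prems IH])
    next
      assume "\<xi> q < \<xi> p"
      then have "R q (q + m) \<longleftrightarrow> R p (p + m)"
        by (rule main) (use False sym less.prems IH in auto)
      then show ?thesis ..
    qed
  qed
qed

end

section \<open>Density and the slope threshold\<close>

context sturmian
begin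

lemma slope_irrational: "slope \<notin> \<rat>"
proof
  assume "slope \<in> \<rat>"
  then obtain a b :: int where ab: "slope = of_int a / of_int b" "b > 0" by (meson Rats_cases')
  then have "real (nat b) * slope = of_int a" by simp
  then have "real (nat b) * slope \<in> \<int>" by (simp only: Ints_of_int)
  with slope_notin_Ints[of "nat b"] ab(2) show False by simp
qed

lemma \<xi>_eq_if_close:
  assumes "\<bar>\<xi> n - y\<bar> < 1" "\<xi> n - y \<in> \<int>"
  shows "\<xi> n = y"
proof -
  obtain z :: int where z: "\<xi> n - y = of_int z" using assms(2) by (elim Ints_cases)
  with assms(1) have "z = 0" by linarith
  with z show ?thesis by simp
qed

definition base :: real where
  "base = Inf (range \<xi>)"

lemma \<xi>_bounds: "base \<le> \<xi> n" "\<xi> n \<le> base + 1"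
proof -
  have lo: "\<xi> n - 1 \<le> x" if x: "x \<in> range \<xi>" for x n
  proof -
    obtain k where "x = \<xi> k" using x by blast
    then show ?thesis using \<xi>_diff_less[of n k] by linarith
  qed
  then have "bdd_below (range \<xi>)" by (intro bdd_belowI[of _ "\<xi> 0 - 1"])
  then show "base \<le> \<xi> n" unfolding base_def by (intro cInf_lower) auto
  have "\<xi> n - 1 \<le> base" unfolding base_def by (intro cInf_greatest lo) auto
  then show "\<xi> n \<le> base + 1" by simp
qed

text \<open>Modulo 1 the discrepancies are multiples of the irrational slope, so Kronecker's theorem
  applies; inside a strip of width 1 the residue determines the value. \<open>K\<close> leaves room
  for steps backwards.\<close>

lemma \<xi>_dense:
  assumes "\<epsilon> > 0" "base \<le> p - \<epsilon>" "p + \<epsilon> \<le> base + 1"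
  shows "\<exists>n\<ge>K. \<bar>\<xi> n - p\<bar> < \<epsilon>"
proof -
  obtain h k where k: "k > 0" "\<bar>of_int k * slope - of_int h - (- p - real K * slope)\<bar> < \<epsilon>"
    using sequence_of_fractional_parts_is_dense[OF slope_irrational assms(1)] by blast
  define n where "n = K + nat k"
  define y where "y = of_int h - real n * slope"
  have "real n = real K + of_int k" using k(1) by (simp add: n_def)
  then have y: "\<bar>y - p\<bar> < \<epsilon>" using k(2) by (simp add: y_def algebra_simps)
  have "\<xi> n - y = of_int (ones n - h)" by (simp add: \<xi>_def y_def)
  then have "\<xi> n - y \<in> \<int>" by (simp only: Ints_of_int)
  moreover have "\<bar>\<xi> n - y\<bar> < 1" using \<xi>_bounds[of n] y assms by linarith
  ultimately have "\<xi> n = y" by (intro \<xi>_eq_if_close)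
  with y show ?thesis by (intro exI[of _ n]) (simp add: n_def)
qed

text \<open>Change of \<xi> over a displacement by \<open>m\<close> places with \<open>C\<close>
  ones; integers because displacements may go backwards.\<close>

definition height :: "int \<Rightarrow> int \<Rightarrow> real" where
  "height m C = of_int C - of_int m * slope"

lemma height_eq: "height (int n' - int n) (ones n' - ones n) = \<xi> n' - \<xi> n"
  by (simp add: height_def \<xi>_def algebra_simps)

lemma ones_diff_if_in_strip:
  assumes "int n' = int n + m" "base < \<xi> n + height m C" "\<xi> n + height m C < base + 1"
  shows "ones n' - ones n = C"
proof -
  have "real n' = real n + of_int m" using assms(1) by (metis of_int_add of_int_of_nat_eq)
  then have e: "\<xi> n' - (\<xi> n + height m C) = of_int (ones n' - ones n - C)"
    by (simp add: height_def \<xi>_def algebra_simps)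
  then have "\<xi> n' - (\<xi> n + height m C) \<in> \<int>" by (simp only: Ints_of_int)
  moreover have "\<bar>\<xi> n' - (\<xi> n + height m C)\<bar> < 1" using \<xi>_bounds[of n'] assms by linarith
  ultimately have "\<xi> n' = \<xi> n + height m C" by (intro \<xi>_eq_if_close)
  with e show ?thesis by simp
qed

text \<open>The start and the ends of the first and second step have relative heights pairwise below
  1 in modulus, so they span less than the strip, and by density a start exists for which all three
  lie inside.\<close>

lemma realize_two_steps:
  assumes "\<bar>height m C\<bar> < 1" "\<bar>height m' C'\<bar> < 1" "\<bar>height (m + m') (C + C')\<bar> < 1"
  shows "\<exists>n n' n''. int n' = int n + m \<and> int n'' = int n' + m' \<and>
    ones n' - ones n = C \<and> ones n'' - ones n' = C'"
proof -
  let ?h = "height m C" and ?k = "height (m + m') (C + C')"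
  have add: "?k = ?h + height m' C'" by (simp add: height_def algebra_simps)
  define lo where "lo = min 0 (min ?h ?k)"
  define hi where "hi = max 0 (max ?h ?k)"
  have lohi: "lo \<le> 0" "lo \<le> ?h" "lo \<le> ?k" "0 \<le> hi" "?h \<le> hi" "?k \<le> hi" "hi - lo < 1"
    using assms unfolding add lo_def hi_def by (auto simp: min_def max_def abs_less_iff)
  define \<epsilon> where "\<epsilon> = (1 - (hi - lo)) / 2"
  define p where "p = base + \<epsilon> - lo"
  have "\<epsilon> > 0" using lohi by (simp add: \<epsilon>_def)
  moreover have "base \<le> p - \<epsilon>" "p + \<epsilon> \<le> base + 1"
    using lohi by (simp_all add: p_def \<epsilon>_def field_simps)
  ultimately obtain n where n: "n \<ge> nat \<bar>m\<bar> + nat \<bar>m'\<bar>" "\<bar>\<xi> n - p\<bar> < \<epsilon>"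
    using \<xi>_dense[of \<epsilon> p "nat \<bar>m\<bar> + nat \<bar>m'\<bar>"] by auto
  have "p + hi = base + 1 - \<epsilon>" by (simp add: p_def \<epsilon>_def field_simps)
  then have strip: "base < \<xi> n + x" "\<xi> n + x < base + 1" if "lo \<le> x" "x \<le> hi" for x
    using n(2) that unfolding p_def abs_less_iff by linarith+
  define n' where "n' = nat (int n + m)"
  define n'' where "n'' = nat (int n + (m + m'))"
  have i: "int n' = int n + m" "int n'' = int n + (m + m')" using n(1) by (auto simp: n'_def n''_def)
  have "ones n' - ones n = C"
    by (rule ones_diff_if_in_strip[OF i(1)]) (use strip lohi in auto)
  moreover have "ones n'' - ones n = C + C'"
    by (rule ones_diff_if_in_strip[OF i(2)]) (use strip lohi in auto)
  ultimately show ?thesis using i by (intro exI[of _ n] exI[of _ n'] exI[of _ n'']) auto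
qed

end

text \<open>A fraction of denominator \<open>m\<close> is within \<open>1 / m\<close> of \<theta>,
  so away from \<theta> denominators are bounded and the set is locally finite; a limit other than
  \<theta> is therefore attained.\<close>

lemma limit_ratio_attained:
  fixes W :: "real set"
  assumes ratio: "\<And>u. u \<in> W \<Longrightarrow> \<exists>m C. m \<ge> 1 \<and> u = of_int C / real m \<and> \<bar>u - \<theta>\<bar> < 1 / real m"
    and "0 < \<theta>" "\<theta> < 1" and lim: "\<And>\<epsilon>. \<epsilon> > 0 \<Longrightarrow> \<exists>u\<in>W. \<bar>u - s\<bar> < \<epsilon>" and "s \<noteq> \<theta>"
  shows "s \<in> W"
proof (rule ccontr)
  assume "s \<notin> W"
  define \<epsilon> where "\<epsilon> = \<bar>s - \<theta>\<bar> / 2"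
  have \<epsilon>: "\<epsilon> > 0" using assms(5) by (simp add: \<epsilon>_def)
  define F where "F = {u \<in> W. \<bar>u - s\<bar> < \<epsilon>}"
  obtain M :: nat where M: "1 / \<epsilon> < real M" using reals_Archimedean2 by blast
  have "F \<subseteq> (\<lambda>(m, C). of_int C / real m) ` ({..M} \<times> {- 2 * int M..2 * int M})"
  proof
    fix u assume u: "u \<in> F"
    then obtain m C where m: "m \<ge> 1" "u = of_int C / real m" "\<bar>u - \<theta>\<bar> < 1 / real m"
      using ratio[of u] by (auto simp: F_def)
    have "\<bar>u - \<theta>\<bar> > \<epsilon>" using u unfolding F_def \<epsilon>_def by (auto simp: abs_if split: if_splits)
    with m(3) have "\<epsilon> < 1 / real m" by linarith
    then have "real m < 1 / \<epsilon>" using \<epsilon> m(1) by (simp add: field_simps)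
    with M have mM: "m \<le> M" by linarith
    have "1 / real m \<le> 1" using m(1) by simp
    with m(3) assms(2,3) have "\<bar>u\<bar> < 2" by linarith
    then have "\<bar>real_of_int C\<bar> < 2 * real m" using m(1,2) by (simp add: field_simps)
    then have "\<bar>C\<bar> < 2 * int m" by linarith
    with mM have "C \<in> {- 2 * int M..2 * int M}" by auto
    with mM m(2) show "u \<in> (\<lambda>(m, C). of_int C / real m) ` ({..M} \<times> {- 2 * int M..2 * int M})"
      by (intro image_eqI[of _ _ "(m, C)"]) auto
  qed
  then have finF: "finite F" by (rule finite_subset) simp
  have "F \<noteq> {}" using lim[OF \<epsilon>] by (auto simp: F_def)
  define \<delta> where "\<delta> = Min ((\<lambda>u. \<bar>u - s\<bar>) ` F)"
  have "\<delta> \<in> (\<lambda>u. \<bar>u - s\<bar>) ` F" unfolding \<delta>_def using finF \<open>F \<noteq> {}\<close> by (intro Min_in) auto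
  then have "\<delta> > 0" "\<delta> < \<epsilon>" using \<open>s \<notin> W\<close> by (auto simp: F_def)
  from lim[OF this(1)] obtain u where u: "u \<in> W" "\<bar>u - s\<bar> < \<delta>" by blast
  with \<open>\<delta> < \<epsilon>\<close> have "u \<in> F" by (simp add: F_def)
  then have "\<delta> \<le> \<bar>u - s\<bar>" unfolding \<delta>_def using finF by (intro Min_le) auto
  with u(2) show False by simp
qed

section \<open>Ascending displacements and the threshold\<close>

context sturmian_order
begin

text \<open>A displacement that ascends once ascends at every occurrence
  (\<open>ascends_all\<close>), backward displacements included.\<close>

definition ascends :: "int \<Rightarrow> int \<Rightarrow> bool" where
  "ascends m C \<longleftrightarrow> (\<exists>n n'. int n' = int n + m \<and> ones n' - ones n = C \<and> R n n')"

lemma ascends_all: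
  assumes "ascends m C" "int n' = int n + m" "ones n' - ones n = C"
  shows "R n n'"
proof -
  obtain k k' where k: "int k' = int k + m" "ones k' - ones k = C" "R k k'"
    using assms(1) unfolding ascends_def by blast
  show ?thesis
  proof (cases "m \<ge> 0")
    case True
    define l where "l = nat m"
    have e: "k' = k + l" "n' = n + l" using True k(1) assms(2) by (auto simp: l_def)
    then have "cnt k l = cnt n l" using k(2) assms(3) by (simp add: cnt_def)
    from sign_determined_by_cnt[OF this] k(3) e show ?thesis by simp
  next
    case False
    define l where "l = nat (- m)"
    have e: "k = k' + l" "n = n' + l" "l \<noteq> 0" using False k(1) assms(2) by (auto simp: l_def)
    then have "cnt k' l = cnt n' l" using k(2) assms(3) by (simp add: cnt_def)
    from sign_determined_by_cnt[OF this] k(3) e flip[of k' k] flip[of n' n] show ?thesis by simp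
  qed
qed

lemma ascends_height: "ascends m C \<Longrightarrow> \<bar>height m C\<bar> < 1"
  unfolding ascends_def using height_eq \<xi>_diff_less by (metis add_diff_cancel_left')

lemma ascends_0: "\<not> ascends 0 C"
  unfolding ascends_def using irrefl by auto

text \<open>Realizing both displacements in succession reduces this to transitivity; the bound on
  the height guarantees that such an occurrence exists.\<close>

lemma ascends_add:
  assumes "ascends m C" "ascends m' C'" "\<bar>height (m + m') (C + C')\<bar> < 1"
  shows "ascends (m + m') (C + C')"
proof -
  obtain n n' n'' where n: "int n' = int n + m" "int n'' = int n' + m'"
    "ones n' - ones n = C" "ones n'' - ones n' = C'"
    using realize_two_steps[OF assms(1,2)[THEN ascends_height] assms(3)] by blast
  have "R n n'" "R n' n''"
    using ascends_all[OF assms(1) n(1,3)] ascends_all[OF assms(2) n(2,4)] by blast+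
  then have "R n n''" by (rule trans)
  with n show ?thesis unfolding ascends_def by (intro exI[of _ n] exI[of _ n'']) auto
qed

text \<open>Adding the steps in an order that keeps the height in \<open>(-1, 1)\<close>, every partial sum ascends.\<close>

lemma no_zero_sum:
  assumes "ascends m C" "\<And>v. v \<in> set vs \<Longrightarrow> ascends (fst v) (snd v)"
    and "m + sum_list (map fst vs) = 0" "C + sum_list (map snd vs) = 0"
  shows False
  using assms
proof (induction "length vs" arbitrary: vs m C)
  case 0
  then show ?case using ascends_0 by simp
next
  case (Suc l)
  let ?h = "\<lambda>v. height (fst v) (snd v)"
  have sum: "height m C + sum_list (map ?h us) = height (m + sum_list (map fst us)) (C + sum_list (map snd us))" for us
    by (induction us) (simp_all add: height_def algebra_simps)
  have sum0: "height m C + sum_list (map ?h vs) = 0"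
    using sum[of vs] Suc.prems(3,4) by (simp add: height_def)
  have "vs \<noteq> []" using Suc.hyps(2) by auto
  \<comment> \<open>The heights add up to 0, so some remaining step does not have the sign of the
    current height, and adding it stays within (-1, 1).\<close>
  have "\<exists>v\<in>set vs. height m C * ?h v \<le> 0"
  proof (rule ccontr)
    assume "\<not> ?thesis"
    then have "\<forall>v\<in>set vs. height m C * ?h v > 0" by auto
    with \<open>vs \<noteq> []\<close> have "sum_list (map (\<lambda>v. height m C * ?h v) vs) > 0"
      by (induction vs rule: list_nonempty_induct) auto
    then have "0 < height m C * sum_list (map ?h vs)" by (simp add: sum_list_const_mult)
    moreover have "sum_list (map ?h vs) = - height m C" using sum0 by simp
    ultimately show False by (simp add: not_square_less_zero)
  qed
  then obtain v where v: "v \<in> set vs" "height m C * ?h v \<le> 0" by blast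
  then have "\<bar>height m C + ?h v\<bar> < 1"
    using ascends_height[OF Suc.prems(2)[OF v(1)]] ascends_height[OF Suc.prems(1)]
    by (auto simp: mult_le_0_iff abs_less_iff)
  with v(1) have v: "v \<in> set vs" "\<bar>height m C + ?h v\<bar> < 1" by simp_all
  have "height (m + fst v) (C + snd v) = height m C + ?h v" by (simp add: height_def algebra_simps)
  with v have asc: "ascends (m + fst v) (C + snd v)"
    by (intro ascends_add Suc.prems(1,2)) auto
  show False
  proof (rule Suc.hyps(1)[OF _ asc, of "remove1 v vs"])
    show "l = length (remove1 v vs)" using Suc.hyps(2) v(1) by (simp add: length_remove1)
    show "ascends (fst u) (snd u)" if "u \<in> set (remove1 v vs)" for u
      using that Suc.prems(2) set_remove1_subset by fastforce
    show "m + fst v + sum_list (map fst (remove1 v vs)) = 0"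
      using Suc.prems(3) sum_list_map_remove1[OF v(1), of fst] by simp
    show "C + snd v + sum_list (map snd (remove1 v vs)) = 0"
      using Suc.prems(4) sum_list_map_remove1[OF v(1), of snd] by simp
  qed
qed

lemma ascends_unit: "ascends 1 0" "ascends (- 1) (- 1)"
proof -
  obtain n where n: "w n = 0" using ex_letter(1) by blast
  then have "ones (Suc n) - ones n = 0" by (simp add: ones_def)
  with n show "ascends 1 0" unfolding ascends_def w_iff by (intro exI[of _ n] exI[of _ "Suc n"]) simp
  obtain k where k: "w k = 1" using ex_letter(2) by blast
  then have "ones k - ones (Suc k) = -1" "R (Suc k) k"
    using w_iff[of k] flip[of k "Suc k"] by (auto simp: ones_def)
  then show "ascends (- 1) (- 1)" unfolding ascends_def by (intro exI[of _ "Suc k"] exI[of _ k]) simp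
qed

text \<open>Otherwise \<open>m'\<close> copies of the first displacement and \<open>m\<close> of the
  second leave a surplus of \<open>j\<close> ones, which \<open>j\<close> pairs of the unit steps
  \<open>(1, 0)\<close> and \<open>(- 1, - 1)\<close> cancel: a closed chain of ascents.\<close>

lemma ascent_ratio_less:
  assumes "ascends (int m) C" "ascends (- int m') (- C')" "m \<ge> 1" "m' \<ge> 1"
  shows "C * int m' < C' * int m"
proof (rule ccontr)
  assume ge: "\<not> ?thesis"
  define j where "j = nat (C * int m' - C' * int m)"
  have j: "int j = C * int m' - C' * int m" using ge by (simp add: j_def)
  obtain k where k: "m' = Suc k" using assms(4) by (cases m') auto
  define vs where "vs = replicate k (int m, C) @ replicate m (- int m', - C') @
    replicate j (1, 0) @ replicate j (- 1, - 1)"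
  show False
  proof (rule no_zero_sum[OF assms(1), of vs])
    show "ascends (fst v) (snd v)" if "v \<in> set vs" for v
      using that assms(1,2) ascends_unit by (auto simp: vs_def)
    show "int m + sum_list (map fst vs) = 0"
      by (simp add: vs_def sum_list_replicate k algebra_simps)
    show "C + sum_list (map snd vs) = 0"
      by (simp add: vs_def sum_list_replicate j, simp add: k algebra_simps)
  qed
qed

lemma ratio_close:
  assumes "\<bar>height m C\<bar> < 1" "\<bar>m\<bar> = int k" "k \<ge> 1"
  shows "\<bar>of_int C / of_int m - slope\<bar> < 1 / real k"
proof -
  have m: "m \<noteq> 0" "\<bar>real_of_int m\<bar> = real k" using assms(2,3) by auto
  have "of_int C / of_int m - slope = height m C / of_int m"
    using m(1) by (simp add: height_def field_simps)
  then have "\<bar>of_int C / of_int m - slope\<bar> = \<bar>height m C\<bar> / real k" by (simp add: abs_divide m(2))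
  also have "\<dots> < 1 / real k" using assms(1,3) by (simp add: divide_strict_right_mono)
  finally show ?thesis .
qed

text \<open>\<open>U\<close> and \<open>V\<close> collect the ratios of ones in ascending and
  descending blocks; \<open>U\<close> lies below \<open>V\<close>. If \<open>Sup U < Inf V\<close>,
  their midpoint will do. A common bound other than the slope would be attained on both sides; if it
  is the slope, irrationality keeps it out of both. The unit steps put 0 into \<open>U\<close> and 1
  into \<open>V\<close>, whence \<open>0 < x < 1\<close>.\<close>

lemma ex_threshold:
  "\<exists>x. 0 < x \<and> x < 1 \<and> (\<forall>n m. m \<ge> 1 \<longrightarrow>
     (if R n (n + m) then of_int (cnt n m) < real m * x else real m * x < of_int (cnt n m)))"
proof -
  define U where "U = {of_int C / real m |m C. m \<ge> 1 \<and> ascends (int m) C}"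
  define V where "V = {of_int C / real m |m C. m \<ge> 1 \<and> ascends (- int m) (- C)}"
  have UV: "u < v" if uv: "u \<in> U" "v \<in> V" for u v
  proof -
    obtain m C where u: "u = of_int C / real m" "m \<ge> 1" "ascends (int m) C" using uv(1) by (auto simp: U_def)
    obtain m' C' where v: "v = of_int C' / real m'" "m' \<ge> 1" "ascends (- int m') (- C')"
      using uv(2) by (auto simp: V_def)
    have "C * int m' < C' * int m" by (rule ascent_ratio_less[OF u(3) v(3) u(2) v(2)])
    then have "real_of_int (C * int m') < real_of_int (C' * int m)" by (simp only: of_int_less_iff)
    then show ?thesis unfolding u(1) v(1) using u(2) v(2) by (simp add: field_simps)
  qed
  have ratio: "\<exists>m C. m \<ge> 1 \<and> u = of_int C / real m \<and> \<bar>u - slope\<bar> < 1 / real m" if u: "u \<in> U \<union> V" for u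
  proof -
    obtain m C where u: "u = of_int C / real m" "m \<ge> 1" "ascends (int m) C \<or> ascends (- int m) (- C)"
      using u by (auto simp: U_def V_def)
    then have "\<bar>height (int m) C\<bar> < 1"
      using ascends_height[of "int m" C] ascends_height[of "- int m" "- C"]
      by (auto simp: height_def abs_minus_commute)
    from ratio_close[OF this _ u(2)] u show ?thesis by (intro exI[of _ m] exI[of _ C]) simp
  qed
  have irr: "u \<noteq> slope" if "u \<in> U \<union> V" for u
  proof
    assume "u = slope"
    moreover have "\<exists>m C. u = of_int C / real m" using that by (auto simp: U_def V_def)
    ultimately show False using slope_irrational by (metis Rats_divide Rats_of_int Rats_of_nat)
  qed
  have "0 \<in> U" unfolding U_def using ascends_unit(1) by (intro CollectI exI[of _ 1] exI[of _ 0]) simp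
  have "1 \<in> V" unfolding V_def using ascends_unit(2) by (intro CollectI exI[of _ 1]) simp
  have bdd: "bdd_above U" "bdd_below V"
    using UV \<open>0 \<in> U\<close> \<open>1 \<in> V\<close> by (meson bdd_aboveI bdd_belowI less_imp_le)+
  define s where "s = Sup U"
  define t where "t = Inf V"
  have sU: "u \<le> s" if "u \<in> U" for u unfolding s_def by (rule cSup_upper[OF that bdd(1)])
  have tV: "t \<le> v" if "v \<in> V" for v unfolding t_def by (rule cInf_lower[OF that bdd(2)])
  have "s \<le> v" if "v \<in> V" for v
    unfolding s_def using UV that \<open>0 \<in> U\<close> by (intro cSup_least) (auto intro: less_imp_le)
  then have st: "s \<le> t" unfolding t_def using \<open>1 \<in> V\<close> by (intro cInf_greatest) auto
  have "\<exists>x. (\<forall>u\<in>U. u < x) \<and> (\<forall>v\<in>V. x < v)"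
  proof (cases "s < t")
    case True
    define x where "x = (s + t) / 2"
    have "s < x" "x < t" using True by (simp_all add: x_def)
    then show ?thesis using sU tV by (intro exI[of _ x]) fastforce
  next
    case False
    with st have eq: "s = t" by simp
    have "s = slope"
    proof (rule ccontr)
      assume ne: "s \<noteq> slope"
      have "s \<in> U"
      proof (rule limit_ratio_attained[OF ratio[OF UnI1] slope_bounds _ ne])
        fix \<epsilon> :: real assume "\<epsilon> > 0"
        then obtain u where "u \<in> U" "s - \<epsilon> < u"
          using less_cSup_iff[OF _ bdd(1), of "s - \<epsilon>"] \<open>0 \<in> U\<close> unfolding s_def[symmetric] by auto
        with sU[of u] show "\<exists>u\<in>U. \<bar>u - s\<bar> < \<epsilon>" by (intro bexI[of _ u]) auto
      qed
      moreover have "t \<in> V"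
      proof (rule limit_ratio_attained[OF ratio[OF UnI2] slope_bounds])
        fix \<epsilon> :: real assume "\<epsilon> > 0"
        then obtain v where "v \<in> V" "v < t + \<epsilon>"
          using cInf_less_iff[OF _ bdd(2), of "t + \<epsilon>"] \<open>1 \<in> V\<close> unfolding t_def[symmetric] by auto
        with tV[of v] show "\<exists>u\<in>V. \<bar>u - t\<bar> < \<epsilon>" by (intro bexI[of _ v]) auto
      next
        show "t \<noteq> slope" using ne unfolding eq .
      qed
      ultimately show False using UV eq by blast
    qed
    then have "u < s" if "u \<in> U" for u using sU[OF that] irr[of u] that by simp
    moreover have "s < v" if "v \<in> V" for v using tV[OF that] irr[of v] that eq \<open>s = slope\<close> by force
    ultimately show ?thesis by blast
  qed
  then obtain x where x: "\<And>u. u \<in> U \<Longrightarrow> u < x" "\<And>v. v \<in> V \<Longrightarrow> x < v" by blast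
  have "if R n (n + m) then of_int (cnt n m) < real m * x else real m * x < of_int (cnt n m)" if m: "m \<ge> 1" for n m
  proof (cases "R n (n + m)")
    case True
    then have "ascends (int m) (cnt n m)"
      unfolding ascends_def by (intro exI[of _ n] exI[of _ "n + m"]) (simp add: cnt_def)
    then have "of_int (cnt n m) / real m \<in> U" using m unfolding U_def by blast
    from x(1)[OF this] True m show ?thesis by (simp add: field_simps)
  next
    case False
    then have "R (n + m) n" using flip[of n "n + m"] m by simp
    then have "ascends (- int m) (- cnt n m)"
      unfolding ascends_def by (intro exI[of _ "n + m"] exI[of _ n]) (simp add: cnt_def)
    then have "of_int (cnt n m) / real m \<in> V" using m unfolding V_def by blast
    from x(2)[OF this] False m show ?thesis by (simp add: field_simps)
  qed
  moreover have "0 < x" "x < 1" using x(1)[OF \<open>0 \<in> U\<close>] x(2)[OF \<open>1 \<in> V\<close>] by simp_all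
  ultimately show ?thesis by blast
qed

lemma ex_steps: "\<exists>x y. admissible_steps w x y \<and> (\<forall>i j. R i j \<longleftrightarrow> sturmian_seq w x y 0 i < sturmian_seq w x y 0 j)"
proof -
  obtain x where x: "0 < x" "x < 1"
    and th: "\<And>n m. m \<ge> 1 \<Longrightarrow> if R n (n + m) then of_int (cnt n m) < real m * x else real m * x < of_int (cnt n m)"
    using ex_threshold by blast
  \<comment> \<open>Normalized to \<open>x + y = 1\<close>: a block of \<open>m\<close> letters then
    moves by \<open>m * x\<close> minus its number of ones, whose sign the threshold
    decides.\<close>
  define s where "s = sturmian_seq w x (1 - x) 0"
  have s: "s (n + m) = s n + real m * x - of_int (cnt n m)" for n m
    using sturmian_seq_eq[of x "1 - x" 0 n m] by (simp add: s_def)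
  have range: "range w \<subseteq> {0, 1}" using sturmian by (simp add: sturmian_word_def)
  have "admissible_steps w x (1 - x)" unfolding admissible_steps_def
  proof (intro conjI allI impI ballI)
    fix n u assume n: "n \<ge> 1" "u \<in> factors w n"
    then obtain i where u: "u = map w [i..<i + n]" by (auto simp: factors_def)
    have "s (i + n) \<noteq> s i" using th[OF n(1), of i] by (auto simp: s split: if_splits)
    with sturmian_seq_add[OF range, of x "1 - x" 0 i n]
    show "real (count_list u 0) * x \<noteq> real (count_list u 1) * (1 - x)" unfolding u s_def by auto
  qed (use x in auto)
  moreover have "R i j \<longleftrightarrow> s i < s j" for i j
  proof -
    have less: "R i j \<longleftrightarrow> s i < s j" "R j i \<longleftrightarrow> s j < s i" if "i < j" for i j
    proof -
      define m where "m = j - i"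
      have m: "m \<ge> 1" "j = i + m" using that by (simp_all add: m_def)
      show "R i j \<longleftrightarrow> s i < s j" "R j i \<longleftrightarrow> s j < s i"
        using th[OF m(1), of i] s[of i m] flip[of i j] that unfolding m(2)
        by (auto split: if_splits)
    qed
    show ?thesis using less[of i j] less[of j i] irrefl by (cases i j rule: linorder_cases) auto
  qed
  ultimately show ?thesis unfolding s_def by blast
qed

end

theorem sturmian_perm_if_complexity:
  assumes le: "\<And>n. n \<ge> 1 \<Longrightarrow> max_pattern_complexity \<alpha> n = n"
  shows "sturmian_perm \<alpha>"
proof -
  let ?R = "perm_less \<alpha>"
  interpret index_order ?R by (rule index_order_perm_less)
  interpret low_order ?R
    by unfold_locales (rule card_order_types_le_if_max_le, simp add: le)
  have aper: "\<not> order_periodic ?R"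
  proof
    assume "order_periodic ?R"
    then obtain C where C: "\<And>T. finite T \<Longrightarrow> card (range (order_type ?R T)) \<le> C"
      using order_periodic_bounded irrefl by blast
    have "max_pattern_complexity \<alpha> (Suc C) \<in> {window_complexity \<alpha> T |T. window T \<and> card T = Suc C}"
      unfolding max_pattern_complexity_def
      by (intro Max_in finite_window_complexities window_complexities_nonempty) simp
    then obtain T where "window T" "max_pattern_complexity \<alpha> (Suc C) = window_complexity \<alpha> T" by blast
    with C[of T] le[of "Suc C"] show False
      by (simp add: window_def window_complexity_def window_factor_eq)
  qed
  define w where "w n = (if ?R n (n + 1) then 0 else 1 :: nat)" for n
  have w01: "range w \<subseteq> {0, 1}" by (auto simp: w_def)
  then have finw: "finite (range w)" by (rule finite_subset) simp
  have w_iff: "w n = 0 \<longleftrightarrow> ?R n (n + 1)" for n by (simp add: w_def)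
  have nper: "\<not> ev_periodic w"
  proof
    assume "ev_periodic w"
    then obtain p N where p: "p \<ge> 1" "\<forall>n\<ge>N. w (n + p) = w n" by (auto simp: ev_periodic_def)
    then have "\<forall>n\<ge>N. ?R (n + p) (n + p + 1) = ?R n (n + 1)" using w_iff by metis
    with p(1) have "ev_periodic (\<lambda>n. ?R n (n + 1))" unfolding ev_periodic_def by blast
    with order_periodic_if_ev_periodic aper show False by blast
  qed
  have "card (factors w k) \<le> k + 1" for k
  proof -
    have "finite (factors w k) \<and> card (factors w k) \<le> card {..k}"
    proof (rule card_le_if_observed[of "{..k}" "factors w k" UNIV "\<lambda>i. map w [i..<i + k]"])
      show "\<exists>n\<in>UNIV. map w [n..<n + k] = x" if "x \<in> factors w k" for x
        using that by (auto simp: factors_def)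
      fix n n' assume eq: "order_type ?R {..k} n = order_type ?R {..k} n'"
      show "map w [n..<n + k] = map w [n'..<n' + k]" unfolding map_upt_eq_iff
      proof (intro allI impI)
        fix s assume "s < k"
        then have "?R (n + s) (n + Suc s) \<longleftrightarrow> ?R (n' + s) (n' + Suc s)"
          by (intro order_type_eqD[OF eq]) auto
        then show "w (n + s) = w (n' + s)" by (simp add: w_def)
      qed
    qed auto
    then show ?thesis by simp
  qed
  with morse_hedlund[OF finw nper] have "card (factors w k) = k + 1" for k
    by (simp add: le_antisym)
  with w01 have sw: "sturmian_word w" by (simp add: sturmian_word_def)
  interpret sturmian_order ?R w by unfold_locales (rule sw, rule w_iff)
  obtain x y where xy: "admissible_steps w x y"
    "\<And>i j. ?R i j \<longleftrightarrow> sturmian_seq w x y 0 i < sturmian_seq w x y 0 j"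
    using ex_steps by blast
  have "\<alpha> = perm_class (sturmian_seq w x y 0)"
    by (rule infperm_eqI) (simp add: perm_less_perm_class[OF inj_sturmian_seq[OF sw xy(1)]] xy(2))
  with sw xy(1) show ?thesis unfolding sturmian_perm_def by blast
qed

theorem theorem6:
  fixes \<alpha> :: infperm
  shows "(\<not> ultimately_periodic \<alpha> \<longrightarrow> (\<forall>n\<ge>1. max_pattern_complexity \<alpha> n \<ge> n)) \<and>
         ((\<forall>n\<ge>1. max_pattern_complexity \<alpha> n = n) \<longleftrightarrow> sturmian_perm \<alpha>)"
  using max_pattern_complexity_ge sturmian_perm_complexity sturmian_perm_if_complexity by blast

end
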